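(* Let $d\ge2$ and let $W=(W^{(1)},\dots,W^{(d)})$ be a $d$-dimensional Brownian sheet. Let $x\in\mathbb{R}^d\mapsto\xi(x)=(\xi_{i,j}(x))_{i,j=1,\dots,d}$ be the 2D-stochastic current over $W$, given by $$\xi_{i,j}(x)=\delta^{i}_{(u_1,v_1)}\,\delta^{j}_{(u_2,v_2)}\Big(\Delta(x-W_{u_1,v_2})\,1_{[0,u_1]}(u_2)\,1_{[0,v_2]}(v_1)\Big),\qquad i,j=1,\dots,d.$$ Then, for almost all $\omega$, $\xi$ belongs to the Sobolev space $H^{-r}(\mathbb{R}^d;\mathbb{R}^{d\times d})$ for every $r>\frac d2$.
   Context: $d$-dimensional Brownian sheet: the components $W^{(k)}=(W^{(k)}_{s,t})_{s,t\in[0,1]}$, $k=1,\dots,d$, are mutually independent real Wiener sheets, i.e. centered Gaussian processes with $\mathbf{E}[W^{(k)}_{s,t}W^{(k)}_{s',t'}]=(s\wedge s')(t\wedge t')$. Each $W^{(k)}$ is identified with an isonormal Gaussian process over $L^2([0,1]^2)$ via $W^{(k)}_{s,t}=W^{(k)}(1_{[0,s]\times[0,t]})$. $I^k_n$ denotes the multiple Wiener-Itô integral of order $n$ with respect to $W^{(k)}$ (extended to complex kernels by linearity), with $\mathbf{E}[I^k_n(f)I^k_m(g)]=\mathbf 1_{n=m}n!\langle\tilde f,\tilde g\rangle_{L^2(([0,1]^2)^n)}$ for real kernels, $\tilde f$ being the symmetrization of $f$. Dirac functional: with $H_m(y)=\frac{(-1)^m}{m!}e^{y^2/2}\frac{d^m}{dy^m}e^{-y^2/2}$,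 $p_s(y)=\frac{1}{\sqrt{2\pi s}}e^{-y^2/(2s)}$ and $a_m^{y}(u,v)=(uv)^{-m/2}p_{uv}(y)H_m(y/\sqrt{uv})$ for $y\in\mathbb{R}$, $u,v\in(0,1]$, one has $$\Delta(x-W_{u,v})=\prod_{k=1}^d\Delta(x_k-W^{(k)}_{u,v}),\qquad \Delta(x_k-W^{(k)}_{u,v})=\sum_{m\ge0}a_m^{x_k}(u,v)\,I^k_m\big(1_{[0,u]\times[0,v]}^{\otimes m}\big),$$ understood as a formal chaos series (a distribution in the Watanabe sense). Divergence: $\delta^k$ is the divergence (Skorohod) integral with respect to $W^{(k)}$. In $\xi_{i,j}$, $\delta^j$ acts in the variable $(u_2,v_2)\in[0,1]^2$ and $\delta^i$ in the variable $(u_1,v_1)\in[0,1]^2$. On chaos expansions, $\delta^k_{z}$ applied to $\sum_n I_n^k(f_n(\cdot\,;z))$ gives $\sum_n I^k_{n+1}(\tilde f_n)$, with $\tilde f_n$ the symmetrization in all $n+1$ variables; integrals with respect to the other, independent components behave as deterministic coefficients. Fourier transform and Sobolev space: the convention is $\hat f(x)=\int_{\mathbb{R}^d}e^{-i\langle x,y\rangle}f(y)\,dy$. The Fourier transform $\hat\xi_{i,j}$ of $x\mapsto\xi_{i,j}(x)$ is taken chaos by chaos: in the chaos expansion of $\xi_{i,j}(x)$, whose kernels depend on $x$ only through the products $\prod_k a_{m_k}^{x_k}(u_1,v_2)$, each such function of $x$ is replaced by its Fourier transform. $H^{-r}(\mathbb{R}^d;\mathbb{R}^{d\times d})$ is the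 space of $\mathbb{R}^{d\times d}$-valued (tempered) distributions $\varphi$ with $\int_{\mathbb{R}^d}(1+|x|^2)^{-r}|\hat\varphi(x)|^2dx<\infty$, where $|\cdot|$ on matrices is the Euclidean (Frobenius) norm. The current $\xi$ is regarded as the random distribution in $x$ whose Fourier transform is (a jointly measurable version of) $(\hat\xi_{i,j})_{i,j}$; membership in $H^{-r}$ for almost all $\omega$ means that $\int_{\mathbb{R}^d}(1+|x|^2)^{-r}|\hat\xi(x)|^2dx<\infty$ almost surely. *)

theory Defs
  imports "HOL-Probability.Probability"
begin

section \<open>The Brownian sheet\<close>

definition unit_square :: "(real \<times> real) set" where
  "unit_square = {0..1} \<times> {0..1}"

text \<open>Degenerate Gaussian laws (variance zero) are allowed.\<close>

definition centered_gaussian_rv :: "'w measure \<Rightarrow> ('w \<Rightarrow> real) \<Rightarrow> bool" where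
  "centered_gaussian_rv M X \<longleftrightarrow>
     X \<in> borel_measurable M \<and>
     (distr M borel X = return borel 0 \<or>
      (\<exists>\<sigma>>0. distributed M lborel X (\<lambda>x. ennreal (normal_density 0 \<sigma> x))))"

definition centered_gaussian_process :: "'w measure \<Rightarrow> 'i set \<Rightarrow> ('i \<Rightarrow> 'w \<Rightarrow> real) \<Rightarrow> bool" where
  "centered_gaussian_process M T X \<longleftrightarrow>
     (\<forall>S c. finite S \<and> S \<subseteq> T \<longrightarrow> centered_gaussian_rv M (\<lambda>\<omega>. \<Sum>p\<in>S. c p * X p \<omega>))"

definition wiener_sheet :: "'w measure \<Rightarrow> (real \<times> real \<Rightarrow> 'w \<Rightarrow> real) \<Rightarrow> bool" where
  "wiener_sheet M B \<longleftrightarrow>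
     centered_gaussian_process M unit_square B \<and>
     (\<forall>(s, t)\<in>unit_square. \<forall>(s', t')\<in>unit_square.
        (LINT \<omega>|M. B (s, t) \<omega> * B (s', t') \<omega>) = min s s' * min t t')"

text \<open>The dimension is the cardinality of the finite index type \<open>'d\<close>. Independence is that of
  the components viewed as random elements of the product space over the unit square.\<close>

definition brownian_sheet :: "'w measure \<Rightarrow> ('d::finite \<Rightarrow> real \<times> real \<Rightarrow> 'w \<Rightarrow> real) \<Rightarrow> bool" where
  "brownian_sheet M W \<longleftrightarrow>
     prob_space M \<and>
     (\<forall>k. wiener_sheet M (W k)) \<and>
     prob_space.indep_vars M (\<lambda>_. PiM unit_square (\<lambda>_. borel))
       (\<lambda>k \<omega>. \<lambda>p\<in>unit_square. W k p \<omega>) UNIV"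


section \<open>Multiple Wiener-Ito integrals\<close>

text \<open>A formal chaos series is indexed by multi-indices \<open>n :: 'd \<Rightarrow> nat\<close>. Its kernel of multi-index
  \<open>n\<close> is a function of the points \<open>z (k, l)\<close> with \<open>l < n k\<close>; the variables \<open>z (k, _)\<close> are those
  integrated with respect to the component \<open>k\<close>.\<close>

type_synonym 'd points = "'d \<times> nat \<Rightarrow> real \<times> real"

type_synonym ('d, 'c) chaos = "('d \<Rightarrow> nat) \<Rightarrow> 'd points \<Rightarrow> 'c"

definition slots :: "('d \<Rightarrow> nat) \<Rightarrow> ('d \<times> nat) set" where
  "slots n = (SIGMA k:UNIV. {..<n k})"

definition points_measure :: "('d::finite \<Rightarrow> nat) \<Rightarrow> 'd points measure" where
  "points_measure n = PiM (slots n) (\<lambda>_. restrict_space lborel unit_square)"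

definition cell :: "(real \<times> real) \<times> (real \<times> real) \<Rightarrow> (real \<times> real) set" where
  "cell = (\<lambda>((s, t), (s', t')). {s<..s'} \<times> {t<..t'})"

text \<open>The value on the indicator of a cell of the isonormal process associated with \<open>B\<close>.\<close>

definition cell_increment ::
    "(real \<times> real \<Rightarrow> 'w \<Rightarrow> real) \<Rightarrow> (real \<times> real) \<times> (real \<times> real) \<Rightarrow> 'w \<Rightarrow> real" where
  "cell_increment B = (\<lambda>((s, t), (s', t')) \<omega>. B (s', t') \<omega> - B (s, t') \<omega> - B (s', t) \<omega> + B (s, t) \<omega>)"

text \<open>An elementary kernel is a product of indicators of cells in which the cells
  belonging to one and the same component are pairwise disjoint (so that it vanishes on the
  diagonals of that component).\<close>

definition elementary_cells ::
    "('d \<Rightarrow> nat) \<Rightarrow> ('d \<times> nat \<Rightarrow> (real \<times> real) \<times> (real \<times> real)) \<Rightarrow> bool" where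
  "elementary_cells n R \<longleftrightarrow>
     (\<forall>a\<in>slots n. case R a of ((s, t), (s', t')) \<Rightarrow> 0 \<le> s \<and> s \<le> s' \<and> s' \<le> 1 \<and> 0 \<le> t \<and> t \<le> t' \<and> t' \<le> 1) \<and>
     (\<forall>k. disjoint_family_on (\<lambda>l. cell (R (k, l))) {..<n k})"

definition tendsto_L2 :: "'a measure \<Rightarrow> ('i \<Rightarrow> 'a \<Rightarrow> complex) \<Rightarrow> ('a \<Rightarrow> complex) \<Rightarrow> 'i filter \<Rightarrow> bool" where
  "tendsto_L2 M X Y F \<longleftrightarrow> ((\<lambda>p. \<integral>\<^sup>+ \<omega>. ennreal ((norm (X p \<omega> - Y \<omega>))\<^sup>2) \<partial>M) \<longlongrightarrow> 0) F"

text \<open>\<open>multiple_integral M W n f X\<close>: \<open>X\<close> is a version of the multiple Wiener-Ito integral of the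
  square integrable complex kernel \<open>f\<close>, of order \<open>n k\<close> in each component \<open>W k\<close>, defined as the
  \<open>L\<^sup>2\<close> extension of
  \<open>\<Otimes>\<^sub>k \<Otimes>\<^sub>l 1\<^bsub>R (k, l)\<^esub> \<mapsto> \<Prod>\<^sub>k \<Prod>\<^sub>l W k (R (k, l))\<close>.
  On kernels \<open>\<Otimes>\<^sub>k f\<^sub>k\<close> it is the product over \<open>k\<close> of the \<open>n k\<close>-fold integrals of \<open>f\<^sub>k\<close> with respect
  to \<open>W k\<close>; the kernels of the current are not of this product form.\<close>

definition multiple_integral ::
    "'w measure \<Rightarrow> ('d::finite \<Rightarrow> real \<times> real \<Rightarrow> 'w \<Rightarrow> real) \<Rightarrow> ('d \<Rightarrow> nat) \<Rightarrow>
     ('d points \<Rightarrow> complex) \<Rightarrow> ('w \<Rightarrow> complex) \<Rightarrow> bool" where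
  "multiple_integral M W n f X \<longleftrightarrow>
     f \<in> borel_measurable (points_measure n) \<and> X \<in> borel_measurable M \<and>
     (\<exists>(N :: nat \<Rightarrow> nat) c R. (\<forall>p. \<forall>q<N p. elementary_cells n (R p q)) \<and>
        tendsto_L2 (points_measure n)
          (\<lambda>p z. \<Sum>q<N p. c p q * (\<Prod>a\<in>slots n. indicator (cell (R p q a)) (z a)))
          f sequentially \<and>
        tendsto_L2 M
          (\<lambda>p \<omega>. \<Sum>q<N p. c p q * (\<Prod>(k, l)\<in>slots n. of_real (cell_increment (W k) (R p q (k, l)) \<omega>)))
          X sequentially)"

definition chaos_sum ::
    "'w measure \<Rightarrow> ('d::finite \<Rightarrow> real \<times> real \<Rightarrow> 'w \<Rightarrow> real) \<Rightarrow> ('d, complex) chaos \<Rightarrow>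
     ('w \<Rightarrow> complex) \<Rightarrow> bool" where
  "chaos_sum M W f X \<longleftrightarrow>
     X \<in> borel_measurable M \<and>
     (\<exists>J. (\<forall>n. multiple_integral M W n (f n) (J n)) \<and>
        tendsto_L2 M (\<lambda>S \<omega>. \<Sum>n\<in>S. J n \<omega>) X (finite_subsets_at_top UNIV))"


section \<open>The Dirac functional and the divergence as operations on formal chaos series\<close>

definition hermite :: "nat \<Rightarrow> real \<Rightarrow> real" where
  "hermite m y = (-1) ^ m / fact m * exp (y\<^sup>2 / 2) * (deriv ^^ m) (\<lambda>t. exp (- t\<^sup>2 / 2)) y"

definition heat_kernel :: "real \<Rightarrow> real \<Rightarrow> real" where
  "heat_kernel s y = 1 / sqrt (2 * pi * s) * exp (- y\<^sup>2 / (2 * s))"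

definition dirac_coeff :: "nat \<Rightarrow> real \<Rightarrow> real \<Rightarrow> real \<Rightarrow> real" where
  "dirac_coeff m y u v =
     (u * v) powr (- real m / 2) * heat_kernel (u * v) y * hermite m (y / sqrt (u * v))"

definition dirac_chaos :: "real ^ 'd \<Rightarrow> real \<times> real \<Rightarrow> ('d::finite, real) chaos" where
  "dirac_chaos x = (\<lambda>(u, v) n z.
     \<Prod>k\<in>UNIV. dirac_coeff (n k) (x $ k) u v * (\<Prod>l<n k. indicator ({0..u} \<times> {0..v}) (z (k, l))))"

definition symmetrize :: "'d \<Rightarrow> nat \<Rightarrow> ('d points \<Rightarrow> real) \<Rightarrow> 'd points \<Rightarrow> real" where
  "symmetrize k m f z =
     (\<Sum>\<sigma> | \<sigma> permutes {..<m}. f (\<lambda>(k', l). if k' = k then z (k, \<sigma> l) else z (k', l))) / fact m"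

text \<open>The divergence with respect to component \<open>k\<close> of the field \<open>F\<close>: the argument of \<open>F\<close> becomes
  the last variable of that component, and the kernel is symmetrized in all variables of that
  component. The variables of the other components are not touched.\<close>

definition divergence ::
    "'d \<Rightarrow> (real \<times> real \<Rightarrow> ('d, real) chaos) \<Rightarrow> ('d, real) chaos" where
  "divergence k F n =
     (if n k = 0 then (\<lambda>_. 0)
      else symmetrize k (n k) (\<lambda>z. F (z (k, n k - 1)) (n(k := n k - 1)) z))"

definition current_chaos :: "'d \<Rightarrow> 'd \<Rightarrow> real ^ 'd \<Rightarrow> ('d::finite, real) chaos" where
  "current_chaos i j x =
     divergence i (\<lambda>(u1, v1). divergence j (\<lambda>(u2, v2).
       (\<lambda>n z. dirac_chaos x (u1, v2) n z * indicator {0..u1} u2 * indicator {0..v2} v1)))"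


section \<open>Fourier transform and Sobolev spaces of negative order\<close>

definition fourier :: "(real ^ 'd \<Rightarrow> complex) \<Rightarrow> real ^ 'd \<Rightarrow> complex" where
  "fourier f y = (LINT x|lborel. exp (- \<i> * of_real (y \<bullet> x)) * f x)"

definition fourier_chaos ::
    "(real ^ 'd \<Rightarrow> ('d, real) chaos) \<Rightarrow> real ^ 'd \<Rightarrow> ('d::finite, complex) chaos" where
  "fourier_chaos f y = (\<lambda>n z. fourier (\<lambda>x. of_real (f x n z)) y)"

definition fourier_current_version ::
    "'w measure \<Rightarrow> ('d::finite \<Rightarrow> real \<times> real \<Rightarrow> 'w \<Rightarrow> real) \<Rightarrow>
     (real ^ 'd \<Rightarrow> 'w \<Rightarrow> complex ^ 'd ^ 'd) \<Rightarrow> bool" where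
  "fourier_current_version M W \<Xi> \<longleftrightarrow>
     (\<lambda>(y, \<omega>). \<Xi> y \<omega>) \<in> borel_measurable (borel \<Otimes>\<^sub>M M) \<and>
     (\<forall>y i j. chaos_sum M W (fourier_chaos (current_chaos i j) y) (\<lambda>\<omega>. \<Xi> y \<omega> $ i $ j))"

text \<open>The Fourier transforms of the elements of the space \<open>H\<close> of order \<open>- r\<close> of
  real-matrix-valued distributions: a function satisfying the weighted integrability condition is
  automatically the Fourier transform of a tempered distribution, and the symmetry condition
  says that this distribution is real. The norm on \<open>complex ^ 'd ^ 'd\<close> is the Frobenius norm.\<close>

definition neg_sobolev_fourier :: "real \<Rightarrow> (real ^ 'd \<Rightarrow> complex ^ 'd ^ 'd) set" where
  "neg_sobolev_fourier r =
     {\<phi>. \<phi> \<in> borel_measurable borel \<and>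
         (AE y in lborel. \<forall>i j. \<phi> (- y) $ i $ j = cnj (\<phi> y $ i $ j)) \<and>
         (\<integral>\<^sup>+ y. ennreal ((1 + (norm y)\<^sup>2) powr (- r) * (norm (\<phi> y))\<^sup>2) \<partial>lborel) < \<infinity>}"

end

theory Submission
  imports Defs
begin

text \<open>
  The Fourier transform of \<open>x \<mapsto> \<Delta>(x - W\<^bsub>u,v\<^esub>)\<close> at \<open>y\<close> is \<open>exp (- i \<langle>y, W\<^bsub>u,v\<^esub>\<rangle>)\<close>, a random variable
  of modulus one. Since the point \<open>(u\<^sub>1, v\<^sub>2)\<close> is the upper right corner of \<open>(u\<^sub>1, v\<^sub>1)\<close> and \<open>(u\<^sub>2, v\<^sub>2)\<close> on the
  support of the two indicators, the double divergence is an Ito integral with respect to both variables, and its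
  isometry bounds the second moment of every entry of the Fourier transformed current by a constant
  that does not depend on \<open>y\<close>. The weight \<open>(1 + |y|\<^sup>2) powr (- r)\<close> is integrable
  for \<open>r > d / 2\<close>, and Tonelli's theorem turns the finite mean into almost sure finiteness.

  On the level of chaos expansions the isometry takes the following form. The kernel of order
  \<open>n\<close> is a mean, over the pairs of slots \<open>a\<close> of component \<open>i\<close> and \<open>b\<close> of component \<open>j\<close>, of functions that vanish
  unless \<open>a\<close> carries the rightmost and \<open>b\<close> the highest of all points
  (\<open>current_chaos_closed_form\<close>, \<open>fourier_current\<close>). For almost all configurations this happens for at most one pair,
  so the squares of the terms add up without cross terms, and the weighted sum of the squared norms of the kernels is
  an integral over the square of the exponential series of \<open>u v |y|\<^sup>2\<close> times \<open>exp (- u v |y|\<^sup>2)\<close>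
  (\<open>current_energy_bound\<close>).

  The passage from kernels to random variables is Bessel's inequality
  \<open>multiple_integral_bessel\<close>: the second moment of a sum of multiple integrals of different orders is at most the sum
  of \<open>n! \<parallel>f\<^sub>n\<parallel>\<^sup>2\<close>. It gives the existence of the chaos sums, their uniqueness, and the bound on
  the second moment. For elementary kernels it follows by refining all cells to one grid, because products of
  increments over different sets of grid cells are orthogonal; this rests on the independence
  of the increments, which are jointly Gaussian and uncorrelated (\<open>grid_increment_indep\<close>).

  For the existence of a jointly measurable version, every kernel is replaced by its
  values at points rounded up to a finer and finer mesh. Since the kernels depend on the points only through comparisons
  of coordinates and a continuous function, this converges almost everywhere.
\<close>

section \<open>Mean square convergence\<close>

lemma borel_measurable_cnj[measurable (raw)]:
  "f \<in> borel_measurable M \<Longrightarrow> (\<lambda>x. cnj (f x)) \<in> borel_measurable M"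
  by (rule measurable_compose[OF _ borel_measurable_continuous_onI]) (auto intro: continuous_on_cnj continuous_on_id)

text \<open>Extended-valued, so that it makes sense without any integrability hypothesis.\<close>

definition L2_sq :: "'a measure \<Rightarrow> ('a \<Rightarrow> complex) \<Rightarrow> ennreal" where
  "L2_sq M f = (\<integral>\<^sup>+ x. ennreal ((norm (f x))\<^sup>2) \<partial>M)"

lemma tendsto_L2_iff: "tendsto_L2 M X Y F \<longleftrightarrow> ((\<lambda>p. L2_sq M (\<lambda>x. X p x - Y x)) \<longlongrightarrow> 0) F"
  by (simp add: tendsto_L2_def L2_sq_def)

lemma norm_add_sq_le:
  fixes a b :: "'a::real_normed_vector"
  assumes "e > 0"
  shows "(norm (a + b))\<^sup>2 \<le> (1 + e) * (norm a)\<^sup>2 + (1 + 1 / e) * (norm b)\<^sup>2"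
proof -
  have "2 * norm a * norm b \<le> e * (norm a)\<^sup>2 + (norm b)\<^sup>2 / e"
    using sum_squares_bound[of "sqrt e * norm a" "norm b / sqrt e"] assms
    by (simp add: power_mult_distrib power_divide field_simps)
  moreover have "(norm (a + b))\<^sup>2 \<le> (norm a + norm b)\<^sup>2"
    by (intro power_mono norm_triangle_ineq) auto
  ultimately show ?thesis by (simp add: power2_sum algebra_simps)
qed

text \<open>Young's inequality in place of the triangle inequality: it avoids square roots of extended reals. The
  factor \<open>1 + e\<close> is removed at the end of an argument by
  \<open>ennreal_le_one_plus_eps\<close>.\<close>

lemma L2_sq_add_le:
  assumes [measurable]: "f \<in> borel_measurable M" "g \<in> borel_measurable M" and e: "e > 0"
  shows "L2_sq M (\<lambda>x. f x + g x) \<le> ennreal (1 + e) * L2_sq M f + ennreal (1 + 1 / e) * L2_sq M g"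
proof -
  have "L2_sq M (\<lambda>x. f x + g x)
      \<le> (\<integral>\<^sup>+ x. ennreal (1 + e) * ennreal ((norm (f x))\<^sup>2) + ennreal (1 + 1 / e) * ennreal ((norm (g x))\<^sup>2) \<partial>M)"
    unfolding L2_sq_def
  proof (intro nn_integral_mono)
    fix x
    have "ennreal ((norm (f x + g x))\<^sup>2) \<le> ennreal ((1 + e) * (norm (f x))\<^sup>2 + (1 + 1 / e) * (norm (g x))\<^sup>2)"
      by (intro ennreal_leI norm_add_sq_le e)
    also have "\<dots> = ennreal (1 + e) * ennreal ((norm (f x))\<^sup>2) + ennreal (1 + 1 / e) * ennreal ((norm (g x))\<^sup>2)"
      using e by (simp add: ennreal_mult ennreal_plus)
    finally show "ennreal ((norm (f x + g x))\<^sup>2) \<le> \<dots>" .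
  qed
  also have "\<dots> = ennreal (1 + e) * L2_sq M f + ennreal (1 + 1 / e) * L2_sq M g"
    unfolding L2_sq_def by (subst nn_integral_add) (auto simp: nn_integral_cmult)
  finally show ?thesis .
qed

lemma L2_sq_add_le2:
  assumes "f \<in> borel_measurable M" "g \<in> borel_measurable M"
  shows "L2_sq M (\<lambda>x. f x + g x) \<le> 2 * L2_sq M f + 2 * L2_sq M g"
  using L2_sq_add_le[OF assms, of 1] by simp

lemma L2_sq_cong_AE: "AE x in M. f x = g x \<Longrightarrow> L2_sq M f = L2_sq M g"
  unfolding L2_sq_def by (intro nn_integral_cong_AE) auto

lemma L2_sq_norm_cong: "(\<And>x. x \<in> space M \<Longrightarrow> norm (f x) = norm (g x)) \<Longrightarrow> L2_sq M f = L2_sq M g"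
  unfolding L2_sq_def by (intro nn_integral_cong) auto

lemma L2_sq_minus_commute: "L2_sq M (\<lambda>x. f x - g x) = L2_sq M (\<lambda>x. g x - f x)"
  by (intro L2_sq_norm_cong) (simp add: norm_minus_commute)

lemma L2_sq_zeroD:
  assumes [measurable]: "f \<in> borel_measurable M" and "L2_sq M f = 0"
  shows "AE x in M. f x = 0"
proof -
  have "AE x in M. ennreal ((norm (f x))\<^sup>2) = 0"
    using assms(2) unfolding L2_sq_def by (subst (asm) nn_integral_0_iff_AE) auto
  then show ?thesis by eventually_elim simp
qed

lemma ennreal_le_one_plus_eps:
  fixes a b :: ennreal
  assumes "\<And>e. e > 0 \<Longrightarrow> a \<le> ennreal (1 + e) * b"
  shows "a \<le> b"
proof (cases "b = \<infinity>")
  case False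
  have "((\<lambda>n. ennreal (1 + 1 / real (Suc n)) * b) \<longlongrightarrow> ennreal 1 * b) sequentially"
  proof (intro tendsto_mult_ennreal tendsto_ennrealI tendsto_const)
    show "(\<lambda>n. 1 + 1 / real (Suc n)) \<longlonglongrightarrow> 1"
      using tendsto_add[OF tendsto_const[of 1] LIMSEQ_inverse_real_of_nat] by (simp add: inverse_eq_divide)
  qed (use False in auto)
  then have "a \<le> ennreal 1 * b"
  proof (rule tendsto_lowerbound)
    show "\<forall>\<^sub>F n in sequentially. a \<le> ennreal (1 + 1 / real (Suc n)) * b"
      by (intro always_eventually allI assms) simp
  qed simp
  then show ?thesis by simp
qed auto

lemma L2_sq_limit_le:
  assumes lim: "tendsto_L2 M X Y F" and F: "F \<noteq> bot"
    and X: "\<And>p. X p \<in> borel_measurable M" and Y: "Y \<in> borel_measurable M"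
    and le: "\<forall>\<^sub>F p in F. L2_sq M (X p) \<le> B p" and B: "(B \<longlongrightarrow> b) F"
  shows "L2_sq M Y \<le> b"
proof (rule ennreal_le_one_plus_eps)
  fix e :: real assume e: "e > 0"
  have "((\<lambda>p. ennreal (1 + e) * B p + ennreal (1 + 1 / e) * L2_sq M (\<lambda>x. X p x - Y x))
      \<longlongrightarrow> ennreal (1 + e) * b + ennreal (1 + 1 / e) * 0) F"
    using lim B unfolding tendsto_L2_iff
    by (intro tendsto_add ennreal_tendsto_cmult) auto
  then have lim': "((\<lambda>p. ennreal (1 + e) * B p + ennreal (1 + 1 / e) * L2_sq M (\<lambda>x. X p x - Y x))
      \<longlongrightarrow> ennreal (1 + e) * b) F" by simp
  show "L2_sq M Y \<le> ennreal (1 + e) * b"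
  proof (rule tendsto_lowerbound[OF lim' _ F])
    show "\<forall>\<^sub>F p in F. L2_sq M Y \<le> ennreal (1 + e) * B p + ennreal (1 + 1 / e) * L2_sq M (\<lambda>x. X p x - Y x)"
      using le
    proof eventually_elim
      case (elim p)
      have "L2_sq M Y = L2_sq M (\<lambda>x. X p x + (Y x - X p x))" by simp
      also have "\<dots> \<le> ennreal (1 + e) * L2_sq M (X p) + ennreal (1 + 1 / e) * L2_sq M (\<lambda>x. Y x - X p x)"
        using X Y by (intro L2_sq_add_le e) auto
      also have "\<dots> \<le> ennreal (1 + e) * B p + ennreal (1 + 1 / e) * L2_sq M (\<lambda>x. X p x - Y x)"
        using elim by (intro add_mono mult_left_mono) (auto simp: L2_sq_minus_commute)
      finally show ?case .
    qed
  qed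
qed

lemma tendsto_L2_add:
  assumes "tendsto_L2 M X Y F" "tendsto_L2 M X' Y' F"
    and [measurable]: "\<And>p. X p \<in> borel_measurable M" "Y \<in> borel_measurable M"
       "\<And>p. X' p \<in> borel_measurable M" "Y' \<in> borel_measurable M"
  shows "tendsto_L2 M (\<lambda>p x. X p x + X' p x) (\<lambda>x. Y x + Y' x) F"
proof -
  have "((\<lambda>p. 2 * L2_sq M (\<lambda>x. X p x - Y x) + 2 * L2_sq M (\<lambda>x. X' p x - Y' x)) \<longlongrightarrow> 2 * 0 + 2 * 0) F"
    using assms(1,2) unfolding tendsto_L2_iff
    by (intro tendsto_add ennreal_tendsto_cmult) auto
  then have lim: "((\<lambda>p. 2 * L2_sq M (\<lambda>x. X p x - Y x) + 2 * L2_sq M (\<lambda>x. X' p x - Y' x)) \<longlongrightarrow> 0) F" by simp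
  have "L2_sq M (\<lambda>x. (X p x + X' p x) - (Y x + Y' x))
      \<le> 2 * L2_sq M (\<lambda>x. X p x - Y x) + 2 * L2_sq M (\<lambda>x. X' p x - Y' x)" for p
    using L2_sq_add_le2[of "\<lambda>x. X p x - Y x" M "\<lambda>x. X' p x - Y' x"] by (simp add: algebra_simps)
  then show ?thesis
    unfolding tendsto_L2_iff
    by (intro tendsto_sandwich[OF _ _ tendsto_const lim]) auto
qed

lemma tendsto_L2_cmult:
  assumes "tendsto_L2 M X Y F" and [measurable]: "\<And>p. X p \<in> borel_measurable M" "Y \<in> borel_measurable M"
  shows "tendsto_L2 M (\<lambda>p x. c * X p x) (\<lambda>x. c * Y x) F"
proof -
  have "L2_sq M (\<lambda>x. c * X p x - c * Y x) = ennreal ((norm c)\<^sup>2) * L2_sq M (\<lambda>x. X p x - Y x)" for p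
    unfolding L2_sq_def right_diff_distrib[symmetric] norm_mult power_mult_distrib
    by (subst nn_integral_cmult[symmetric]) (auto simp: ennreal_mult)
  then show ?thesis
    using ennreal_tendsto_cmult[of "ennreal ((norm c)\<^sup>2)" "\<lambda>p. L2_sq M (\<lambda>x. X p x - Y x)" 0 F] assms(1)
    unfolding tendsto_L2_iff by simp
qed

lemma tendsto_L2_sum:
  assumes "finite S" "\<And>n. n \<in> S \<Longrightarrow> tendsto_L2 M (X n) (Y n) F"
    and "\<And>n p. n \<in> S \<Longrightarrow> X n p \<in> borel_measurable M" "\<And>n. n \<in> S \<Longrightarrow> Y n \<in> borel_measurable M"
  shows "tendsto_L2 M (\<lambda>p x. \<Sum>n\<in>S. X n p x) (\<lambda>x. \<Sum>n\<in>S. Y n x) F"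
  using assms
proof (induction S rule: finite_induct)
  case empty
  then show ?case by (simp add: tendsto_L2_def)
next
  case (insert n S)
  then show ?case
    by (simp, intro tendsto_L2_add) auto
qed

lemma tendsto_L2_cnj:
  assumes "tendsto_L2 M X Y F"
  shows "tendsto_L2 M (\<lambda>p x. cnj (X p x)) (\<lambda>x. cnj (Y x)) F"
proof -
  have "norm (cnj a - cnj b) = norm (a - b)" for a b
    by (metis complex_cnj_diff complex_mod_cnj)
  then show ?thesis using assms by (simp add: tendsto_L2_def)
qed

lemma tendsto_L2_cong_AE:
  assumes "tendsto_L2 M X Y F" "\<And>p. AE x in M. X p x = X' p x" "AE x in M. Y x = Y' x"
  shows "tendsto_L2 M X' Y' F"
proof -
  have "L2_sq M (\<lambda>x. X p x - Y x) = L2_sq M (\<lambda>x. X' p x - Y' x)" for p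
    using assms(2)[of p] assms(3) by (intro L2_sq_cong_AE) (auto elim: eventually_elim2)
  then show ?thesis using assms(1) by (simp add: tendsto_L2_iff)
qed

lemma tendsto_L2_unique:
  assumes "tendsto_L2 M X Y F" "tendsto_L2 M X Z F" "F \<noteq> bot"
    and [measurable]: "\<And>p. X p \<in> borel_measurable M" "Y \<in> borel_measurable M" "Z \<in> borel_measurable M"
  shows "AE x in M. Y x = Z x"
proof -
  have "tendsto_L2 M (\<lambda>p x. X p x + (-1) * X p x) (\<lambda>x. Y x + (-1) * Z x) F"
    using assms(1,2) by (intro tendsto_L2_add tendsto_L2_cmult) auto
  then have "tendsto_L2 M (\<lambda>p x. 0) (\<lambda>x. Y x - Z x) F" by simp
  then have "L2_sq M (\<lambda>x. Y x - Z x) \<le> 0"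
    by (rule L2_sq_limit_le[OF _ assms(3), where B = "\<lambda>_. 0"]) (auto simp: L2_sq_def)
  then have "AE x in M. Y x - Z x = 0" by (intro L2_sq_zeroD) auto
  then show ?thesis by simp
qed

text \<open>Completeness of \<open>L\<^sup>2\<close> with a measurable parameter \<open>y\<close>. The speed of
  convergence depends on \<open>y\<close>, but the least index from which on the error is below
  \<open>(1/4) ^ l\<close> is a measurable function of \<open>y\<close>. Along these indices convergence
  is almost sure, so that the limit can be taken pointwise.\<close>

lemma (in prob_space) L2_limit_jointly_measurable:
  fixes X :: "nat \<Rightarrow> 'b \<times> 'a \<Rightarrow> complex"
  assumes X[measurable]: "\<And>p. X p \<in> borel_measurable (N \<Otimes>\<^sub>M M)"
    and cauchy: "\<And>y e. y \<in> space N \<Longrightarrow> e > 0 \<Longrightarrow>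
       \<exists>P. \<forall>p\<ge>P. \<forall>q\<ge>P. L2_sq M (\<lambda>\<omega>. X p (y, \<omega>) - X q (y, \<omega>)) \<le> ennreal e"
  obtains Y where "Y \<in> borel_measurable (N \<Otimes>\<^sub>M M)"
    "\<And>y. y \<in> space N \<Longrightarrow> tendsto_L2 M (\<lambda>p \<omega>. X p (y, \<omega>)) (\<lambda>\<omega>. Y (y, \<omega>)) sequentially"
proof -
  define D where "D p q y = L2_sq M (\<lambda>\<omega>. X p (y, \<omega>) - X q (y, \<omega>))" for p q y
  have D[measurable]: "D p q \<in> borel_measurable N" for p q
    unfolding D_def L2_sq_def by measurable
  define K where "K l y = (LEAST P. \<forall>p\<ge>P. \<forall>q\<ge>P. D p q y \<le> ennreal ((1/4) ^ l))" for l y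
  have K: "D p q y \<le> ennreal ((1/4) ^ l)" if "y \<in> space N" "p \<ge> K l y" "q \<ge> K l y" for l y p q
  proof -
    have "\<exists>P. \<forall>p\<ge>P. \<forall>q\<ge>P. D p q y \<le> ennreal ((1/4) ^ l)"
      using cauchy[OF that(1), of "(1/4)^l"] by (simp add: D_def)
    from LeastI_ex[OF this] have "\<forall>p\<ge>K l y. \<forall>q\<ge>K l y. D p q y \<le> ennreal ((1/4) ^ l)"
      unfolding K_def[symmetric] .
    with that(2,3) show ?thesis by blast
  qed
  have K_mono: "K l y \<le> K (Suc l) y" if "y \<in> space N" for l y
    unfolding K_def[of l]
  proof (rule Least_le, intro allI impI)
    fix p q assume "p \<ge> K (Suc l) y" "q \<ge> K (Suc l) y"
    with that have "D p q y \<le> ennreal ((1/4) ^ Suc l)" by (rule K)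
    also have "\<dots> \<le> ennreal ((1/4) ^ l)" by (intro ennreal_leI) simp
    finally show "D p q y \<le> ennreal ((1/4) ^ l)" .
  qed
  have [measurable]: "K l \<in> measurable N (count_space UNIV)" for l
    unfolding K_def
  proof (rule measurable_Least)
    show "Measurable.pred N (\<lambda>y. \<forall>p\<ge>P. \<forall>q\<ge>P. D p q y \<le> ennreal ((1/4) ^ l))" for P
      by measurable
  qed
  define Z where "Z l = (\<lambda>(y, \<omega>). X (K l y) (y, \<omega>))" for l
  have Z[measurable]: "Z l \<in> borel_measurable (N \<Otimes>\<^sub>M M)" for l
  proof -
    have "(\<lambda>x. X (K l (fst x)) x) \<in> borel_measurable (N \<Otimes>\<^sub>M M)"
      by (rule measurable_compose_countable[where g = "\<lambda>x. K l (fst x)"]) measurable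
    then show ?thesis by (simp add: Z_def case_prod_beta)
  qed
  define Y where "Y x = lim (\<lambda>l. Z l x)" for x
  have Y[measurable]: "Y \<in> borel_measurable (N \<Otimes>\<^sub>M M)"
    unfolding Y_def by (rule borel_measurable_lim_metric) measurable
  have conv: "AE \<omega> in M. (\<lambda>l. Z l (y, \<omega>)) \<longlonglongrightarrow> Y (y, \<omega>)" if y[measurable]: "y \<in> space N" for y
  proof -
    \<comment> \<open>the arithmetic-geometric mean inequality with weight \<open>2 ^ l\<close> bounds the \<open>L\<^sup>1\<close> norm of the increments\<close>
    have int: "(\<integral>\<^sup>+ \<omega>. ennreal (norm (Z (Suc l) (y, \<omega>) - Z l (y, \<omega>))) \<partial>M) \<le> ennreal ((1/2) ^ l)" for l
    proof -
      have le: "ennreal (norm a) \<le> ennreal (2 ^ l / 2) * ennreal ((norm a)\<^sup>2) + ennreal ((1/2) ^ l / 2)" for a :: complex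
      proof -
        have "norm a \<le> (2 ^ l / 2) * (norm a)\<^sup>2 + (1/2) ^ l / 2"
        proof -
          define t :: real where "t = 2 ^ l"
          have t: "t > 0" "(1/2) ^ l = 1 / t" by (auto simp: t_def power_one_over)
          have "0 \<le> (t * norm a - 1)\<^sup>2" by simp
          then have "0 \<le> (t * norm a - 1)\<^sup>2 / (2 * t)" using t by simp
          also have "\<dots> = t / 2 * (norm a)\<^sup>2 + 1 / t / 2 - norm a"
            using t by (simp add: power2_eq_square field_simps)
          finally show ?thesis unfolding t t_def[symmetric] by simp
        qed
        then have "ennreal (norm a) \<le> ennreal ((2 ^ l / 2) * (norm a)\<^sup>2 + (1/2) ^ l / 2)" by (rule ennreal_leI)
        also have "\<dots> = ennreal (2 ^ l / 2) * ennreal ((norm a)\<^sup>2) + ennreal ((1/2) ^ l / 2)"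
          by (subst ennreal_plus, simp, simp, subst ennreal_mult, simp, simp, rule refl)
        finally show ?thesis .
      qed
      have "(\<integral>\<^sup>+ \<omega>. ennreal (norm (Z (Suc l) (y, \<omega>) - Z l (y, \<omega>))) \<partial>M)
          \<le> (\<integral>\<^sup>+ \<omega>. ennreal (2 ^ l / 2) * ennreal ((norm (Z (Suc l) (y, \<omega>) - Z l (y, \<omega>)))\<^sup>2) + ennreal ((1/2) ^ l / 2) \<partial>M)"
        by (intro nn_integral_mono le)
      also have "\<dots> = ennreal (2 ^ l / 2) * D (K (Suc l) y) (K l y) y + ennreal ((1/2) ^ l / 2)"
        by (subst nn_integral_add) (auto simp: nn_integral_cmult D_def L2_sq_def Z_def emeasure_space_1)
      also have "\<dots> \<le> ennreal (2 ^ l / 2) * ennreal ((1/4) ^ l) + ennreal ((1/2) ^ l / 2)"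
        by (intro add_mono mult_left_mono K y K_mono) auto
      also have "\<dots> = ennreal ((2 ^ l / 2) * (1/4) ^ l + (1/2) ^ l / 2)"
        by (subst ennreal_plus, simp, simp, subst ennreal_mult, simp, simp, rule refl)
      also have "(2 ^ l / 2) * (1/4) ^ l + (1/2) ^ l / 2 = (1/2 :: real) ^ l"
        by (simp flip: power_mult_distrib)
      finally show ?thesis .
    qed
    have "(\<integral>\<^sup>+ \<omega>. (\<Sum>l. ennreal (norm (Z (Suc l) (y, \<omega>) - Z l (y, \<omega>)))) \<partial>M)
        = (\<Sum>l. \<integral>\<^sup>+ \<omega>. ennreal (norm (Z (Suc l) (y, \<omega>) - Z l (y, \<omega>))) \<partial>M)"
      by (rule nn_integral_suminf) measurable
    also have "\<dots> \<le> (\<Sum>l. ennreal ((1/2) ^ l))" by (intro suminf_le int) auto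
    also have "\<dots> = ennreal (\<Sum>l. (1/2) ^ l)" by (intro suminf_ennreal2) auto
    also have "\<dots> < \<infinity>" by simp
    finally have "AE \<omega> in M. (\<Sum>l. ennreal (norm (Z (Suc l) (y, \<omega>) - Z l (y, \<omega>)))) \<noteq> \<infinity>"
      by (intro nn_integral_PInf_AE) auto
    then show ?thesis
    proof eventually_elim
      case (elim \<omega>)
      have "summable (\<lambda>l. norm (Z (Suc l) (y, \<omega>) - Z l (y, \<omega>)))"
        using elim by (intro summable_suminf_not_top) auto
      then have "summable (\<lambda>l. Z (Suc l) (y, \<omega>) - Z l (y, \<omega>))" by (rule summable_norm_cancel)
      then have "convergent (\<lambda>l. \<Sum>i<l. Z (Suc i) (y, \<omega>) - Z i (y, \<omega>))"
        by (simp add: summable_iff_convergent)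
      then have "convergent (\<lambda>l. Z l (y, \<omega>) - Z 0 (y, \<omega>))" unfolding sum_lessThan_telescope[of "\<lambda>l. Z l (y, \<omega>)"] .
      then have "convergent (\<lambda>l. Z l (y, \<omega>))" by (simp add: convergent_diff_const_right_iff)
      then show ?case by (simp add: Y_def convergent_LIMSEQ_iff)
    qed
  qed
  have "tendsto_L2 M (\<lambda>p \<omega>. X p (y, \<omega>)) (\<lambda>\<omega>. Y (y, \<omega>)) sequentially" if y[measurable]: "y \<in> space N" for y
  proof -
    have bound: "L2_sq M (\<lambda>\<omega>. X p (y, \<omega>) - Y (y, \<omega>)) \<le> ennreal ((1/4) ^ m)" if p: "p \<ge> K m y" for p m
    proof -
      have "L2_sq M (\<lambda>\<omega>. X p (y, \<omega>) - Y (y, \<omega>))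
          = (\<integral>\<^sup>+ \<omega>. liminf (\<lambda>l. ennreal ((norm (X p (y, \<omega>) - Z l (y, \<omega>)))\<^sup>2)) \<partial>M)"
        unfolding L2_sq_def
      proof (rule nn_integral_cong_AE)
        show "AE \<omega> in M. ennreal ((norm (X p (y, \<omega>) - Y (y, \<omega>)))\<^sup>2)
            = liminf (\<lambda>l. ennreal ((norm (X p (y, \<omega>) - Z l (y, \<omega>)))\<^sup>2))"
          using conv[OF y]
        proof eventually_elim
          case (elim \<omega>)
          have "(\<lambda>l. ennreal ((norm (X p (y, \<omega>) - Z l (y, \<omega>)))\<^sup>2))
              \<longlonglongrightarrow> ennreal ((norm (X p (y, \<omega>) - Y (y, \<omega>)))\<^sup>2)"
            by (intro tendsto_intros elim)
          from lim_imp_Liminf[OF _ this] show ?case by simp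
        qed
      qed
      also have "\<dots> \<le> liminf (\<lambda>l. \<integral>\<^sup>+ \<omega>. ennreal ((norm (X p (y, \<omega>) - Z l (y, \<omega>)))\<^sup>2) \<partial>M)"
        by (rule nn_integral_liminf) measurable
      also have "\<dots> \<le> limsup (\<lambda>l. \<integral>\<^sup>+ \<omega>. ennreal ((norm (X p (y, \<omega>) - Z l (y, \<omega>)))\<^sup>2) \<partial>M)"
        by (rule Liminf_le_Limsup) simp
      also have "\<dots> \<le> ennreal ((1/4) ^ m)"
      proof (rule Limsup_bounded, rule eventually_sequentiallyI)
        fix l assume "l \<ge> m"
        then have "K m y \<le> K l y" using K_mono[OF y] by (rule lift_Suc_mono_le[of "\<lambda>l. K l y", rotated])
        then show "(\<integral>\<^sup>+ \<omega>. ennreal ((norm (X p (y, \<omega>) - Z l (y, \<omega>)))\<^sup>2) \<partial>M) \<le> ennreal ((1/4) ^ m)"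
          using K[OF y p, of "K l y"] by (simp add: D_def L2_sq_def Z_def)
      qed
      finally show ?thesis .
    qed
    show ?thesis unfolding tendsto_L2_iff
    proof (rule order_tendstoI)
      fix e :: ennreal assume "0 < e"
      moreover have "(\<lambda>m. ennreal ((1/4) ^ m)) \<longlonglongrightarrow> ennreal 0"
        by (intro tendsto_ennrealI LIMSEQ_power_zero) simp
      ultimately have "\<forall>\<^sub>F m in sequentially. ennreal ((1/4) ^ m) < e"
        by (intro order_tendstoD(2)[where y = 0]) auto
      then obtain m where m: "ennreal ((1/4) ^ m) < e"
        by (auto simp: eventually_sequentially)
      show "\<forall>\<^sub>F p in sequentially. L2_sq M (\<lambda>\<omega>. X p (y, \<omega>) - Y (y, \<omega>)) < e"
        using bound[of m] m by (intro eventually_sequentiallyI[of "K m y"]) (meson le_less_trans)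
    qed auto
  qed
  with Y show thesis by (rule that)
qed

section \<open>Independence from characteristic functions\<close>

context prob_space
begin

text \<open>The hypothesis says that \<open>X\<close> has the same characteristic function under the measure with
  density \<open>1 + w\<close>, normalized, as under \<open>M\<close>. By Levy's theorem it has the same
  law.\<close>

lemma real_weight_independent:
  fixes X w :: "'a \<Rightarrow> real"
  assumes [measurable]: "X \<in> borel_measurable M" "w \<in> borel_measurable M"
    and w1: "\<And>\<omega>. \<bar>w \<omega>\<bar> \<le> 1"
    and eq: "\<And>t. (CLINT \<omega>|M. iexp (t * X \<omega>) * w \<omega>) = (CLINT \<omega>|M. iexp (t * X \<omega>)) * (CLINT \<omega>|M. w \<omega>)"
    and E[measurable]: "E \<in> sets borel"
  shows "(LINT \<omega>|M. indicator E (X \<omega>) * w \<omega>) = (LINT \<omega>|M. indicator E (X \<omega>)) * (LINT \<omega>|M. w \<omega>)"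
proof -
  have int_w: "integrable M w" by (rule integrable_const_bound[where B = 1]) (use w1 in auto)
  have int_ew: "integrable M (\<lambda>\<omega>. iexp (t * X \<omega>) * w \<omega>)" for t
    by (rule integrable_const_bound[where B = 1]) (use w1 in \<open>auto simp: norm_mult\<close>)
  have int_e: "integrable M (\<lambda>\<omega>. iexp (t * X \<omega>))" for t
    by (rule integrable_const_bound[where B = 1]) auto
  have int_iw: "integrable M (\<lambda>\<omega>. indicator E (X \<omega>) * w \<omega>)"
    by (rule integrable_const_bound[where B = 1]) (use w1 in \<open>auto simp: abs_mult indicator_def\<close>)
  have int_i: "integrable M (\<lambda>\<omega>. indicator E (X \<omega>) :: real)"
    by (rule integrable_const_bound[where B = 1]) (auto simp: indicator_def)
  \<comment> \<open>adding one makes the weight nonnegative; for constant weights both identities are trivial\<close>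
  define v where "v \<omega> = 1 + w \<omega>" for \<omega>
  have v0: "v \<omega> \<ge> 0" for \<omega> using w1[of \<omega>] by (simp add: v_def abs_le_iff)
  have v[measurable]: "v \<in> borel_measurable M" unfolding v_def by measurable
  have int_v: "integrable M v" unfolding v_def using int_w by simp
  define C where "C = (LINT \<omega>|M. v \<omega>)"
  have C_eq: "C = 1 + (LINT \<omega>|M. w \<omega>)" unfolding C_def v_def using int_w by (simp add: prob_space)
  have v_char: "(CLINT \<omega>|M. iexp (t * X \<omega>) * v \<omega>) = (CLINT \<omega>|M. iexp (t * X \<omega>)) * C" for t
    using int_e[of t] int_ew[of t] int_w eq[of t]
    by (simp add: v_def C_eq algebra_simps integral_complex_of_real)
  have "(LINT \<omega>|M. indicator E (X \<omega>) * v \<omega>) = (LINT \<omega>|M. indicator E (X \<omega>)) * C"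
  proof (cases "C = 0")
    case True
    then have "AE \<omega> in M. v \<omega> = 0"
      unfolding C_def using int_v v0 by (subst (asm) integral_nonneg_eq_0_iff_AE) auto
    then have "(LINT \<omega>|M. indicator E (X \<omega>) * v \<omega>) = (LINT \<omega>|M. 0)"
      by (intro integral_cong_AE) (auto elim!: eventually_mono)
    with True show ?thesis by simp
  next
    case False
    have "C \<ge> 0" unfolding C_def by (rule Bochner_Integration.integral_nonneg) (rule v0)
    with False have C0: "C > 0" by simp
    define Q where "Q = density M (\<lambda>\<omega>. ennreal (v \<omega> / C))"
    have v_C: "v \<omega> / C \<ge> 0" for \<omega> using v0 C0 by simp
    have "emeasure Q (space Q) = (\<integral>\<^sup>+ \<omega>. ennreal (v \<omega> / C) \<partial>M)"
      by (simp add: Q_def emeasure_density cong: nn_integral_cong)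
    also have "\<dots> = ennreal (LINT \<omega>|M. v \<omega> / C)"
      using int_v v_C by (intro nn_integral_eq_integral) auto
    also have "\<dots> = 1" using C0 by (simp add: C_def)
    finally interpret Q: prob_space Q by (rule prob_spaceI)
    have XQ[measurable]: "X \<in> borel_measurable Q" by (simp add: Q_def)
    have int_Q: "(LINT \<omega>|Q. f (X \<omega>)) = (LINT \<omega>|M. (v \<omega> / C) *\<^sub>R f (X \<omega>))"
      if [measurable]: "f \<in> borel_measurable borel" for f :: "real \<Rightarrow> 'b :: {banach, second_countable_topology}"
      unfolding Q_def by (rule integral_density) (use v_C in auto)
    have "char (distr Q borel X) = char (distr M borel X)"
    proof
      fix t
      have "char (distr Q borel X) t = (CLINT \<omega>|Q. iexp (t * X \<omega>))"
        unfolding char_def by (rule integral_distr) auto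
      also have "\<dots> = (CLINT \<omega>|M. (v \<omega> / C) *\<^sub>R iexp (t * X \<omega>))"
        by (rule int_Q) simp
      also have "\<dots> = (CLINT \<omega>|M. iexp (t * X \<omega>) * v \<omega> / C)"
        by (intro Bochner_Integration.integral_cong) (auto simp: scaleR_conv_of_real)
      also have "\<dots> = (CLINT \<omega>|M. iexp (t * X \<omega>) * v \<omega>) / C" by simp
      also have "\<dots> = (CLINT \<omega>|M. iexp (t * X \<omega>))" unfolding v_char using C0 by simp
      also have "\<dots> = char (distr M borel X) t"
        unfolding char_def by (rule integral_distr[symmetric]) auto
      finally show "char (distr Q borel X) t = char (distr M borel X) t" .
    qed
    then have law: "distr Q borel X = distr M borel X"
      by (intro Levy_uniqueness Q.real_distribution_distr real_distribution_distr) auto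
    have "(LINT \<omega>|M. indicator E (X \<omega>)) = (LINT x|distr M borel X. indicator E x :: real)"
      by (rule integral_distr[symmetric]) auto
    also have "\<dots> = (LINT \<omega>|Q. indicator E (X \<omega>))"
      unfolding law[symmetric] by (rule integral_distr) auto
    also have "\<dots> = (LINT \<omega>|M. (v \<omega> / C) *\<^sub>R indicator E (X \<omega>))" by (rule int_Q) simp
    also have "\<dots> = (LINT \<omega>|M. indicator E (X \<omega>) * v \<omega>) / C"
      by (simp add: mult.commute flip: Bochner_Integration.integral_divide_zero)
    finally show ?thesis using C0 by simp
  qed
  then show ?thesis
    using int_i int_iw by (simp add: v_def C_eq algebra_simps)
qed

text \<open>The real and imaginary part of \<open>w\<close> are combinations of \<open>w\<close> and its conjugate,
  which is why both are assumed to satisfy the identity.\<close>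

lemma complex_weight_independent:
  fixes X :: "'a \<Rightarrow> real" and w :: "'a \<Rightarrow> complex"
  assumes [measurable]: "X \<in> borel_measurable M" "w \<in> borel_measurable M"
    and w1: "\<And>\<omega>. norm (w \<omega>) \<le> 1"
    and eq: "\<And>t. (CLINT \<omega>|M. iexp (t * X \<omega>) * w \<omega>) = (CLINT \<omega>|M. iexp (t * X \<omega>)) * (CLINT \<omega>|M. w \<omega>)"
    and eq': "\<And>t. (CLINT \<omega>|M. iexp (t * X \<omega>) * cnj (w \<omega>)) = (CLINT \<omega>|M. iexp (t * X \<omega>)) * (CLINT \<omega>|M. cnj (w \<omega>))"
    and E[measurable]: "E \<in> sets borel"
  shows "(CLINT \<omega>|M. indicator E (X \<omega>) * w \<omega>) = (CLINT \<omega>|M. indicator E (X \<omega>)) * (CLINT \<omega>|M. w \<omega>)"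
proof -
  have int_w: "integrable M w" "integrable M (\<lambda>\<omega>. cnj (w \<omega>))"
    by (rule integrable_const_bound[where B = 1]; use w1 in \<open>simp\<close>)+
  have int_ew: "integrable M (\<lambda>\<omega>. iexp (t * X \<omega>) * w \<omega>)" "integrable M (\<lambda>\<omega>. iexp (t * X \<omega>) * cnj (w \<omega>))" for t
    by (rule integrable_const_bound[where B = 1]; use w1 in \<open>simp add: norm_mult\<close>)+
  have Re_eq: "of_real (Re z) = (z + cnj z) / 2" for z by (simp add: complex_eq_iff)
  have Im_eq: "of_real (Im z) = (z - cnj z) / (2 * \<i>)" for z by (simp add: complex_eq_iff)
  have R: "(LINT \<omega>|M. indicator E (X \<omega>) * Re (w \<omega>)) = (LINT \<omega>|M. indicator E (X \<omega>)) * (LINT \<omega>|M. Re (w \<omega>))"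
  proof (rule real_weight_independent)
    show "\<bar>Re (w \<omega>)\<bar> \<le> 1" for \<omega> using w1[of \<omega>] abs_Re_le_cmod order_trans by blast
    show "(CLINT \<omega>|M. iexp (t * X \<omega>) * complex_of_real (Re (w \<omega>)))
        = (CLINT \<omega>|M. iexp (t * X \<omega>)) * (CLINT \<omega>|M. complex_of_real (Re (w \<omega>)))" for t
      unfolding Re_eq using int_w int_ew[of t] eq[of t] eq'[of t]
      by (simp add: distrib_left add_divide_distrib)
  qed simp_all
  have I: "(LINT \<omega>|M. indicator E (X \<omega>) * Im (w \<omega>)) = (LINT \<omega>|M. indicator E (X \<omega>)) * (LINT \<omega>|M. Im (w \<omega>))"
  proof (rule real_weight_independent)
    show "\<bar>Im (w \<omega>)\<bar> \<le> 1" for \<omega> using w1[of \<omega>] abs_Im_le_cmod order_trans by blast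
    show "(CLINT \<omega>|M. iexp (t * X \<omega>) * complex_of_real (Im (w \<omega>)))
        = (CLINT \<omega>|M. iexp (t * X \<omega>)) * (CLINT \<omega>|M. complex_of_real (Im (w \<omega>)))" for t
    proof -
      have "(CLINT \<omega>|M. iexp (t * X \<omega>) * complex_of_real (Im (w \<omega>)))
          = (CLINT \<omega>|M. (iexp (t * X \<omega>) * w \<omega> - iexp (t * X \<omega>) * cnj (w \<omega>)) / (2 * \<i>))"
        unfolding Im_eq by (simp only: right_diff_distrib diff_divide_distrib times_divide_eq_right)
      also have "\<dots> = ((CLINT \<omega>|M. iexp (t * X \<omega>) * w \<omega>) - (CLINT \<omega>|M. iexp (t * X \<omega>) * cnj (w \<omega>))) / (2 * \<i>)"
        unfolding integral_divide_zero Bochner_Integration.integral_diff[OF int_ew] ..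
      also have "\<dots> = (CLINT \<omega>|M. iexp (t * X \<omega>)) * (((CLINT \<omega>|M. w \<omega>) - (CLINT \<omega>|M. cnj (w \<omega>))) / (2 * \<i>))"
        unfolding eq eq' by (simp only: right_diff_distrib[symmetric] times_divide_eq_right)
      also have "((CLINT \<omega>|M. w \<omega>) - (CLINT \<omega>|M. cnj (w \<omega>))) / (2 * \<i>) = (CLINT \<omega>|M. complex_of_real (Im (w \<omega>)))"
        unfolding Im_eq integral_divide_zero Bochner_Integration.integral_diff[OF int_w] ..
      finally show ?thesis .
    qed
  qed simp_all
  have int_iw: "integrable M (\<lambda>\<omega>. indicator E (X \<omega>) * w \<omega>)"
    by (rule integrable_const_bound[where B = 1]) (use w1 in \<open>auto simp: norm_mult indicator_def\<close>)
  have ind: "(CLINT \<omega>|M. indicator E (X \<omega>)) = of_real (LINT \<omega>|M. indicator E (X \<omega>))"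
    unfolding integral_complex_of_real[symmetric]
    by (intro Bochner_Integration.integral_cong) (auto simp: indicator_def)
  have "Re (indicator E x * z) = indicator E x * Re z" "Im (indicator E x * z) = indicator E x * Im z"
    for x and z :: complex by (auto simp: indicator_def)
  then show ?thesis unfolding ind
    using R I int_iw int_w by (simp add: complex_eq_iff flip: integral_Re integral_Im)
qed

text \<open>The exponentials are replaced by indicators one variable at a time. For the variable under treatment, the
  product of the indicators already present and the remaining exponentials is a bounded weight, and its
  conjugate is a weight of the same form with the coefficients negated.\<close>

lemma indep_vars_if_char_factorizes:
  fixes X :: "'i \<Rightarrow> 'a \<Rightarrow> real"
  assumes fin: "finite A" and X: "\<And>a. a \<in> A \<Longrightarrow> X a \<in> borel_measurable M"
    and fac: "\<And>c. (CLINT \<omega>|M. iexp (\<Sum>a\<in>A. c a * X a \<omega>)) = (\<Prod>a\<in>A. CLINT \<omega>|M. iexp (c a * X a \<omega>))"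
  shows "indep_vars (\<lambda>_. borel) X A"
proof (cases "A = {}")
  case True
  then show ?thesis by (simp add: indep_vars_def2 indep_sets_def)
next
  case False
  have claim: "(CLINT \<omega>|M. (\<Prod>b\<in>B. indicator (E b) (X b \<omega>)) * iexp (\<Sum>a\<in>A - B. c a * X a \<omega>))
      = (\<Prod>b\<in>B. CLINT \<omega>|M. indicator (E b) (X b \<omega>)) * (\<Prod>a\<in>A - B. CLINT \<omega>|M. iexp (c a * X a \<omega>))"
    if "finite B" "B \<subseteq> A" "\<And>b. E b \<in> sets borel" for B E c
    using that(1,2)
  proof (induction B arbitrary: c rule: finite_induct)
    case empty
    then show ?case using fac by simp
  next
    case (insert h B)
    have h: "h \<in> A" "h \<in> A - B" and hB: "h \<notin> B" and BA: "B \<subseteq> A" using insert by auto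
    define A' where "A' = A - insert h B"
    have A': "finite A'" "h \<notin> A'" "A - B = insert h A'" "A' \<subseteq> A" using fin h hB by (auto simp: A'_def)
    define w where "w c \<omega> = (\<Prod>b\<in>B. indicator (E b) (X b \<omega>)) * iexp (\<Sum>a\<in>A'. c a * X a \<omega>)" for c \<omega>
    have Xm[measurable]: "X a \<in> borel_measurable M" if "a \<in> A'" for a using X A' that by auto
    have Xm2[measurable]: "X a \<in> borel_measurable M" if "a \<in> B" for a using X BA that by auto
    have Xh[measurable]: "X h \<in> borel_measurable M" using X h by auto
    have Em[measurable]: "E b \<in> sets borel" for b by (rule that(3))
    have wm[measurable]: "w c \<in> borel_measurable M" for c unfolding w_def by measurable
    have IH: "(CLINT \<omega>|M. iexp (t * X h \<omega>) * w c \<omega>)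
        = (CLINT \<omega>|M. iexp (t * X h \<omega>)) * ((\<Prod>b\<in>B. CLINT \<omega>|M. indicator (E b) (X b \<omega>)) * (\<Prod>a\<in>A'. CLINT \<omega>|M. iexp (c a * X a \<omega>)))" for t c
    proof -
      have "(\<Sum>a\<in>A'. (c(h := t)) a * X a \<omega>) = (\<Sum>a\<in>A'. c a * X a \<omega>)" for \<omega>
        using A' by (intro sum.cong) auto
      moreover have "(\<Prod>a\<in>A'. CLINT \<omega>|M. iexp ((c(h := t)) a * X a \<omega>)) = (\<Prod>a\<in>A'. CLINT \<omega>|M. iexp (c a * X a \<omega>))"
        using A' by (intro prod.cong) auto
      ultimately show ?thesis
        using insert.IH[OF BA, of "c(h := t)"] unfolding A'(3) sum.insert[OF A'(1,2)] prod.insert[OF A'(1,2)]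
        by (simp add: w_def distrib_left exp_add mult_ac)
    qed
    have Ew: "(CLINT \<omega>|M. w c \<omega>) = (\<Prod>b\<in>B. CLINT \<omega>|M. indicator (E b) (X b \<omega>)) * (\<Prod>a\<in>A'. CLINT \<omega>|M. iexp (c a * X a \<omega>))" for c
      using IH[of 0 c] by (simp add: prob_space)
    have cnj_w: "cnj (w c \<omega>) = w (\<lambda>a. - c a) \<omega>" for c \<omega>
    proof -
      have "cnj (indicator S x) = (indicator S x :: complex)" for S and x :: real by (auto simp: indicator_def)
      then show ?thesis by (simp add: w_def sum_negf exp_cnj)
    qed
    have w1: "norm (w c \<omega>) \<le> 1" for c \<omega>
    proof -
      have "norm (\<Prod>b\<in>B. indicator (E b) (X b \<omega>) :: complex) \<le> 1"
        unfolding prod_norm[symmetric] by (intro prod_le_1) (auto simp: indicator_def)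
      then show ?thesis by (simp add: w_def norm_mult)
    qed
    have wi: "(CLINT \<omega>|M. indicator (E h) (X h \<omega>) * w c \<omega>) = (CLINT \<omega>|M. indicator (E h) (X h \<omega>)) * (CLINT \<omega>|M. w c \<omega>)"
    proof (rule complex_weight_independent)
      show "(CLINT \<omega>|M. iexp (t * X h \<omega>) * w c \<omega>) = (CLINT \<omega>|M. iexp (t * X h \<omega>)) * (CLINT \<omega>|M. w c \<omega>)" for t
        unfolding IH Ew ..
      show "(CLINT \<omega>|M. iexp (t * X h \<omega>) * cnj (w c \<omega>)) = (CLINT \<omega>|M. iexp (t * X h \<omega>)) * (CLINT \<omega>|M. cnj (w c \<omega>))" for t
        unfolding cnj_w IH Ew ..
    qed (auto simp: w1)
    have "(CLINT \<omega>|M. (\<Prod>b\<in>insert h B. indicator (E b) (X b \<omega>)) * iexp (\<Sum>a\<in>A - insert h B. c a * X a \<omega>))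
        = (CLINT \<omega>|M. indicator (E h) (X h \<omega>) * w c \<omega>)"
      unfolding w_def A'_def[symmetric] prod.insert[OF insert(1,2)] by (simp only: mult.assoc)
    also note wi
    also note Ew
    finally show ?case
      unfolding A'_def[symmetric] prod.insert[OF insert(1,2)] by (simp only: mult.assoc)
  qed
  have "(\<forall>E\<in>(\<Pi> i\<in>A. sets borel). prob (\<Inter>j\<in>A. X j -` E j \<inter> space M) = (\<Prod>j\<in>A. prob (X j -` E j \<inter> space M)))"
  proof
    fix E assume E: "E \<in> (\<Pi> i\<in>A. sets (borel :: real measure))"
    define E' where "E' a = (if a \<in> A then E a else {})" for a
    have E': "E' a \<in> sets borel" for a using E by (auto simp: E'_def)
    note [measurable] = X E'
    have ind: "(CLINT \<omega>|M. indicator (E' b) (X b \<omega>)) = of_real (prob (X b -` E' b \<inter> space M))" if b: "b \<in> A" for b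
    proof -
      have "(CLINT \<omega>|M. indicator (E' b) (X b \<omega>)) = (CLINT \<omega>|M. of_real (indicator (X b -` E' b \<inter> space M) \<omega>))"
        by (intro Bochner_Integration.integral_cong) (auto simp: indicator_def)
      also have "\<dots> = of_real (prob (X b -` E' b \<inter> space M))"
        unfolding integral_complex_of_real using X[OF b] E' by simp
      finally show ?thesis .
    qed
    have "(\<Inter>j\<in>A. X j -` E' j \<inter> space M) \<in> sets M"
      using X E' fin False by (intro sets.finite_INT) auto
    then have "of_real (prob (\<Inter>j\<in>A. X j -` E' j \<inter> space M)) = (CLINT \<omega>|M. of_real (indicator (\<Inter>j\<in>A. X j -` E' j \<inter> space M) \<omega>))"
      unfolding integral_complex_of_real using sets.sets_into_space[of _ M] by (simp add: Int_absorb2)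
    also have "\<dots> = (CLINT \<omega>|M. (\<Prod>b\<in>A. indicator (E' b) (X b \<omega>)))"
    proof (intro Bochner_Integration.integral_cong refl)
      fix \<omega> assume "\<omega> \<in> space M"
      then show "complex_of_real (indicator (\<Inter>j\<in>A. X j -` E' j \<inter> space M) \<omega>) = (\<Prod>b\<in>A. indicator (E' b) (X b \<omega>))"
        using fin False by (auto simp: indicator_def prod_zero_iff intro!: prod.neutral)
    qed
    also have "\<dots> = (\<Prod>b\<in>A. of_real (prob (X b -` E' b \<inter> space M)))"
      using claim[of A E' "\<lambda>_. 0"] fin E' ind by simp
    finally have "prob (\<Inter>j\<in>A. X j -` E' j \<inter> space M) = (\<Prod>b\<in>A. prob (X b -` E' b \<inter> space M))"
      by (simp flip: of_real_prod)
    then show "prob (\<Inter>j\<in>A. X j -` E j \<inter> space M) = (\<Prod>j\<in>A. prob (X j -` E j \<inter> space M))"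
      by (simp add: E'_def)
  qed
  then show ?thesis
    using False fin X
    by (subst indep_vars_finite[where E = "\<lambda>_. sets borel"])
       (auto simp: Int_stable_def sets.sigma_sets_eq[of borel, simplified])
qed

lemma centered_gaussian_moments:
  assumes "centered_gaussian_rv M X"
  shows centered_gaussian_integrable: "integrable M (\<lambda>\<omega>. (X \<omega>)\<^sup>2)"
    and centered_gaussian_char: "(CLINT \<omega>|M. iexp (t * X \<omega>)) = of_real (exp (- t\<^sup>2 * (LINT \<omega>|M. (X \<omega>)\<^sup>2) / 2))"
    and centered_gaussian_mean: "(LINT \<omega>|M. X \<omega>) = 0"
proof -
  have X[measurable]: "X \<in> borel_measurable M" using assms by (simp add: centered_gaussian_rv_def)
  have "integrable M (\<lambda>\<omega>. (X \<omega>)\<^sup>2) \<and> (CLINT \<omega>|M. iexp (t * X \<omega>)) = of_real (exp (- t\<^sup>2 * (LINT \<omega>|M. (X \<omega>)\<^sup>2) / 2))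
    \<and> (LINT \<omega>|M. X \<omega>) = 0"
  proof (cases "distr M borel X = return borel 0")
    case True
    have "AE x in distr M borel X. x = 0" unfolding True by (subst AE_return) auto
    then have 0: "AE \<omega> in M. X \<omega> = 0" by (subst (asm) AE_distr_iff) auto
    have "integrable M (\<lambda>\<omega>. (X \<omega>)\<^sup>2)"
      by (subst integrable_cong_AE[where g = "\<lambda>_. 0"]) (use 0 in auto)
    moreover have "(LINT \<omega>|M. (X \<omega>)\<^sup>2) = 0"
      by (subst integral_cong_AE[where g = "\<lambda>_. 0"]) (use 0 in auto)
    moreover have "(LINT \<omega>|M. X \<omega>) = 0"
      by (subst integral_cong_AE[where g = "\<lambda>_. 0"]) (use 0 in auto)
    moreover have "(CLINT \<omega>|M. iexp (t * X \<omega>)) = (CLINT \<omega>|M. 1)"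
      by (rule integral_cong_AE) (use 0 in auto)
    ultimately show ?thesis by (simp add: prob_space)
  next
    case False
    then obtain \<sigma> where \<sigma>: "\<sigma> > 0" and D: "distributed M lborel X (\<lambda>x. ennreal (normal_density 0 \<sigma> x))"
      using assms by (auto simp: centered_gaussian_rv_def)
    have "distributed M lborel (\<lambda>\<omega>. (X \<omega> - 0) / \<sigma>) (\<lambda>x. ennreal (std_normal_density x))"
      using D \<sigma> by (subst (asm) normal_standard_normal_convert) auto
    then have Y: "distr M lborel (\<lambda>\<omega>. X \<omega> / \<sigma>) = std_normal_distribution"
      by (simp add: distributed_def)
    have "(CLINT \<omega>|M. iexp (t * X \<omega>)) = (CLINT \<omega>|M. iexp ((t * \<sigma>) * (X \<omega> / \<sigma>)))"
      using \<sigma> by simp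
    also have "\<dots> = char std_normal_distribution (t * \<sigma>)"
      unfolding char_def Y[symmetric] by (rule integral_distr[symmetric]) auto
    also have "\<dots> = of_real (exp (- t\<^sup>2 * \<sigma>\<^sup>2 / 2))"
      by (simp add: char_std_normal_distribution power_mult_distrib)
    finally have "(CLINT \<omega>|M. iexp (t * X \<omega>)) = of_real (exp (- t\<^sup>2 * \<sigma>\<^sup>2 / 2))" .
    moreover have "(LINT \<omega>|M. (X \<omega>)\<^sup>2) = \<sigma>\<^sup>2"
      using distributed_integral[OF D, of "\<lambda>x. x\<^sup>2"] integral_normal_moment_even[OF \<sigma>, of 0 1] \<sigma>
      by simp
    moreover have "integrable M (\<lambda>\<omega>. (X \<omega>)\<^sup>2)"
      using distributed_integrable[OF D, of "\<lambda>x. x\<^sup>2"] integrable_normal_moment[OF \<sigma>, of 0 2] by simp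
    moreover have "(LINT \<omega>|M. X \<omega>) = 0"
      using distributed_integral[OF D, of "\<lambda>x. x"] integral_normal_moment_odd[OF \<sigma>, of 0 0] by simp
    ultimately show ?thesis by simp
  qed
  then show "integrable M (\<lambda>\<omega>. (X \<omega>)\<^sup>2)"
    "(CLINT \<omega>|M. iexp (t * X \<omega>)) = of_real (exp (- t\<^sup>2 * (LINT \<omega>|M. (X \<omega>)\<^sup>2) / 2))"
    "(LINT \<omega>|M. X \<omega>) = 0" by auto
qed

end

section \<open>Increments of the Brownian sheet over a grid\<close>

lemma (in prob_space) integrable_mult_L2:
  fixes X Y :: "'a \<Rightarrow> real"
  assumes [measurable]: "X \<in> borel_measurable M" "Y \<in> borel_measurable M"
    and "integrable M (\<lambda>\<omega>. (X \<omega>)\<^sup>2)" "integrable M (\<lambda>\<omega>. (Y \<omega>)\<^sup>2)"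
  shows "integrable M (\<lambda>\<omega>. X \<omega> * Y \<omega>)"
proof (rule Bochner_Integration.integrable_bound)
  show "integrable M (\<lambda>\<omega>. (X \<omega>)\<^sup>2 + (Y \<omega>)\<^sup>2)" using assms by simp
  have "\<bar>a * b\<bar> \<le> a\<^sup>2 + b\<^sup>2" for a b :: real
  proof -
    have "2 * (\<bar>a\<bar> * \<bar>b\<bar>) \<le> a\<^sup>2 + b\<^sup>2" using sum_squares_bound[of "\<bar>a\<bar>" "\<bar>b\<bar>"] by simp
    moreover have "0 \<le> \<bar>a\<bar> * \<bar>b\<bar>" by simp
    ultimately show ?thesis unfolding abs_mult by linarith
  qed
  then show "AE \<omega> in M. norm (X \<omega> * Y \<omega>) \<le> norm ((X \<omega>)\<^sup>2 + (Y \<omega>)\<^sup>2)" by simp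
qed simp

locale brownian_sheet_space = prob_space M
  for M :: "'w measure" and W :: "'d::finite \<Rightarrow> real \<times> real \<Rightarrow> 'w \<Rightarrow> real" +
  assumes sheet: "brownian_sheet M W"
begin

text \<open>The linear span of the values of one component. All its elements are Gaussian, and increments over cells
  belong to it.\<close>

definition first_chaos :: "'d \<Rightarrow> ('w \<Rightarrow> real) set" where
  "first_chaos k = {\<lambda>\<omega>. \<Sum>p\<in>S. c p * W k p \<omega> | S c. finite S \<and> S \<subseteq> unit_square}"

lemma first_chaos_gaussian: "Y \<in> first_chaos k \<Longrightarrow> centered_gaussian_rv M Y"
  using sheet by (auto simp: first_chaos_def brownian_sheet_def wiener_sheet_def centered_gaussian_process_def)

lemma first_chaos_measurable: "Y \<in> first_chaos k \<Longrightarrow> Y \<in> borel_measurable M"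
  using first_chaos_gaussian by (auto simp: centered_gaussian_rv_def)

lemma first_chaos_square_integrable: "Y \<in> first_chaos k \<Longrightarrow> integrable M (\<lambda>\<omega>. (Y \<omega>)\<^sup>2)"
  using first_chaos_gaussian centered_gaussian_integrable by blast

lemma first_chaos_mult_integrable:
  "Y \<in> first_chaos k \<Longrightarrow> Z \<in> first_chaos k \<Longrightarrow> integrable M (\<lambda>\<omega>. Y \<omega> * Z \<omega>)"
  by (intro integrable_mult_L2 first_chaos_measurable first_chaos_square_integrable)

lemma first_chaos_sheet: "p \<in> unit_square \<Longrightarrow> W k p \<in> first_chaos k"
  unfolding first_chaos_def by (intro CollectI exI[of _ "{p}"] exI[of _ "\<lambda>_. 1"]) auto

lemma first_chaos_cmult:
  assumes "Y \<in> first_chaos k"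
  shows "(\<lambda>\<omega>. a * Y \<omega>) \<in> first_chaos k"
proof -
  from assms obtain S c where S: "finite S" "S \<subseteq> unit_square" "Y = (\<lambda>\<omega>. \<Sum>p\<in>S. c p * W k p \<omega>)"
    by (auto simp: first_chaos_def)
  then have "(\<lambda>\<omega>. a * Y \<omega>) = (\<lambda>\<omega>. \<Sum>p\<in>S. (a * c p) * W k p \<omega>)" by (simp add: sum_distrib_left mult.assoc)
  with S show ?thesis by (auto simp: first_chaos_def intro!: exI[of _ S] exI[of _ "\<lambda>p. a * c p"])
qed

lemma first_chaos_add:
  assumes "Y \<in> first_chaos k" "Z \<in> first_chaos k"
  shows "(\<lambda>\<omega>. Y \<omega> + Z \<omega>) \<in> first_chaos k"
proof -
  from assms obtain S c S' c' where S: "finite S" "S \<subseteq> unit_square" "Y = (\<lambda>\<omega>. \<Sum>p\<in>S. c p * W k p \<omega>)"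
    and S': "finite S'" "S' \<subseteq> unit_square" "Z = (\<lambda>\<omega>. \<Sum>p\<in>S'. c' p * W k p \<omega>)"
    by (auto simp: first_chaos_def)
  define e where "e p = (if p \<in> S then c p else 0) + (if p \<in> S' then c' p else 0)" for p
  have "(\<lambda>\<omega>. Y \<omega> + Z \<omega>) = (\<lambda>\<omega>. \<Sum>p\<in>S \<union> S'. e p * W k p \<omega>)"
  proof
    fix \<omega>
    have "Y \<omega> = (\<Sum>p\<in>S \<union> S'. (if p \<in> S then c p else 0) * W k p \<omega>)"
      unfolding S(3) using S(1) S'(1) by (intro sum.mono_neutral_cong_left) auto
    moreover have "Z \<omega> = (\<Sum>p\<in>S \<union> S'. (if p \<in> S' then c' p else 0) * W k p \<omega>)"
      unfolding S'(3) using S(1) S'(1) by (intro sum.mono_neutral_cong_left) auto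
    ultimately show "Y \<omega> + Z \<omega> = (\<Sum>p\<in>S \<union> S'. e p * W k p \<omega>)"
      by (simp add: e_def distrib_right sum.distrib)
  qed
  moreover have "finite (S \<union> S')" "S \<union> S' \<subseteq> unit_square" using S S' by auto
  ultimately show ?thesis unfolding first_chaos_def by blast
qed

lemma first_chaos_sum:
  assumes "finite A" "\<And>a. a \<in> A \<Longrightarrow> Y a \<in> first_chaos k"
  shows "(\<lambda>\<omega>. \<Sum>a\<in>A. c a * Y a \<omega>) \<in> first_chaos k"
  using assms
proof (induction A rule: finite_induct)
  case empty
  then show ?case unfolding first_chaos_def by (intro CollectI exI[of _ "{}"]) auto
next
  case (insert a A)
  then show ?case by (auto intro!: first_chaos_add first_chaos_cmult)
qed

lemma sheet_covariance:
  "p \<in> unit_square \<Longrightarrow> q \<in> unit_square \<Longrightarrow>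
    (LINT \<omega>|M. W k p \<omega> * W k q \<omega>) = min (fst p) (fst q) * min (snd p) (snd q)"
  using sheet unfolding brownian_sheet_def wiener_sheet_def by (cases p; cases q) fastforce

lemma first_chaos_increment:
  assumes "(s, t) \<in> unit_square" "(s', t') \<in> unit_square"
  shows "cell_increment (W k) ((s, t), (s', t')) \<in> first_chaos k"
proof -
  have "(\<lambda>\<omega>. (W k (s', t') \<omega> + (-1) * W k (s, t') \<omega>) + ((-1) * W k (s', t) \<omega> + W k (s, t) \<omega>)) \<in> first_chaos k"
    using assms by (intro first_chaos_add first_chaos_cmult first_chaos_sheet) (auto simp: unit_square_def)
  then show ?thesis by (simp add: cell_increment_def algebra_simps)
qed

lemma increment_covariance:
  assumes "(s, t) \<in> unit_square" "(s', t') \<in> unit_square" "(u, v) \<in> unit_square" "(u', v') \<in> unit_square"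
  shows "(LINT \<omega>|M. cell_increment (W k) ((s, t), (s', t')) \<omega> * cell_increment (W k) ((u, v), (u', v')) \<omega>)
    = (min s' u' - min s u' - min s' u + min s u) * (min t' v' - min t v' - min t' v + min t v)"
proof -
  have *: "integrable M (\<lambda>\<omega>. W k p \<omega> * W k q \<omega>)" if "p \<in> unit_square" "q \<in> unit_square" for p q
    using that by (intro first_chaos_mult_integrable[of _ k] first_chaos_sheet)
  have in_sq: "(s', t) \<in> unit_square" "(s, t') \<in> unit_square" "(u, v') \<in> unit_square" "(u', v) \<in> unit_square"
    using assms by (auto simp: unit_square_def)
  show ?thesis
    unfolding cell_increment_def
    by (simp add: * assms in_sq sheet_covariance left_diff_distrib right_diff_distrib distrib_left distrib_right)
qed

end

text \<open>A grid cell is named by its upper right corner. As cells are half open, a cell with corners on the grid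
  contains a grid cell if and only if it contains the corner that names it, so kernels can be evaluated at
  corners instead of on cells.\<close>

definition grid_pred :: "real set \<Rightarrow> real \<Rightarrow> real" where
  "grid_pred D t = Max {s\<in>D. s < t}"

definition grid_corners :: "real set \<Rightarrow> (real \<times> real) set" where
  "grid_corners D = (D - {0}) \<times> (D - {0})"

definition grid_cell :: "real set \<Rightarrow> real \<times> real \<Rightarrow> (real \<times> real) \<times> (real \<times> real)" where
  "grid_cell D = (\<lambda>(a, b). ((grid_pred D a, grid_pred D b), (a, b)))"

definition is_grid :: "real set \<Rightarrow> bool" where
  "is_grid D \<longleftrightarrow> finite D \<and> {0, 1} \<subseteq> D \<and> D \<subseteq> {0..1}"

lemma grid_pred:
  assumes "is_grid D" "t \<in> D - {0}"
  shows "grid_pred D t \<in> D" "grid_pred D t < t" "s \<in> D \<Longrightarrow> s < t \<Longrightarrow> s \<le> grid_pred D t"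
proof -
  have "finite {s\<in>D. s < t}" "0 \<in> {s\<in>D. s < t}" using assms by (auto simp: is_grid_def)
  then have "grid_pred D t \<in> {s\<in>D. s < t}" and max: "\<And>s. s \<in> {s\<in>D. s < t} \<Longrightarrow> s \<le> grid_pred D t"
    unfolding grid_pred_def using Max_in[of "{s\<in>D. s < t}"] Max_ge[of "{s\<in>D. s < t}"] by blast+
  then show "grid_pred D t \<in> D" "grid_pred D t < t" by auto
  show "s \<in> D \<Longrightarrow> s < t \<Longrightarrow> s \<le> grid_pred D t" using max by simp
qed

lemma grid_pred_in: "is_grid D \<Longrightarrow> t \<in> D \<Longrightarrow> t \<noteq> 0 \<Longrightarrow> grid_pred D t \<in> D"
  using grid_pred(1) by simp

lemma grid_unit_square: "is_grid D \<Longrightarrow> a \<in> D \<Longrightarrow> b \<in> D \<Longrightarrow> (a, b) \<in> unit_square"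
  unfolding is_grid_def unit_square_def by blast

lemma grid_telescope:
  fixes F :: "real \<Rightarrow> 'b::ab_group_add"
  assumes D: "is_grid D" and "s \<in> D" "s' \<in> D" "s \<le> s'"
  shows "F s' - F s = (\<Sum>t\<in>{t\<in>D - {0}. s < t \<and> t \<le> s'}. F t - F (grid_pred D t))"
proof -
  have "\<And>s'. s' \<in> D \<Longrightarrow> s \<le> s' \<Longrightarrow> card {t\<in>D. t < s'} = n \<Longrightarrow>
    F s' - F s = (\<Sum>t\<in>{t\<in>D - {0}. s < t \<and> t \<le> s'}. F t - F (grid_pred D t))" for n
  proof (induction n rule: less_induct)
    case (less n s')
    show ?case
    proof (cases "s = s'")
      case False
      have fin: "finite D" using D by (simp add: is_grid_def)
      have s': "s' \<in> D - {0}" "s < s'" using less.prems False \<open>s \<in> D\<close> D by (auto simp: is_grid_def)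
      define p where "p = grid_pred D s'"
      have p: "p \<in> D" "p < s'" "s \<le> p" "\<And>t. t \<in> D \<Longrightarrow> t < s' \<Longrightarrow> t \<le> p"
        unfolding p_def using grid_pred[OF D s'(1)] \<open>s \<in> D\<close> s' by auto
      have "card {t\<in>D. t < p} < n"
        unfolding less.prems(3)[symmetric] by (rule psubset_card_mono) (use fin p in auto)
      from less.IH[OF this p(1,3) refl]
      have "F p - F s = (\<Sum>t\<in>{t\<in>D - {0}. s < t \<and> t \<le> p}. F t - F (grid_pred D t))" .
      moreover have "{t\<in>D - {0}. s < t \<and> t \<le> s'} = insert s' {t\<in>D - {0}. s < t \<and> t \<le> p}"
        using p s' by force
      moreover have "finite {t\<in>D - {0}. s < t \<and> t \<le> p}" "s' \<notin> {t\<in>D - {0}. s < t \<and> t \<le> p}"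
        using fin p by auto
      moreover have "F s' - F s = (F s' - F p) + (F p - F s)" by simp
      ultimately show ?thesis by (simp add: p_def[symmetric])
    next
      case True
      then have "{t\<in>D - {0}. s < t \<and> t \<le> s'} = {}" by auto
      with True show ?thesis by (simp only: sum.empty diff_self)
    qed
  qed
  with assms show ?thesis by blast
qed

lemma cell_increment_grid:
  assumes D: "is_grid D" and "s \<in> D" "s' \<in> D" "s \<le> s'" "t \<in> D" "t' \<in> D" "t \<le> t'"
  shows "cell_increment B ((s, t), (s', t')) \<omega>
    = (\<Sum>g\<in>grid_corners D. indicator (cell ((s, t), (s', t'))) g * cell_increment B (grid_cell D g) \<omega>)"
proof -
  have fin: "finite D" using D by (simp add: is_grid_def)
  let ?G = "\<lambda>a. B (a, t') \<omega> - B (a, t) \<omega>"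
  have "cell_increment B ((s, t), (s', t')) \<omega> = ?G s' - ?G s" by (simp add: cell_increment_def)
  also have "\<dots> = (\<Sum>a\<in>{a\<in>D - {0}. s < a \<and> a \<le> s'}. ?G a - ?G (grid_pred D a))"
    by (rule grid_telescope) fact+
  also have "\<dots> = (\<Sum>a\<in>{a\<in>D - {0}. s < a \<and> a \<le> s'}. \<Sum>b\<in>{b\<in>D - {0}. t < b \<and> b \<le> t'}.
      cell_increment B (grid_cell D (a, b)) \<omega>)"
  proof (rule sum.cong[OF refl])
    fix a
    have "?G a - ?G (grid_pred D a)
        = (B (a, t') \<omega> - B (grid_pred D a, t') \<omega>) - (B (a, t) \<omega> - B (grid_pred D a, t) \<omega>)" by simp
    also have "\<dots> = (\<Sum>b\<in>{b\<in>D - {0}. t < b \<and> b \<le> t'}.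
        (B (a, b) \<omega> - B (grid_pred D a, b) \<omega>) - (B (a, grid_pred D b) \<omega> - B (grid_pred D a, grid_pred D b) \<omega>))"
      by (rule grid_telescope) fact+
    finally show "?G a - ?G (grid_pred D a) = (\<Sum>b\<in>{b\<in>D - {0}. t < b \<and> b \<le> t'}.
      cell_increment B (grid_cell D (a, b)) \<omega>)"
      by (simp add: cell_increment_def grid_cell_def algebra_simps)
  qed
  also have "\<dots> = (\<Sum>g\<in>{a\<in>D - {0}. s < a \<and> a \<le> s'} \<times> {b\<in>D - {0}. t < b \<and> b \<le> t'}.
      cell_increment B (grid_cell D g) \<omega>)"
    by (simp add: sum.cartesian_product case_prod_beta)
  also have "\<dots> = (\<Sum>g\<in>grid_corners D. indicator (cell ((s, t), (s', t'))) g * cell_increment B (grid_cell D g) \<omega>)"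
    using fin by (intro sum.mono_neutral_cong_left) (auto simp: grid_corners_def cell_def indicator_def)
  finally show ?thesis .
qed

definition grid_area :: "real set \<Rightarrow> real \<times> real \<Rightarrow> real" where
  "grid_area D = (\<lambda>(a, b). (a - grid_pred D a) * (b - grid_pred D b))"

text \<open>The one-dimensional covariance of two increments is the length of the intersection of their intervals;
  intervals of a grid are equal or disjoint.\<close>

lemma grid_overlap:
  assumes D: "is_grid D" and a: "a \<in> D - {0}" "b \<in> D - {0}"
  shows "min a b - min (grid_pred D a) b - min a (grid_pred D b) + min (grid_pred D a) (grid_pred D b)
    = (if a = b then a - grid_pred D a else 0)"
proof (cases a b rule: linorder_cases)
  case less
  then have "a \<le> grid_pred D b" "grid_pred D a < a" "grid_pred D b < b"
    using grid_pred[OF D a(1)] grid_pred[OF D a(2)] a by auto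
  with less show ?thesis by (simp add: min_def)
next
  case equal
  then show ?thesis using grid_pred[OF D a(2)] by (simp add: min_def)
next
  case greater
  then have "b \<le> grid_pred D a" "grid_pred D a < a" "grid_pred D b < b"
    using grid_pred[OF D a(1)] grid_pred[OF D a(2)] a by auto
  with greater show ?thesis by (simp add: min_def)
qed

context brownian_sheet_space
begin

definition grid_increment :: "real set \<Rightarrow> 'd \<times> (real \<times> real) \<Rightarrow> 'w \<Rightarrow> real" where
  "grid_increment D = (\<lambda>(k, g). cell_increment (W k) (grid_cell D g))"

lemma grid_increment_first_chaos:
  assumes "is_grid D" "g \<in> grid_corners D"
  shows "grid_increment D (k, g) \<in> first_chaos k"
  using assms by (cases g) (auto simp: grid_increment_def grid_cell_def grid_corners_def
     intro!: first_chaos_increment grid_unit_square grid_pred_in)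

lemma grid_increment_measurable:
  assumes "is_grid D" "snd a \<in> grid_corners D"
  shows "grid_increment D a \<in> borel_measurable M"
  using grid_increment_first_chaos[OF assms(1), of "snd a" "fst a"] assms(2) first_chaos_measurable by simp

lemma grid_increment_covariance:
  assumes D: "is_grid D" and g: "g \<in> grid_corners D" "h \<in> grid_corners D"
  shows "(LINT \<omega>|M. grid_increment D (k, g) \<omega> * grid_increment D (k, h) \<omega>) = (if g = h then grid_area D g else 0)"
proof -
  obtain a b c d where gh: "g = (a, b)" "h = (c, d)" by (cases g; cases h)
  with g have m: "a \<in> D - {0}" "b \<in> D - {0}" "c \<in> D - {0}" "d \<in> D - {0}" by (auto simp: grid_corners_def)
  have "(LINT \<omega>|M. grid_increment D (k, g) \<omega> * grid_increment D (k, h) \<omega>) =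
    (if a = c then a - grid_pred D a else 0) * (if b = d then b - grid_pred D b else 0)"
    using grid_overlap[OF D m(1,3)] grid_overlap[OF D m(2,4)]
    unfolding gh grid_increment_def grid_cell_def prod.case
    by (subst increment_covariance) (use m in \<open>auto intro!: grid_unit_square grid_pred_in D\<close>)
  then show ?thesis by (auto simp: gh grid_area_def)
qed

text \<open>Within a component the increments are jointly Gaussian and orthogonal, so their joint characteristic
  function is a product; across components it factorizes because the components are independent.\<close>

lemma grid_increment_indep:
  assumes D: "is_grid D"
  shows "indep_vars (\<lambda>_. borel) (grid_increment D) (UNIV \<times> grid_corners D)"
proof (rule indep_vars_if_char_factorizes)
  let ?G = "grid_corners D"
  have finG: "finite ?G" using D by (auto simp: is_grid_def grid_corners_def)
  show "finite ((UNIV :: 'd set) \<times> ?G)" using finG by simp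
  show "a \<in> UNIV \<times> ?G \<Longrightarrow> grid_increment D a \<in> borel_measurable M" for a
    using grid_increment_measurable[OF D] by auto
  fix c :: "'d \<times> (real \<times> real) \<Rightarrow> real"
  define L where "L k \<omega> = (\<Sum>g\<in>?G. c (k, g) * grid_increment D (k, g) \<omega>)" for k \<omega>
  have L: "L k \<in> first_chaos k" for k
    unfolding L_def[abs_def] using grid_increment_first_chaos[OF D]
    by (intro first_chaos_sum[OF finG]) auto
  have Lsq: "(LINT \<omega>|M. (L k \<omega>)\<^sup>2) = (\<Sum>g\<in>?G. (c (k, g))\<^sup>2 * grid_area D g)" for k
  proof -
    have int: "integrable M (\<lambda>\<omega>. grid_increment D (k, g) \<omega> * grid_increment D (k, h) \<omega>)"
      if "g \<in> ?G" "h \<in> ?G" for g h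
      by (rule first_chaos_mult_integrable[of _ k]) (auto intro!: grid_increment_first_chaos D that)
    have "(LINT \<omega>|M. (L k \<omega>)\<^sup>2) = (LINT \<omega>|M. (\<Sum>g\<in>?G. \<Sum>h\<in>?G. (c (k, g) * c (k, h)) *
         (grid_increment D (k, g) \<omega> * grid_increment D (k, h) \<omega>)))"
      unfolding L_def power2_eq_square sum_product by (simp add: mult_ac)
    also have "\<dots> = (\<Sum>g\<in>?G. \<Sum>h\<in>?G. (c (k, g) * c (k, h)) * (if g = h then grid_area D g else 0))"
      using int by (simp add: grid_increment_covariance[OF D])
    also have "\<dots> = (\<Sum>g\<in>?G. (c (k, g))\<^sup>2 * grid_area D g)"
    proof (rule sum.cong[OF refl])
      fix g assume g: "g \<in> ?G"
      have "(\<Sum>h\<in>?G. (c (k, g) * c (k, h)) * (if g = h then grid_area D g else 0))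
          = (\<Sum>h\<in>?G. if g = h then (c (k, g) * c (k, h)) * grid_area D g else 0)"
        by (intro sum.cong) auto
      then show "(\<Sum>h\<in>?G. (c (k, g) * c (k, h)) * (if g = h then grid_area D g else 0)) = (c (k, g))\<^sup>2 * grid_area D g"
        using finG g by (simp add: power2_eq_square)
    qed
    finally show ?thesis .
  qed
  have charL: "(CLINT \<omega>|M. iexp (L k \<omega>)) = (\<Prod>g\<in>?G. CLINT \<omega>|M. iexp (c (k, g) * grid_increment D (k, g) \<omega>))" for k
  proof -
    have single: "(CLINT \<omega>|M. iexp (c (k, g) * grid_increment D (k, g) \<omega>))
        = of_real (exp (- ((c (k, g))\<^sup>2 * grid_area D g) / 2))" if g: "g \<in> ?G" for g
      using grid_increment_covariance[OF D g g, of k] centered_gaussian_char[OF first_chaos_gaussian[OF grid_increment_first_chaos[OF D g, of k]], of "c (k, g)"]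
      by (simp add: power2_eq_square mult_ac)
    have "(CLINT \<omega>|M. iexp (L k \<omega>)) = of_real (exp (- (\<Sum>g\<in>?G. (c (k, g))\<^sup>2 * grid_area D g) / 2))"
      using centered_gaussian_char[OF first_chaos_gaussian[OF L], of 1 k] unfolding Lsq by simp
    also have "(- (\<Sum>g\<in>?G. (c (k, g))\<^sup>2 * grid_area D g) / 2) = (\<Sum>g\<in>?G. - ((c (k, g))\<^sup>2 * grid_area D g) / 2)"
      by (simp add: sum_negf sum_divide_distrib)
    also have "complex_of_real (exp \<dots>) = (\<Prod>g\<in>?G. of_real (exp (- ((c (k, g))\<^sup>2 * grid_area D g) / 2)))"
      by (simp only: exp_sum[OF finG] of_real_prod)
    finally show ?thesis using single by simp
  qed
  have indep: "indep_vars (\<lambda>_. borel) (\<lambda>k \<omega>. iexp (L k \<omega>)) UNIV"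
  proof -
    \<comment> \<open>the exponential as a function of the path, to which the independence hypothesis applies\<close>
    define \<Phi> where "\<Phi> k f = iexp (\<Sum>g\<in>?G. c (k, g) * cell_increment (\<lambda>p f. f p) (grid_cell D g) f)"
      for k and f :: "real \<times> real \<Rightarrow> real"
    have "indep_vars (\<lambda>_. borel) (\<lambda>k \<omega>. \<Phi> k (\<lambda>p\<in>unit_square. W k p \<omega>)) UNIV"
    proof (rule indep_vars_compose2[where X = "\<lambda>k \<omega>. \<lambda>p\<in>unit_square. W k p \<omega>" and Y = \<Phi> and M' = "\<lambda>_. PiM unit_square (\<lambda>_. borel)"])
      show "indep_vars (\<lambda>_. PiM unit_square (\<lambda>_. borel)) (\<lambda>k \<omega>. \<lambda>p\<in>unit_square. W k p \<omega>) UNIV"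
        using sheet by (simp add: brownian_sheet_def)
      fix k
      have "(\<lambda>f. cell_increment (\<lambda>p f. f p) (grid_cell D g) f) \<in> borel_measurable (PiM unit_square (\<lambda>_. borel))"
        if "g \<in> ?G" for g :: "real \<times> real"
      proof -
        have comp: "p \<in> unit_square \<Longrightarrow> (\<lambda>f. f p) \<in> borel_measurable (PiM unit_square (\<lambda>_. borel :: real measure))" for p
          by (rule measurable_component_singleton)
        then show ?thesis
          using that by (cases g) (auto simp: cell_increment_def grid_cell_def grid_corners_def
            intro!: borel_measurable_diff borel_measurable_add comp grid_unit_square grid_pred_in D)
      qed
      note [measurable] = this
      show "\<Phi> k \<in> borel_measurable (PiM unit_square (\<lambda>_. borel))"
        unfolding \<Phi>_def[abs_def] by measurable
    qed
    also have "(\<lambda>k \<omega>. \<Phi> k (\<lambda>p\<in>unit_square. W k p \<omega>)) = (\<lambda>k \<omega>. iexp (L k \<omega>))"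
    proof (intro ext)
      fix k \<omega>
      have "(\<Sum>g\<in>?G. c (k, g) * cell_increment (\<lambda>p f. f p) (grid_cell D g) (\<lambda>p\<in>unit_square. W k p \<omega>)) = L k \<omega>"
        unfolding L_def
      proof (rule sum.cong[OF refl])
        fix g assume "g \<in> ?G"
        then show "c (k, g) * cell_increment (\<lambda>p f. f p) (grid_cell D g) (\<lambda>p\<in>unit_square. W k p \<omega>) = c (k, g) * grid_increment D (k, g) \<omega>"
          by (cases g) (simp add: grid_corners_def grid_increment_def cell_increment_def grid_cell_def grid_unit_square[OF D] grid_pred_in[OF D])
      qed
      then show "\<Phi> k (\<lambda>p\<in>unit_square. W k p \<omega>) = iexp (L k \<omega>)" by (simp add: \<Phi>_def)
    qed
    finally show ?thesis .
  qed
  have int: "integrable M (\<lambda>\<omega>. iexp (L k \<omega>))" for k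
    by (rule integrable_const_bound[where B = 1]) (use first_chaos_measurable[OF L, of k] in auto)
  have "(CLINT \<omega>|M. iexp (\<Sum>a\<in>UNIV \<times> ?G. c a * grid_increment D a \<omega>)) = (CLINT \<omega>|M. \<Prod>k\<in>UNIV. iexp (L k \<omega>))"
  proof (intro Bochner_Integration.integral_cong refl)
    fix \<omega>
    have "(\<Sum>a\<in>UNIV \<times> ?G. c a * grid_increment D a \<omega>) = (\<Sum>k\<in>UNIV. L k \<omega>)"
      unfolding L_def by (simp add: sum.cartesian_product)
    then show "iexp (\<Sum>a\<in>UNIV \<times> ?G. c a * grid_increment D a \<omega>) = (\<Prod>k\<in>UNIV. iexp (L k \<omega>))"
      by (simp add: sum_distrib_left exp_sum)
  qed
  also have "\<dots> = (\<Prod>k\<in>UNIV. CLINT \<omega>|M. iexp (L k \<omega>))"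
    by (rule indep_vars_lebesgue_integral[OF finite indep int])
  also have "\<dots> = (\<Prod>k\<in>UNIV. \<Prod>g\<in>?G. CLINT \<omega>|M. iexp (c (k, g) * grid_increment D (k, g) \<omega>))"
    by (simp only: charL)
  also have "\<dots> = (\<Prod>a\<in>UNIV \<times> ?G. CLINT \<omega>|M. iexp (c a * grid_increment D a \<omega>))"
    by (simp add: prod.cartesian_product case_prod_beta)
  finally show "(CLINT \<omega>|M. iexp (\<Sum>a\<in>UNIV \<times> ?G. c a * grid_increment D a \<omega>))
    = (\<Prod>a\<in>UNIV \<times> ?G. CLINT \<omega>|M. iexp (c a * grid_increment D a \<omega>))" .
qed

end

section \<open>Elementary kernels on a grid\<close>

abbreviation square_measure :: "(real \<times> real) measure" where
  "square_measure \<equiv> restrict_space lborel unit_square"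

lemma unit_square_sets[measurable]: "unit_square \<in> sets borel"
  unfolding unit_square_def by (intro borel_closed closed_Times) auto

lemma prob_space_square_measure: "prob_space square_measure"
proof
  have "emeasure square_measure (space square_measure) = emeasure (lborel \<Otimes>\<^sub>M lborel) ({0..1::real} \<times> {0..1::real})"
    by (subst emeasure_restrict_space) (auto simp: lborel_prod unit_square_def[symmetric] space_restrict_space)
  also have "\<dots> = 1" by (subst lborel.emeasure_pair_measure_Times) auto
  finally show "emeasure square_measure (space square_measure) = 1" .
qed

interpretation square: prob_space square_measure by (rule prob_space_square_measure)

interpretation points: product_sigma_finite "\<lambda>_. square_measure"
  by (simp add: product_sigma_finite_def prob_space_imp_sigma_finite prob_space_square_measure)

lemma finite_slots[simp]: "finite (slots (n :: 'd::finite \<Rightarrow> nat))"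
  by (simp add: slots_def)

lemma prob_space_points_measure: "prob_space (points_measure (n :: 'd::finite \<Rightarrow> nat))"
  unfolding points_measure_def by (intro prob_space_PiM prob_space_square_measure)

lemma space_points_measure: "space (points_measure n) = PiE (slots n) (\<lambda>_. unit_square)"
  by (simp add: points_measure_def space_PiM space_restrict_space)

lemma cell_sets[measurable]: "cell R \<in> sets borel"
proof -
  obtain s t s' t' where "R = ((s, t), (s', t'))" by (metis surj_pair)
  moreover have "{s<..s'} \<times> {t<..t'} \<in> sets (borel :: (real \<times> real) measure)"
    unfolding borel_prod[symmetric] by (intro pair_measureI) auto
  ultimately show ?thesis by (simp only: cell_def prod.case)
qed

lemma coordinate_measurable[measurable (raw)]:
  assumes "a \<in> slots (n :: 'd::finite \<Rightarrow> nat)"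
  shows "(\<lambda>z. z a) \<in> borel_measurable (points_measure n)"
proof -
  have "(\<lambda>z. z a) \<in> measurable (points_measure n) square_measure"
    unfolding points_measure_def using assms by (rule measurable_component_singleton)
  then have "(\<lambda>z. z a) \<in> measurable (points_measure n) lborel"
    by (rule measurable_restrict_space2_iff[THEN iffD1, THEN conjunct1])
  then show ?thesis by simp
qed

definition elementary_kernel :: "('d::finite \<Rightarrow> nat) \<Rightarrow> nat \<Rightarrow> (nat \<Rightarrow> complex) \<Rightarrow>
    (nat \<Rightarrow> 'd \<times> nat \<Rightarrow> (real \<times> real) \<times> (real \<times> real)) \<Rightarrow> 'd points \<Rightarrow> complex" where
  "elementary_kernel n N c R z = (\<Sum>q<N. c q * (\<Prod>a\<in>slots n. indicator (cell (R q a)) (z a)))"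

definition elementary_integral :: "('d::finite \<Rightarrow> real \<times> real \<Rightarrow> 'w \<Rightarrow> real) \<Rightarrow> ('d \<Rightarrow> nat) \<Rightarrow> nat \<Rightarrow>
    (nat \<Rightarrow> complex) \<Rightarrow> (nat \<Rightarrow> 'd \<times> nat \<Rightarrow> (real \<times> real) \<times> (real \<times> real)) \<Rightarrow> 'w \<Rightarrow> complex" where
  "elementary_integral W n N c R \<omega> =
     (\<Sum>q<N. c q * (\<Prod>(k, l)\<in>slots n. of_real (cell_increment (W k) (R q (k, l)) \<omega>)))"

lemma elementary_kernel_measurable[measurable]:
  "elementary_kernel n N c R \<in> borel_measurable (points_measure n)"
  unfolding elementary_kernel_def[abs_def]
  by (intro borel_measurable_sum borel_measurable_times borel_measurable_const borel_measurable_prod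
      borel_measurable_indicator' coordinate_measurable measurable_compose[OF coordinate_measurable borel_measurable_indicator]) auto

definition cell_on_grid :: "real set \<Rightarrow> (real \<times> real) \<times> (real \<times> real) \<Rightarrow> bool" where
  "cell_on_grid D = (\<lambda>((s, t), (s', t')). s \<in> D \<and> t \<in> D \<and> s' \<in> D \<and> t' \<in> D \<and> s \<le> s' \<and> t \<le> t')"

lemma cell_on_grid_mem_iff:
  assumes D: "is_grid D" and g: "g \<in> grid_corners D" and R: "cell_on_grid D R"
    and z: "z \<in> cell (grid_cell D g)"
  shows "z \<in> cell R \<longleftrightarrow> g \<in> cell R"
proof -
  obtain a b s t s' t' u v where eq: "g = (a, b)" "R = ((s, t), (s', t'))" "z = (u, v)"
    by (metis surj_pair)
  have ab: "a \<in> D - {0}" "b \<in> D - {0}" using g by (auto simp: eq grid_corners_def)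
  have uv: "grid_pred D a < u" "u \<le> a" "grid_pred D b < v" "v \<le> b"
    using z by (auto simp: eq cell_def grid_cell_def)
  have iff: "(x < w \<longleftrightarrow> x < c) \<and> (w \<le> x \<longleftrightarrow> c \<le> x)" if "x \<in> D" "c \<in> D - {0}" "grid_pred D c < w" "w \<le> c" for x w c
    using grid_pred(3)[OF D that(2), of x] that by force
  show ?thesis
    using R iff[OF _ ab(1) uv(1,2)] iff[OF _ ab(2) uv(3,4)]
    by (auto simp: eq cell_on_grid_def cell_def)
qed

lemma grid_cells_disjoint:
  assumes D: "is_grid D" and g: "g \<in> grid_corners D" "h \<in> grid_corners D"
    and z: "z \<in> cell (grid_cell D g)" "z \<in> cell (grid_cell D h)"
  shows "g = h"
proof -
  have uniq: "a = b" if "a \<in> D - {0}" "b \<in> D - {0}" "grid_pred D a < u" "u \<le> a" "grid_pred D b < u" "u \<le> b" for a b u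
    using grid_pred(3)[OF D that(1), of b] grid_pred(3)[OF D that(2), of a] that by force
  show ?thesis
    using g z uniq by (cases g; cases h; cases z) (auto simp: grid_corners_def grid_cell_def cell_def)
qed

lemma grid_area_nonneg:
  assumes D: "is_grid D" and g: "g \<in> grid_corners D"
  shows "grid_area D g \<ge> 0"
  using grid_pred(2)[OF D] g by (cases g) (auto simp: grid_area_def grid_corners_def intro!: mult_nonneg_nonneg less_imp_le)

lemma grid_cell_subset:
  assumes D: "is_grid D" and g: "g \<in> grid_corners D"
  shows "cell (grid_cell D g) \<subseteq> unit_square"
proof -
  obtain a b where ab: "g = (a, b)" by (cases g)
  then have m: "a \<in> D - {0}" "b \<in> D - {0}" using g by (auto simp: grid_corners_def)
  have p: "0 \<le> grid_pred D a" "a \<le> 1" "0 \<le> grid_pred D b" "b \<le> 1"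
    using grid_pred(1)[OF D m(1)] grid_pred(1)[OF D m(2)] D m by (auto simp: is_grid_def)
  then show ?thesis by (auto simp: ab cell_def grid_cell_def unit_square_def)
qed

lemma emeasure_grid_cell:
  assumes D: "is_grid D" and g: "g \<in> grid_corners D"
  shows "emeasure square_measure (cell (grid_cell D g)) = ennreal (grid_area D g)"
proof -
  obtain a b where ab: "g = (a, b)" by (cases g)
  then have m: "a \<in> D - {0}" "b \<in> D - {0}" using g by (auto simp: grid_corners_def)
  have p: "0 \<le> grid_pred D a" "grid_pred D a < a" "a \<le> 1" "0 \<le> grid_pred D b" "grid_pred D b < b" "b \<le> 1"
    using grid_pred(1,2)[OF D m(1)] grid_pred(1,2)[OF D m(2)] D m by (auto simp: is_grid_def)
  have "emeasure square_measure (cell (grid_cell D g)) = emeasure lborel (cell (grid_cell D g))"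
    using grid_cell_subset[OF D g] by (subst emeasure_restrict_space) auto
  also have "\<dots> = emeasure (lborel \<Otimes>\<^sub>M lborel) ({grid_pred D a<..a} \<times> {grid_pred D b<..b})"
    by (simp add: lborel_prod cell_def grid_cell_def ab)
  also have "\<dots> = ennreal (a - grid_pred D a) * ennreal (b - grid_pred D b)"
    using p by (subst lborel.emeasure_pair_measure_Times) auto
  also have "\<dots> = ennreal (grid_area D g)"
    using p by (simp add: grid_area_def ab ennreal_mult)
  finally show ?thesis .
qed

text \<open>Slots of different components may use the same cell. Tagging the cells with the component turns the
  requirement that slots of one component use different cells into injectivity.\<close>

definition tag :: "('d \<times> nat \<Rightarrow> 'b) \<Rightarrow> 'd \<times> nat \<Rightarrow> 'd \<times> 'b" where
  "tag \<gamma> a = (fst a, \<gamma> a)"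

text \<open>Elementary kernels vanish at all other assignments of grid corners to the slots.\<close>

definition placements :: "real set \<Rightarrow> ('d::finite \<Rightarrow> nat) \<Rightarrow> ('d \<times> nat \<Rightarrow> real \<times> real) set" where
  "placements D n = {\<gamma> \<in> PiE (slots n) (\<lambda>_. grid_corners D). inj_on (tag \<gamma>) (slots n)}"

lemma finite_grid_corners: "is_grid D \<Longrightarrow> finite (grid_corners D)"
  by (auto simp: is_grid_def grid_corners_def)

lemma finite_placements: "is_grid D \<Longrightarrow> finite (placements D n)"
  unfolding placements_def by (rule finite_subset[OF _ finite_PiE[OF finite_slots finite_grid_corners]]) auto

text \<open>The cells of an elementary kernel that belong to one component are disjoint, so a corner cannot lie in
  two of them.\<close>

lemma elementary_kernel_zero:
  assumes el: "\<forall>q<N. elementary_cells n (R q)" and ninj: "\<not> inj_on (tag \<gamma>) (slots n)"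
  shows "elementary_kernel n N c R \<gamma> = 0"
proof -
  obtain k l l' where l: "(k, l) \<in> slots n" "(k, l') \<in> slots n" "\<gamma> (k, l) = \<gamma> (k, l')" "l \<noteq> l'"
  proof -
    obtain a b where ab: "a \<in> slots n" "b \<in> slots n" "tag \<gamma> a = tag \<gamma> b" "a \<noteq> b"
      using ninj by (auto simp: inj_on_def)
    then have "fst a = fst b" "\<gamma> a = \<gamma> b" by (simp_all add: tag_def)
    with ab show thesis using that[of "fst a" "snd a" "snd b"] by (metis prod.collapse)
  qed
  show ?thesis
    unfolding elementary_kernel_def
  proof (rule sum.neutral, rule ballI)
    fix q assume "q \<in> {..<N}"
    then have "cell (R q (k, l)) \<inter> cell (R q (k, l')) = {}"
      using el l by (auto simp: elementary_cells_def disjoint_family_on_def slots_def)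
    then have "indicator (cell (R q (k, l))) (\<gamma> (k, l)) = (0 :: complex) \<or> indicator (cell (R q (k, l'))) (\<gamma> (k, l')) = (0 :: complex)"
      using l(3) by (auto simp: indicator_def)
    then obtain a where "a \<in> slots n" "indicator (cell (R q a)) (\<gamma> a) = (0 :: complex)"
      using l(1,2) by blast
    then have "(\<Prod>a\<in>slots n. indicator (cell (R q a)) (\<gamma> a)) = (0 :: complex)"
      by (intro prod_zero bexI[of _ a]) auto
    then show "c q * (\<Prod>a\<in>slots n. indicator (cell (R q a)) (\<gamma> a)) = 0" by simp
  qed
qed

text \<open>On a product of grid cells an elementary kernel is constant, with its value at the corners, and the
  products that belong to different placements are disjoint.\<close>

lemma elementary_kernel_norm_ge:
  assumes D: "is_grid D" and R: "\<forall>q<N. \<forall>a\<in>slots n. cell_on_grid D (R q a)"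
  shows "(\<Sum>\<gamma>\<in>placements D n. ennreal ((norm (elementary_kernel n N c R \<gamma>))\<^sup>2 * (\<Prod>a\<in>slots n. grid_area D (\<gamma> a))))
    \<le> L2_sq (points_measure n) (elementary_kernel n N c R)"
proof -
  let ?f = "elementary_kernel n N c R"
  let ?I = "\<lambda>\<gamma> z. (\<Prod>a\<in>slots n. indicator (cell (grid_cell D (\<gamma> a))) (z a)) :: ennreal"
  have pl: "\<gamma> a \<in> grid_corners D" if "\<gamma> \<in> placements D n" "a \<in> slots n" for \<gamma> a
    using that by (auto simp: placements_def)
  have I_meas[measurable]: "?I \<gamma> \<in> borel_measurable (points_measure n)" for \<gamma>
    by (intro borel_measurable_prod_ennreal measurable_compose[OF coordinate_measurable borel_measurable_indicator]) auto
  have "(\<Sum>\<gamma>\<in>placements D n. ennreal ((norm (?f \<gamma>))\<^sup>2 * (\<Prod>a\<in>slots n. grid_area D (\<gamma> a))))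
      = (\<Sum>\<gamma>\<in>placements D n. \<integral>\<^sup>+ z. ennreal ((norm (?f \<gamma>))\<^sup>2) * ?I \<gamma> z \<partial>points_measure n)"
  proof (rule sum.cong[OF refl])
    fix \<gamma> assume \<gamma>: "\<gamma> \<in> placements D n"
    have "(\<integral>\<^sup>+ z. ?I \<gamma> z \<partial>points_measure n) = (\<Prod>a\<in>slots n. \<integral>\<^sup>+ p. indicator (cell (grid_cell D (\<gamma> a))) p \<partial>square_measure)"
      unfolding points_measure_def
      by (rule points.product_nn_integral_prod) (auto intro!: measurable_restrict_space1)
    also have "\<dots> = (\<Prod>a\<in>slots n. ennreal (grid_area D (\<gamma> a)))"
    proof (rule prod.cong[OF refl])
      fix a assume a: "a \<in> slots n"
      have "cell (grid_cell D (\<gamma> a)) \<in> sets square_measure"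
        using grid_cell_subset[OF D pl[OF \<gamma> a]] by (simp add: sets_restrict_space_iff)
      then show "(\<integral>\<^sup>+ p. indicator (cell (grid_cell D (\<gamma> a))) p \<partial>square_measure) = ennreal (grid_area D (\<gamma> a))"
        by (simp only: nn_integral_indicator emeasure_grid_cell[OF D pl[OF \<gamma> a]])
    qed
    also have "\<dots> = ennreal (\<Prod>a\<in>slots n. grid_area D (\<gamma> a))"
      using grid_area_nonneg[OF D] pl[OF \<gamma>] by (intro prod_ennreal) auto
    finally show "ennreal ((norm (?f \<gamma>))\<^sup>2 * (\<Prod>a\<in>slots n. grid_area D (\<gamma> a)))
        = (\<integral>\<^sup>+ z. ennreal ((norm (?f \<gamma>))\<^sup>2) * ?I \<gamma> z \<partial>points_measure n)"
      using grid_area_nonneg[OF D] pl[OF \<gamma>]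
      by (simp add: nn_integral_cmult ennreal_mult prod_nonneg)
  qed
  also have "\<dots> = (\<integral>\<^sup>+ z. (\<Sum>\<gamma>\<in>placements D n. ennreal ((norm (?f \<gamma>))\<^sup>2) * ?I \<gamma> z) \<partial>points_measure n)"
    by (rule nn_integral_sum[symmetric]) measurable
  also have "\<dots> \<le> L2_sq (points_measure n) ?f"
    unfolding L2_sq_def
  proof (intro nn_integral_mono)
    fix z
    show "(\<Sum>\<gamma>\<in>placements D n. ennreal ((norm (?f \<gamma>))\<^sup>2) * ?I \<gamma> z) \<le> ennreal ((norm (?f z))\<^sup>2)"
    proof (cases "\<exists>\<gamma>\<in>placements D n. \<forall>a\<in>slots n. z a \<in> cell (grid_cell D (\<gamma> a))")
      case True
      then obtain \<gamma> where \<gamma>: "\<gamma> \<in> placements D n" and z: "\<And>a. a \<in> slots n \<Longrightarrow> z a \<in> cell (grid_cell D (\<gamma> a))" by blast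
      have I0: "?I \<gamma>' z = 0" if "\<gamma>' \<in> placements D n - {\<gamma>}" for \<gamma>'
      proof -
        have "\<gamma>' \<noteq> \<gamma>" "\<gamma>' \<in> PiE (slots n) (\<lambda>_. grid_corners D)" "\<gamma> \<in> PiE (slots n) (\<lambda>_. grid_corners D)"
          using that \<gamma> by (auto simp: placements_def)
        then obtain a where a: "a \<in> slots n" "\<gamma>' a \<noteq> \<gamma> a" by (meson PiE_ext)
        have "z a \<notin> cell (grid_cell D (\<gamma>' a))"
          using grid_cells_disjoint[OF D, of "\<gamma>' a" "\<gamma> a" "z a"] a z[OF a(1)] pl[OF \<gamma> a(1)] pl[of \<gamma>' a] that by auto
        with a show ?thesis by (intro prod_zero bexI[of _ a]) auto
      qed
      have "?f z = ?f \<gamma>"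
        unfolding elementary_kernel_def
      proof (intro sum.cong refl arg_cong2[where f = "(*)"] prod.cong)
        fix q a assume "q \<in> {..<N}" "a \<in> slots n"
        then show "indicator (cell (R q a)) (z a) = (indicator (cell (R q a)) (\<gamma> a) :: complex)"
          using cell_on_grid_mem_iff[OF D pl[OF \<gamma>] _ z] R by (auto simp: indicator_def)
      qed
      moreover have "(\<Sum>\<gamma>\<in>placements D n. ennreal ((norm (?f \<gamma>))\<^sup>2) * ?I \<gamma> z) = ennreal ((norm (?f \<gamma>))\<^sup>2) * ?I \<gamma> z"
      proof -
        have "(\<Sum>\<gamma>\<in>placements D n - {\<gamma>}. ennreal ((norm (?f \<gamma>))\<^sup>2) * ?I \<gamma> z) = 0"
          by (intro sum.neutral ballI) (simp only: I0 mult_zero_right)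
        then show ?thesis by (simp only: sum.remove[OF finite_placements[OF D] \<gamma>] add_0_right)
      qed
      moreover have "?I \<gamma> z = 1" using z by (intro prod.neutral) auto
      ultimately show ?thesis by simp
    next
      case False
      have "?I \<gamma> z = 0" if "\<gamma> \<in> placements D n" for \<gamma>
      proof -
        have "\<forall>\<gamma>\<in>placements D n. \<exists>a\<in>slots n. z a \<notin> cell (grid_cell D (\<gamma> a))"
          using False by simp
        from bspec[OF this that] obtain a where a: "a \<in> slots n" "z a \<notin> cell (grid_cell D (\<gamma> a))" ..
        show ?thesis
        proof (rule prod_zero)
          show "\<exists>a\<in>slots n. indicator (cell (grid_cell D (\<gamma> a))) (z a) = (0 :: ennreal)"
            using indicator_simps(2)[OF a(2)] a(1) by (rule bexI)
        qed simp
      qed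
      then have "(\<Sum>\<gamma>\<in>placements D n. ennreal ((norm (?f \<gamma>))\<^sup>2) * ?I \<gamma> z) = 0"
        by (intro sum.neutral ballI) (simp only: mult_zero_right)
      then show ?thesis by (simp only: zero_le)
    qed
  qed
  finally show ?thesis .
qed

lemma norm_sum_sq_le_card:
  fixes f :: "'b \<Rightarrow> complex"
  shows "(norm (\<Sum>x\<in>F. f x))\<^sup>2 \<le> real (card F) * (\<Sum>x\<in>F. (norm (f x))\<^sup>2)"
proof -
  have "(norm (\<Sum>x\<in>F. f x))\<^sup>2 \<le> (\<Sum>x\<in>F. norm (f x))\<^sup>2"
    by (intro power_mono norm_sum) auto
  also have "\<dots> \<le> (\<Sum>x\<in>F. (norm (f x))\<^sup>2) * real (card F)"
    by (rule sum_squared_le_sum_of_squares)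
  finally show ?thesis by (simp add: mult.commute)
qed

text \<open>Two placements that occupy the same tagged cells differ by a permutation of the slots of each component.\<close>

lemma placements_fibre_card:
  fixes n :: "'d::finite \<Rightarrow> nat"
  assumes D: "is_grid D" and \<gamma>0: "\<gamma>0 \<in> placements D n"
  shows "card {\<gamma> \<in> placements D n. tag \<gamma> ` slots n = tag \<gamma>0 ` slots n} \<le> (\<Prod>k\<in>UNIV. fact (n k))"
proof -
  let ?F = "{\<gamma> \<in> placements D n. tag \<gamma> ` slots n = tag \<gamma>0 ` slots n}"
  let ?P = "PiE UNIV (\<lambda>k. {\<sigma>. \<sigma> permutes {..<n k}})"
  \<comment> \<open>rearranging \<open>\<gamma>0\<close> by a family of permutations reaches every placement with the same image\<close>
  define \<Phi> where "\<Phi> s = restrict (\<lambda>(k, l). \<gamma>0 (k, s k l)) (slots n)" for s :: "'d \<Rightarrow> nat \<Rightarrow> nat"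
  have "?F \<subseteq> \<Phi> ` ?P"
  proof
    fix \<gamma> assume "\<gamma> \<in> ?F"
    then have \<gamma>: "\<gamma> \<in> PiE (slots n) (\<lambda>_. grid_corners D)" "inj_on (tag \<gamma>) (slots n)" "tag \<gamma> ` slots n = tag \<gamma>0 ` slots n"
      by (auto simp: placements_def)
    have ex: "\<exists>l'<n k. \<gamma>0 (k, l') = \<gamma> (k, l)" if "l < n k" for k l
    proof -
      have "tag \<gamma> (k, l) \<in> tag \<gamma>0 ` slots n" unfolding \<gamma>(3)[symmetric] using that by (simp add: slots_def)
      then show ?thesis by (auto simp: tag_def slots_def)
    qed
    define s where "s k l = (if l < n k then SOME l'. l' < n k \<and> \<gamma>0 (k, l') = \<gamma> (k, l) else l)" for k l
    have s: "s k l < n k" "\<gamma>0 (k, s k l) = \<gamma> (k, l)" if "l < n k" for k l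
      using someI_ex[OF ex[OF that, unfolded]] that by (auto simp: s_def)
    have perm: "s k permutes {..<n k}" for k
    proof (rule bij_imp_permutes)
      have "inj_on (s k) {..<n k}"
      proof (rule inj_onI)
        fix l l' assume l: "l \<in> {..<n k}" "l' \<in> {..<n k}" "s k l = s k l'"
        then have "tag \<gamma> (k, l) = tag \<gamma> (k, l')" using s[of l k] s[of l' k] by (simp add: tag_def)
        then show "l = l'" using inj_onD[OF \<gamma>(2)] l by (fastforce simp: slots_def)
      qed
      moreover have "s k ` {..<n k} \<subseteq> {..<n k}" using s(1) by auto
      ultimately show "bij_betw (s k) {..<n k} {..<n k}"
        by (simp add: bij_betw_def endo_inj_surj)
    qed (simp add: s_def)
    have "\<gamma> = \<Phi> s"
    proof
      fix a show "\<gamma> a = \<Phi> s a"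
        using s(2) \<gamma>(1) by (cases a) (auto simp: \<Phi>_def slots_def PiE_def extensional_def restrict_def)
    qed
    with perm show "\<gamma> \<in> \<Phi> ` ?P" by auto
  qed
  moreover have finP: "finite ?P" by (intro finite_PiE) (auto intro: finite_permutations)
  ultimately have "card ?F \<le> card (\<Phi> ` ?P)" by (intro card_mono finite_imageI)
  also have "\<dots> \<le> card ?P" using finP by (rule card_image_le)
  also have "\<dots> = (\<Prod>k\<in>UNIV. fact (n k))"
    by (simp add: card_PiE card_permutations)
  finally show ?thesis .
qed

text \<open>This keeps multiple integrals of different orders orthogonal.\<close>

lemma tag_image_determines_order:
  fixes n m :: "'d::finite \<Rightarrow> nat"
  assumes "inj_on (tag \<gamma>) (slots n)" "inj_on (tag \<delta>) (slots m)" "tag \<gamma> ` slots n = tag \<delta> ` slots m"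
  shows "n = m"
proof
  fix k
  have count: "card {t \<in> tag \<gamma> ` slots n. fst t = k} = n k" if "inj_on (tag \<gamma>) (slots n)"
    for n :: "'d \<Rightarrow> nat" and \<gamma> :: "'d \<times> nat \<Rightarrow> 'b"
  proof -
    have "{t \<in> tag \<gamma> ` slots n. fst t = k} = tag \<gamma> ` ({k} \<times> {..<n k})"
      by (auto simp: tag_def slots_def)
    moreover have "inj_on (tag \<gamma>) ({k} \<times> {..<n k})"
      using that by (rule inj_on_subset) (auto simp: slots_def)
    ultimately show ?thesis by (simp add: card_image card_cartesian_product)
  qed
  show "n k = m k" using count[OF assms(1)] count[OF assms(2)] assms(3) by simp
qed

section \<open>Bessel's inequality for multiple integrals\<close>

lemma elementary_cells_grid:
  fixes S :: "('d::finite \<Rightarrow> nat) set" and N :: "('d \<Rightarrow> nat) \<Rightarrow> nat"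
  assumes fin: "finite S" and el: "\<And>n q. n \<in> S \<Longrightarrow> q < N n \<Longrightarrow> elementary_cells n (R n q)"
  obtains D where "is_grid D" "\<And>n q a. n \<in> S \<Longrightarrow> q < N n \<Longrightarrow> a \<in> slots n \<Longrightarrow> cell_on_grid D (R n q a)"
proof -
  define C where "C = (\<lambda>((s, t), (s', t')). {s, t, s', t' :: real})"
  define D where "D = {0, 1} \<union> (\<Union>n\<in>S. \<Union>q\<in>{..<N n}. \<Union>a\<in>slots n. C (R n q a))"
  have 1: "0 \<le> s \<and> s \<le> s' \<and> s' \<le> 1 \<and> 0 \<le> t \<and> t \<le> t' \<and> t' \<le> 1"
    if "n \<in> S" "q < N n" "a \<in> slots n" "R n q a = ((s, t), (s', t'))" for n q a s t s' t'
    using el[OF that(1,2)] that(3,4) by (fastforce simp: elementary_cells_def)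
  have finC: "finite (C r)" for r by (cases r) (auto simp: C_def split: prod.splits)
  have sub: "C (R n q a) \<subseteq> {0..1}" if "n \<in> S" "q < N n" "a \<in> slots n" for n q a
  proof -
    obtain s t s' t' where "R n q a = ((s, t), (s', t'))" by (metis surj_pair)
    with 1[OF that this] show ?thesis by (auto simp: C_def)
  qed
  have "finite D" unfolding D_def by (intro finite_UnI finite_UN_I fin finite_slots finite_lessThan finC) auto
  moreover have "D \<subseteq> {0..1}" unfolding D_def by (intro Un_least UN_least sub) auto
  ultimately have "is_grid D" by (auto simp: is_grid_def D_def)
  moreover have "cell_on_grid D (R n q a)" if "n \<in> S" "q < N n" "a \<in> slots n" for n q a
  proof -
    obtain s t s' t' where r: "R n q a = ((s, t), (s', t'))" by (metis surj_pair)
    have "C (R n q a) \<subseteq> D" unfolding D_def using that by blast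
    with 1[OF that r] show ?thesis by (auto simp: r C_def cell_on_grid_def)
  qed
  ultimately show thesis by (rule that)
qed

context brownian_sheet_space
begin

definition grid_product :: "real set \<Rightarrow> ('d \<times> (real \<times> real)) set \<Rightarrow> 'w \<Rightarrow> real" where
  "grid_product D T \<omega> = (\<Prod>t\<in>T. grid_increment D t \<omega>)"

lemma elementary_integral_measurable:
  assumes "\<forall>q<N. elementary_cells n (R q)"
  shows "elementary_integral W n N c R \<in> borel_measurable M"
proof -
  have "cell_increment (W k) (R q (k, l)) \<in> borel_measurable M" if "q < N" "(k, l) \<in> slots n" for q k l
  proof -
    obtain s t s' t' where r: "R q (k, l) = ((s, t), (s', t'))" by (metis surj_pair)
    then have "0 \<le> s \<and> s \<le> s' \<and> s' \<le> 1 \<and> 0 \<le> t \<and> t \<le> t' \<and> t' \<le> 1"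
      using assms that by (fastforce simp: elementary_cells_def)
    then show ?thesis unfolding r
      by (intro first_chaos_measurable[of _ k] first_chaos_increment) (auto simp: unit_square_def)
  qed
  then show ?thesis unfolding elementary_integral_def[abs_def]
    by (intro borel_measurable_sum borel_measurable_times borel_measurable_const borel_measurable_prod)
       (auto intro!: borel_measurable_of_real)
qed

text \<open>Multiplying out the sums over the grid cells that make up each cell of the kernel.\<close>

lemma elementary_integral_on_grid:
  assumes D: "is_grid D" and R: "\<forall>q<N. \<forall>a\<in>slots n. cell_on_grid D (R q a)"
    and el: "\<forall>q<N. elementary_cells n (R q)"
  shows "elementary_integral W n N c R \<omega>
    = (\<Sum>\<gamma>\<in>placements D n. elementary_kernel n N c R \<gamma> * of_real (grid_product D (tag \<gamma> ` slots n) \<omega>))"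
proof -
  let ?G = "grid_corners D" and ?P = "PiE (slots n) (\<lambda>_. grid_corners D)"
  let ?x = "\<lambda>a g. of_real (grid_increment D (fst a, g) \<omega>) :: complex"
  have incr: "complex_of_real (cell_increment (W (fst a)) (R q a) \<omega>) = (\<Sum>g\<in>?G. indicator (cell (R q a)) g * ?x a g)"
    if "q < N" "a \<in> slots n" for q a
  proof -
    obtain s t s' t' where r: "R q a = ((s, t), (s', t'))" by (metis surj_pair)
    have "cell_on_grid D (R q a)" using R that by blast
    then have "cell_increment (W (fst a)) (R q a) \<omega> = (\<Sum>g\<in>?G. indicator (cell (R q a)) g * grid_increment D (fst a, g) \<omega>)"
      unfolding r using cell_increment_grid[OF D, of s s' t t' "W (fst a)" \<omega>]
      by (simp add: cell_on_grid_def grid_increment_def)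
    moreover have "complex_of_real (indicator A x) = indicator A x" for A and x :: "real \<times> real"
      by (simp add: indicator_def)
    ultimately show ?thesis by simp
  qed
  have "elementary_integral W n N c R \<omega> = (\<Sum>q<N. c q * (\<Prod>a\<in>slots n. \<Sum>g\<in>?G. indicator (cell (R q a)) g * ?x a g))"
    unfolding elementary_integral_def using incr by (intro sum.cong refl) (auto simp: case_prod_beta intro!: prod.cong)
  also have "\<dots> = (\<Sum>q<N. c q * (\<Sum>\<gamma>\<in>?P. (\<Prod>a\<in>slots n. indicator (cell (R q a)) (\<gamma> a)) * (\<Prod>a\<in>slots n. ?x a (\<gamma> a))))"
  proof (intro sum.cong refl arg_cong2[where f = "(*)"])
    fix q
    show "(\<Prod>a\<in>slots n. \<Sum>g\<in>?G. indicator (cell (R q a)) g * ?x a g)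
        = (\<Sum>\<gamma>\<in>?P. (\<Prod>a\<in>slots n. indicator (cell (R q a)) (\<gamma> a)) * (\<Prod>a\<in>slots n. ?x a (\<gamma> a)))"
      by (subst prod_sum_PiE) (auto simp: finite_grid_corners[OF D] prod.distrib)
  qed
  also have "\<dots> = (\<Sum>\<gamma>\<in>?P. elementary_kernel n N c R \<gamma> * (\<Prod>a\<in>slots n. ?x a (\<gamma> a)))"
    unfolding elementary_kernel_def sum_distrib_left sum_distrib_right
    by (subst sum.swap) (simp add: mult.assoc)
  also have "\<dots> = (\<Sum>\<gamma>\<in>placements D n. elementary_kernel n N c R \<gamma> * (\<Prod>a\<in>slots n. ?x a (\<gamma> a)))"
  proof (rule sum.mono_neutral_right)
    show "finite ?P" by (intro finite_PiE finite_grid_corners D) auto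
    show "placements D n \<subseteq> ?P" by (auto simp: placements_def)
    show "\<forall>\<gamma>\<in>?P - placements D n. elementary_kernel n N c R \<gamma> * (\<Prod>a\<in>slots n. ?x a (\<gamma> a)) = 0"
      using elementary_kernel_zero[OF el] by (auto simp: placements_def)
  qed
  also have "\<dots> = (\<Sum>\<gamma>\<in>placements D n. elementary_kernel n N c R \<gamma> * of_real (grid_product D (tag \<gamma> ` slots n) \<omega>))"
  proof (rule sum.cong[OF refl])
    fix \<gamma> assume "\<gamma> \<in> placements D n"
    then have "inj_on (tag \<gamma>) (slots n)" by (simp add: placements_def)
    then have "grid_product D (tag \<gamma> ` slots n) \<omega> = (\<Prod>a\<in>slots n. grid_increment D (fst a, \<gamma> a) \<omega>)"
      unfolding grid_product_def by (subst prod.reindex) (auto simp: tag_def)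
    then show "elementary_kernel n N c R \<gamma> * (\<Prod>a\<in>slots n. ?x a (\<gamma> a))
        = elementary_kernel n N c R \<gamma> * of_real (grid_product D (tag \<gamma> ` slots n) \<omega>)" by simp
  qed
  finally show ?thesis .
qed

text \<open>If a cell belongs to only one of the two sets, its increment occurs to the first power and contributes
  the factor zero.\<close>

lemma grid_product_orthogonal:
  assumes D: "is_grid D" and T: "T \<subseteq> UNIV \<times> grid_corners D" "T' \<subseteq> UNIV \<times> grid_corners D"
  shows "integrable M (\<lambda>\<omega>. grid_product D T \<omega> * grid_product D T' \<omega>)"
    and "(LINT \<omega>|M. grid_product D T \<omega> * grid_product D T' \<omega>)
      = (if T = T' then (\<Prod>t\<in>T. grid_area D (snd t)) else 0)"
proof -
  let ?x = "grid_increment D"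
  \<comment> \<open>the product over both sets, written as one product of functions of independent increments\<close>
  define h where "h t x = (if t \<in> T then x else 1) * (if t \<in> T' then x else 1 :: real)" for t x
  have fin: "finite (T \<union> T')"
    by (rule finite_subset[of _ "UNIV \<times> grid_corners D"]) (use T finite_grid_corners[OF D] in auto)
  then have finT: "finite T" "finite T'" by auto
  have eq: "grid_product D T \<omega> * grid_product D T' \<omega> = (\<Prod>t\<in>T \<union> T'. h t (?x t \<omega>))" for \<omega>
  proof -
    have "grid_product D T \<omega> = (\<Prod>t\<in>T \<union> T'. if t \<in> T then ?x t \<omega> else 1)"
      unfolding grid_product_def using fin by (intro prod.mono_neutral_cong_left) auto
    moreover have "grid_product D T' \<omega> = (\<Prod>t\<in>T \<union> T'. if t \<in> T' then ?x t \<omega> else 1)"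
      unfolding grid_product_def using fin by (intro prod.mono_neutral_cong_left) auto
    ultimately show ?thesis by (simp add: h_def prod.distrib)
  qed
  have h_meas: "h t \<in> borel_measurable borel" for t
    unfolding h_def[abs_def] by (cases "t \<in> T"; cases "t \<in> T'") simp_all
  have indep: "indep_vars (\<lambda>_. borel) (\<lambda>t \<omega>. h t (?x t \<omega>)) (T \<union> T')"
    by (rule indep_vars_compose2[where X = "?x" and Y = h and M' = "\<lambda>_. borel"])
       (use indep_vars_subset[OF grid_increment_indep[OF D], of "T \<union> T'"] T h_meas in auto)
  have chaos: "?x t \<in> first_chaos (fst t)" if "t \<in> T \<union> T'" for t
    using grid_increment_first_chaos[OF D, of "snd t" "fst t"] that T by auto
  have sq: "integrable M (\<lambda>\<omega>. ?x t \<omega> * ?x t \<omega>)" "(LINT \<omega>|M. ?x t \<omega> * ?x t \<omega>) = grid_area D (snd t)"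
    "(LINT \<omega>|M. ?x t \<omega>) = 0" "integrable M (?x t)" if t: "t \<in> T \<union> T'" for t
  proof -
    show i: "integrable M (\<lambda>\<omega>. ?x t \<omega> * ?x t \<omega>)"
      using first_chaos_mult_integrable[OF chaos[OF t] chaos[OF t]] .
    show "(LINT \<omega>|M. ?x t \<omega> * ?x t \<omega>) = grid_area D (snd t)"
      using grid_increment_covariance[OF D, of "snd t" "snd t" "fst t"] t T by auto
    show "(LINT \<omega>|M. ?x t \<omega>) = 0"
      using centered_gaussian_mean[OF first_chaos_gaussian[OF chaos[OF t]]] .
    show "integrable M (?x t)"
      using integrable_mult_L2[OF first_chaos_measurable[OF chaos[OF t]] borel_measurable_const[of 1]
        first_chaos_square_integrable[OF chaos[OF t]]] by simp
  qed
  have int: "integrable M (\<lambda>\<omega>. h t (?x t \<omega>))" if "t \<in> T \<union> T'" for t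
    using sq[OF that] by (cases "t \<in> T"; cases "t \<in> T'") (simp_all add: h_def)
  show "integrable M (\<lambda>\<omega>. grid_product D T \<omega> * grid_product D T' \<omega>)"
    unfolding eq using fin indep int by (rule indep_vars_integrable)
  have "(LINT \<omega>|M. grid_product D T \<omega> * grid_product D T' \<omega>) = (\<Prod>t\<in>T \<union> T'. LINT \<omega>|M. h t (?x t \<omega>))"
    unfolding eq using fin indep int by (rule indep_vars_lebesgue_integral)
  also have "\<dots> = (\<Prod>t\<in>T \<union> T'. if t \<in> T \<inter> T' then grid_area D (snd t) else 0)"
    using sq by (intro prod.cong refl) (auto simp: h_def)
  also have "\<dots> = (if T = T' then (\<Prod>t\<in>T. grid_area D (snd t)) else 0)"
  proof (cases "T = T'")
    case False
    then obtain t where "t \<in> T \<union> T'" "t \<notin> T \<inter> T'" by auto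
    then show ?thesis using False fin by (auto intro!: prod_zero)
  qed simp
  finally show "(LINT \<omega>|M. grid_product D T \<omega> * grid_product D T' \<omega>)
      = (if T = T' then (\<Prod>t\<in>T. grid_area D (snd t)) else 0)" .
qed

lemma grid_product_measurable:
  assumes D: "is_grid D" and T: "T \<subseteq> UNIV \<times> grid_corners D"
  shows "grid_product D T \<in> borel_measurable M"
  unfolding grid_product_def[abs_def] using T
  by (intro borel_measurable_prod grid_increment_measurable D) auto

lemma grid_product_parseval:
  assumes D: "is_grid D" and \<T>: "finite \<T>" "\<And>T. T \<in> \<T> \<Longrightarrow> T \<subseteq> UNIV \<times> grid_corners D"
  shows "L2_sq M (\<lambda>\<omega>. \<Sum>T\<in>\<T>. b T * of_real (grid_product D T \<omega>))
    = ennreal (\<Sum>T\<in>\<T>. (norm (b T))\<^sup>2 * (\<Prod>t\<in>T. grid_area D (snd t)))"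
proof -
  let ?F = "\<lambda>\<omega>. \<Sum>T\<in>\<T>. b T * of_real (grid_product D T \<omega>)"
  let ?A = "\<lambda>T. \<Prod>t\<in>T. grid_area D (snd t)"
  note [measurable] = grid_product_measurable[OF D \<T>(2)]
  have sq: "complex_of_real ((norm (?F \<omega>))\<^sup>2) = (\<Sum>T\<in>\<T>. \<Sum>T'\<in>\<T>. (b T * cnj (b T')) * of_real (grid_product D T \<omega> * grid_product D T' \<omega>))" for \<omega>
    unfolding complex_norm_square by (simp add: sum_product mult_ac)
  have int: "integrable M (\<lambda>\<omega>. complex_of_real ((norm (?F \<omega>))\<^sup>2))"
    unfolding sq using grid_product_orthogonal(1)[OF D \<T>(2) \<T>(2)]
    by (intro Bochner_Integration.integrable_sum integrable_mult_right integrable_of_real) auto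
  have "complex_of_real (LINT \<omega>|M. (norm (?F \<omega>))\<^sup>2) = (CLINT \<omega>|M. complex_of_real ((norm (?F \<omega>))\<^sup>2))"
    by (rule integral_complex_of_real[symmetric])
  also have "\<dots> = (\<Sum>T\<in>\<T>. \<Sum>T'\<in>\<T>. (b T * cnj (b T')) * of_real (if T = T' then ?A T else 0))"
  proof -
    have "(CLINT \<omega>|M. complex_of_real ((norm (?F \<omega>))\<^sup>2)) =
       (\<Sum>T\<in>\<T>. \<Sum>T'\<in>\<T>. CLINT \<omega>|M. (b T * cnj (b T')) * of_real (grid_product D T \<omega> * grid_product D T' \<omega>))"
      unfolding sq using grid_product_orthogonal(1)[OF D \<T>(2) \<T>(2)]
      by (subst Bochner_Integration.integral_sum, (intro Bochner_Integration.integrable_sum integrable_mult_right integrable_of_real; assumption),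
          intro sum.cong refl, subst Bochner_Integration.integral_sum)
         (auto intro!: integrable_mult_right integrable_of_real simp del: of_real_mult)
    also have "\<dots> = (\<Sum>T\<in>\<T>. \<Sum>T'\<in>\<T>. (b T * cnj (b T')) * of_real (if T = T' then ?A T else 0))"
    proof (intro sum.cong refl)
      fix T T' assume "T \<in> \<T>" "T' \<in> \<T>"
      then have "(LINT \<omega>|M. grid_product D T \<omega> * grid_product D T' \<omega>) = (if T = T' then ?A T else 0)"
        by (intro grid_product_orthogonal(2) D \<T>(2))
      then show "(CLINT \<omega>|M. (b T * cnj (b T')) * of_real (grid_product D T \<omega> * grid_product D T' \<omega>))
        = (b T * cnj (b T')) * of_real (if T = T' then ?A T else 0)"
        by (simp only: integral_mult_right_zero integral_complex_of_real)
    qed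
    finally show ?thesis .
  qed
  also have "\<dots> = (\<Sum>T\<in>\<T>. (b T * cnj (b T)) * of_real (?A T))"
  proof (intro sum.cong refl)
    fix T assume T: "T \<in> \<T>"
    have "(\<Sum>T'\<in>\<T>. (b T * cnj (b T')) * of_real (if T = T' then ?A T else 0))
        = (\<Sum>T'\<in>\<T>. if T = T' then (b T * cnj (b T')) * of_real (?A T) else 0)"
      by (intro sum.cong refl) simp
    also have "\<dots> = (b T * cnj (b T)) * of_real (?A T)"
      unfolding sum.delta'[OF \<T>(1), of T "\<lambda>T'. (b T * cnj (b T')) * of_real (?A T)"] if_P[OF T] ..
    finally show "(\<Sum>T'\<in>\<T>. (b T * cnj (b T')) * of_real (if T = T' then ?A T else 0)) = (b T * cnj (b T)) * of_real (?A T)" .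
  qed
  also have "\<dots> = complex_of_real (\<Sum>T\<in>\<T>. (norm (b T))\<^sup>2 * ?A T)"
    by (simp add: complex_norm_square del: of_real_power)
  finally have "(LINT \<omega>|M. (norm (?F \<omega>))\<^sup>2) = (\<Sum>T\<in>\<T>. (norm (b T))\<^sup>2 * ?A T)"
    by (simp only: of_real_eq_iff)
  moreover have "integrable M (\<lambda>\<omega>. (norm (?F \<omega>))\<^sup>2)" using int by (simp only: complex_of_real_integrable_eq)
  ultimately show ?thesis unfolding L2_sq_def by (subst nn_integral_eq_integral) auto
qed

abbreviation order_factorial :: "('d \<Rightarrow> nat) \<Rightarrow> real" where
  "order_factorial n \<equiv> (\<Prod>k\<in>UNIV. fact (n k))"

text \<open>A product of increments depends on a placement only through the set of tagged cells that it occupies, so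
  the sum is grouped by these sets, and the groups are orthogonal. The Cauchy-Schwarz inequality within a
  group costs its size, which is at most the product of the factorials. The sets also determine the order,
  so that kernels of different orders never meet in a group.\<close>

lemma elementary_bessel:
  assumes fin: "finite S" and el: "\<And>n q. n \<in> S \<Longrightarrow> q < N n \<Longrightarrow> elementary_cells n (R n q)"
  shows "L2_sq M (\<lambda>\<omega>. \<Sum>n\<in>S. elementary_integral W n (N n) (c n) (R n) \<omega>)
    \<le> (\<Sum>n\<in>S. ennreal (order_factorial n) * L2_sq (points_measure n) (elementary_kernel n (N n) (c n) (R n)))"
proof -
  obtain D where D: "is_grid D"
    and grid: "\<And>n q a. n \<in> S \<Longrightarrow> q < N n \<Longrightarrow> a \<in> slots n \<Longrightarrow> cell_on_grid D (R n q a)"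
    using elementary_cells_grid[OF fin, of N R] el by blast
  define Q where "Q = Sigma S (placements D)"
  define f where "f = (\<lambda>(n, \<gamma>). elementary_kernel n (N n) (c n) (R n) \<gamma>)"
  define im where "im = (\<lambda>(n, \<gamma>). tag \<gamma> ` slots n :: ('d \<times> real \<times> real) set)"
  define fib where "fib T = {x \<in> Q. im x = T}" for T
  let ?A = "\<lambda>T. \<Prod>t\<in>T. grid_area D (snd t)"
  have finQ: "finite Q" unfolding Q_def using fin finite_placements[OF D] by auto
  then have finfib: "finite (fib T)" for T by (simp add: fib_def)
  have im_sub: "im x \<subseteq> UNIV \<times> grid_corners D" if "x \<in> Q" for x
    using that by (auto simp: Q_def im_def placements_def tag_def)
  have A0: "?A (im x) \<ge> 0" if "x \<in> Q" for x
    using im_sub[OF that] grid_area_nonneg[OF D] by (intro prod_nonneg) auto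
  have card_fib: "real (card (fib (im x))) \<le> order_factorial (fst x)" if x: "x \<in> Q" for x
  proof -
    obtain n \<gamma>0 where x_eq: "x = (n, \<gamma>0)" by (cases x)
    with x have \<gamma>0: "n \<in> S" "\<gamma>0 \<in> placements D n" by (auto simp: Q_def)
    have "fib (im x) \<subseteq> Pair n ` {\<gamma> \<in> placements D n. tag \<gamma> ` slots n = tag \<gamma>0 ` slots n}"
    proof
      fix y assume y: "y \<in> fib (im x)"
      obtain m \<gamma> where y_eq: "y = (m, \<gamma>)" by (cases y)
      with y have \<gamma>: "\<gamma> \<in> placements D m" "tag \<gamma> ` slots m = tag \<gamma>0 ` slots n"
        by (auto simp: fib_def Q_def im_def x_eq)
      then have "m = n" using \<gamma>0 by (intro tag_image_determines_order) (auto simp: placements_def)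
      with \<gamma> show "y \<in> Pair n ` {\<gamma> \<in> placements D n. tag \<gamma> ` slots n = tag \<gamma>0 ` slots n}"
        by (auto simp: y_eq)
    qed
    moreover have finP: "finite {\<gamma> \<in> placements D n. tag \<gamma> ` slots n = tag \<gamma>0 ` slots n}"
      using finite_placements[OF D, of n] by simp
    ultimately have "card (fib (im x)) \<le> card (Pair n ` {\<gamma> \<in> placements D n. tag \<gamma> ` slots n = tag \<gamma>0 ` slots n})"
      by (intro card_mono finite_imageI)
    also have "\<dots> \<le> card {\<gamma> \<in> placements D n. tag \<gamma> ` slots n = tag \<gamma>0 ` slots n}"
      using finP by (rule card_image_le)
    also have "\<dots> \<le> (\<Prod>k\<in>UNIV. fact (n k))"
      by (rule placements_fibre_card[OF D \<gamma>0(2)])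
    finally have "real (card (fib (im x))) \<le> real (\<Prod>k\<in>UNIV. fact (n k))" by (rule of_nat_mono)
    then show ?thesis by (simp add: x_eq)
  qed
  have decomposition: "(\<Sum>n\<in>S. elementary_integral W n (N n) (c n) (R n) \<omega>)
      = (\<Sum>T\<in>im ` Q. (\<Sum>x\<in>fib T. f x) * of_real (grid_product D T \<omega>))" for \<omega>
  proof -
    have "(\<Sum>n\<in>S. elementary_integral W n (N n) (c n) (R n) \<omega>)
        = (\<Sum>n\<in>S. \<Sum>\<gamma>\<in>placements D n. f (n, \<gamma>) * of_real (grid_product D (im (n, \<gamma>)) \<omega>))"
      using grid el by (intro sum.cong refl) (auto simp: f_def im_def intro!: elementary_integral_on_grid D)
    also have "\<dots> = (\<Sum>x\<in>Q. f x * of_real (grid_product D (im x) \<omega>))"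
      unfolding Q_def using fin finite_placements[OF D] by (subst sum.Sigma) (auto simp: case_prod_beta)
    also have "\<dots> = (\<Sum>T\<in>im ` Q. \<Sum>x\<in>fib T. f x * of_real (grid_product D (im x) \<omega>))"
      unfolding fib_def by (rule sum.image_gen[OF finQ])
    also have "\<dots> = (\<Sum>T\<in>im ` Q. (\<Sum>x\<in>fib T. f x) * of_real (grid_product D T \<omega>))"
      by (intro sum.cong refl) (auto simp: sum_distrib_right fib_def intro!: sum.cong)
    finally show ?thesis .
  qed
  have im_sub': "T \<subseteq> UNIV \<times> grid_corners D" if "T \<in> im ` Q" for T
    using that im_sub by blast
  have "L2_sq M (\<lambda>\<omega>. \<Sum>n\<in>S. elementary_integral W n (N n) (c n) (R n) \<omega>)
      = ennreal (\<Sum>T\<in>im ` Q. (norm (\<Sum>x\<in>fib T. f x))\<^sup>2 * ?A T)"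
    unfolding decomposition by (rule grid_product_parseval[OF D finite_imageI[OF finQ] im_sub'])
  also have "\<dots> \<le> ennreal (\<Sum>T\<in>im ` Q. \<Sum>x\<in>fib T. order_factorial (fst x) * (norm (f x))\<^sup>2 * ?A (im x))"
  proof (intro ennreal_leI sum_mono)
    fix T assume "T \<in> im ` Q"
    then obtain x0 where x0: "x0 \<in> Q" "T = im x0" by auto
    have "(norm (\<Sum>x\<in>fib T. f x))\<^sup>2 * ?A T \<le> (real (card (fib T)) * (\<Sum>x\<in>fib T. (norm (f x))\<^sup>2)) * ?A T"
      using A0[OF x0(1)] x0(2) by (intro mult_right_mono norm_sum_sq_le_card) auto
    also have "\<dots> = (\<Sum>x\<in>fib T. real (card (fib T)) * (norm (f x))\<^sup>2 * ?A (im x))"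
      unfolding sum_distrib_left sum_distrib_right by (intro sum.cong refl) (auto simp: fib_def)
    also have "\<dots> \<le> (\<Sum>x\<in>fib T. order_factorial (fst x) * (norm (f x))\<^sup>2 * ?A (im x))"
    proof (intro sum_mono mult_right_mono)
      fix x assume "x \<in> fib T"
      then have "x \<in> Q" "im x = T" by (auto simp: fib_def)
      then show "real (card (fib T)) \<le> order_factorial (fst x)" "0 \<le> ?A (im x)" using card_fib[of x] A0[of x] by auto
    qed simp
    finally show "(norm (\<Sum>x\<in>fib T. f x))\<^sup>2 * ?A T \<le> (\<Sum>x\<in>fib T. order_factorial (fst x) * (norm (f x))\<^sup>2 * ?A (im x))" .
  qed
  also have "(\<Sum>T\<in>im ` Q. \<Sum>x\<in>fib T. order_factorial (fst x) * (norm (f x))\<^sup>2 * ?A (im x))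
      = (\<Sum>x\<in>Q. order_factorial (fst x) * (norm (f x))\<^sup>2 * ?A (im x))"
    unfolding fib_def by (rule sum.image_gen[OF finQ, symmetric])
  also have "\<dots> = (\<Sum>n\<in>S. \<Sum>\<gamma>\<in>placements D n. order_factorial n * (norm (f (n, \<gamma>)))\<^sup>2 * ?A (im (n, \<gamma>)))"
    unfolding Q_def using fin finite_placements[OF D] by (subst sum.Sigma) (auto simp: case_prod_beta)
  also have "ennreal \<dots> = (\<Sum>n\<in>S. ennreal (order_factorial n) * (\<Sum>\<gamma>\<in>placements D n. ennreal ((norm (f (n, \<gamma>)))\<^sup>2 * ?A (im (n, \<gamma>)))))"
  proof -
    have pos: "0 \<le> (norm (f (n, \<gamma>)))\<^sup>2 * ?A (im (n, \<gamma>))" if "n \<in> S" "\<gamma> \<in> placements D n" for n \<gamma>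
      using A0[of "(n, \<gamma>)"] that by (simp add: Q_def)
    have posS: "0 \<le> (\<Sum>\<gamma>\<in>placements D n. (norm (f (n, \<gamma>)))\<^sup>2 * ?A (im (n, \<gamma>)))" if "n \<in> S" for n
      using that by (intro sum_nonneg pos)
    have fac: "0 \<le> order_factorial n" for n :: "'d \<Rightarrow> nat" by (intro prod_nonneg) auto
    have "ennreal (\<Sum>n\<in>S. \<Sum>\<gamma>\<in>placements D n. order_factorial n * (norm (f (n, \<gamma>)))\<^sup>2 * ?A (im (n, \<gamma>)))
       = ennreal (\<Sum>n\<in>S. order_factorial n * (\<Sum>\<gamma>\<in>placements D n. (norm (f (n, \<gamma>)))\<^sup>2 * ?A (im (n, \<gamma>))))"
      by (simp add: sum_distrib_left mult.assoc)
    also have "\<dots> = (\<Sum>n\<in>S. ennreal (order_factorial n * (\<Sum>\<gamma>\<in>placements D n. (norm (f (n, \<gamma>)))\<^sup>2 * ?A (im (n, \<gamma>)))))"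
      by (intro sum_ennreal[symmetric] mult_nonneg_nonneg fac posS)
    also have "\<dots> = (\<Sum>n\<in>S. ennreal (order_factorial n) * ennreal (\<Sum>\<gamma>\<in>placements D n. (norm (f (n, \<gamma>)))\<^sup>2 * ?A (im (n, \<gamma>))))"
      by (intro sum.cong refl ennreal_mult fac posS)
    also have "\<dots> = (\<Sum>n\<in>S. ennreal (order_factorial n) * (\<Sum>\<gamma>\<in>placements D n. ennreal ((norm (f (n, \<gamma>)))\<^sup>2 * ?A (im (n, \<gamma>)))))"
      by (intro sum.cong refl arg_cong2[where f = "(*)"] sum_ennreal[symmetric] pos)
    finally show ?thesis .
  qed
  also have "\<dots> \<le> (\<Sum>n\<in>S. ennreal (order_factorial n) * L2_sq (points_measure n) (elementary_kernel n (N n) (c n) (R n)))"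
  proof (intro sum_mono mult_left_mono)
    fix n assume n: "n \<in> S"
    have "?A (im (n, \<gamma>)) = (\<Prod>a\<in>slots n. grid_area D (\<gamma> a))" if "\<gamma> \<in> placements D n" for \<gamma>
      using that unfolding im_def prod.case placements_def
      by (subst prod.reindex) (auto simp: tag_def)
    then have "(\<Sum>\<gamma>\<in>placements D n. ennreal ((norm (f (n, \<gamma>)))\<^sup>2 * ?A (im (n, \<gamma>))))
      = (\<Sum>\<gamma>\<in>placements D n. ennreal ((norm (elementary_kernel n (N n) (c n) (R n) \<gamma>))\<^sup>2 * (\<Prod>a\<in>slots n. grid_area D (\<gamma> a))))"
      by (intro sum.cong refl) (simp add: f_def)
    also have "\<dots> \<le> L2_sq (points_measure n) (elementary_kernel n (N n) (c n) (R n))"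
      using grid[OF n] by (intro elementary_kernel_norm_ge D) auto
    finally show "(\<Sum>\<gamma>\<in>placements D n. ennreal ((norm (f (n, \<gamma>)))\<^sup>2 * ?A (im (n, \<gamma>))))
      \<le> L2_sq (points_measure n) (elementary_kernel n (N n) (c n) (R n))" .
  qed simp
  finally show ?thesis .
qed

lemma multiple_integral_iff:
  "multiple_integral M W n f X \<longleftrightarrow> f \<in> borel_measurable (points_measure n) \<and> X \<in> borel_measurable M \<and>
     (\<exists>N c R. (\<forall>p. \<forall>q<N p. elementary_cells n (R p q)) \<and>
        tendsto_L2 (points_measure n) (\<lambda>p. elementary_kernel n (N p) (c p) (R p)) f sequentially \<and>
        tendsto_L2 M (\<lambda>p. elementary_integral W n (N p) (c p) (R p)) X sequentially)"
  unfolding multiple_integral_def elementary_kernel_def[abs_def] elementary_integral_def[abs_def] by simp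

text \<open>Both sides pass to the limit from elementary kernels; all orders in \<open>S\<close> are approximated
  simultaneously.\<close>

lemma multiple_integral_bessel:
  assumes fin: "finite S" and J: "\<And>n. n \<in> S \<Longrightarrow> multiple_integral M W n (f n) (J n)"
  shows "L2_sq M (\<lambda>\<omega>. \<Sum>n\<in>S. J n \<omega>) \<le> (\<Sum>n\<in>S. ennreal (order_factorial n) * L2_sq (points_measure n) (f n))"
proof -
  have meas: "f n \<in> borel_measurable (points_measure n)" "J n \<in> borel_measurable M" if "n \<in> S" for n
    using J[OF that] by (auto simp: multiple_integral_iff)
  define appr where "appr n N c R \<longleftrightarrow> (\<forall>p. \<forall>q<N p. elementary_cells n (R p q)) \<and>
        tendsto_L2 (points_measure n) (\<lambda>p. elementary_kernel n (N p) (c p) (R p)) (f n) sequentially \<and>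
        tendsto_L2 M (\<lambda>p. elementary_integral W n (N p) (c p) (R p)) (J n) sequentially" for n N c R
  have "\<forall>n\<in>S. \<exists>N c R. appr n N c R"
    using J unfolding multiple_integral_iff appr_def by blast
  then obtain N c R where a: "\<And>n. n \<in> S \<Longrightarrow> appr n (N n) (c n) (R n)" by metis
  have el: "\<forall>q<N n p. elementary_cells n (R n p q)" if "n \<in> S" for n p using a[OF that] by (simp add: appr_def)
  let ?K = "\<lambda>n p. elementary_kernel n (N n p) (c n p) (R n p)"
  let ?I = "\<lambda>p \<omega>. \<Sum>n\<in>S. elementary_integral W n (N n p) (c n p) (R n p) \<omega>"
  have lim: "tendsto_L2 M ?I (\<lambda>\<omega>. \<Sum>n\<in>S. J n \<omega>) sequentially"
    using a meas el by (intro tendsto_L2_sum fin) (auto simp: appr_def intro: elementary_integral_measurable)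
  show ?thesis
  proof (rule ennreal_le_one_plus_eps)
    fix e :: real assume e: "e > 0"
    let ?B = "\<lambda>p. \<Sum>n\<in>S. ennreal (order_factorial n) * (ennreal (1 + e) * L2_sq (points_measure n) (f n)
        + ennreal (1 + 1 / e) * L2_sq (points_measure n) (\<lambda>z. ?K n p z - f n z))"
    have "?B \<longlonglongrightarrow> (\<Sum>n\<in>S. ennreal (order_factorial n) * (ennreal (1 + e) * L2_sq (points_measure n) (f n) + ennreal (1 + 1 / e) * 0))"
      using a by (intro tendsto_sum ennreal_tendsto_cmult tendsto_add tendsto_const) (auto simp: appr_def tendsto_L2_iff)
    then have B: "?B \<longlonglongrightarrow> ennreal (1 + e) * (\<Sum>n\<in>S. ennreal (order_factorial n) * L2_sq (points_measure n) (f n))"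
      by (simp add: sum_distrib_left mult_ac)
    show "L2_sq M (\<lambda>\<omega>. \<Sum>n\<in>S. J n \<omega>) \<le> ennreal (1 + e) * (\<Sum>n\<in>S. ennreal (order_factorial n) * L2_sq (points_measure n) (f n))"
    proof (rule L2_sq_limit_le[OF lim _ _ _ _ B])
      show "?I p \<in> borel_measurable M" for p
        by (intro borel_measurable_sum elementary_integral_measurable el)
      show "(\<lambda>\<omega>. \<Sum>n\<in>S. J n \<omega>) \<in> borel_measurable M" using meas by (intro borel_measurable_sum) auto
      show "\<forall>\<^sub>F p in sequentially. L2_sq M (?I p) \<le> ?B p"
      proof (intro always_eventually allI)
        fix p
        have "L2_sq M (?I p) \<le> (\<Sum>n\<in>S. ennreal (order_factorial n) * L2_sq (points_measure n) (?K n p))"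
          using el by (intro elementary_bessel fin) auto
        also have "\<dots> \<le> ?B p"
        proof (intro sum_mono mult_left_mono)
          fix n assume n: "n \<in> S"
          have "L2_sq (points_measure n) (?K n p) = L2_sq (points_measure n) (\<lambda>z. f n z + (?K n p z - f n z))" by simp
          also have "\<dots> \<le> ennreal (1 + e) * L2_sq (points_measure n) (f n)
              + ennreal (1 + 1 / e) * L2_sq (points_measure n) (\<lambda>z. ?K n p z - f n z)"
            using meas(1)[OF n] by (intro L2_sq_add_le e) auto
          finally show "L2_sq (points_measure n) (?K n p) \<le> \<dots>" .
        qed simp
        finally show "L2_sq M (?I p) \<le> ?B p" .
      qed
    qed simp
  qed
qed

lemma sum_lessThan_append:
  fixes F G :: "nat \<Rightarrow> 'b::comm_monoid_add"
  shows "(\<Sum>q<a + b. if q < a then F q else G (q - a)) = (\<Sum>q<a. F q) + (\<Sum>q<b. G q)"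
  by (induction b) (simp_all add: add.assoc)

lemma multiple_integral_diff:
  assumes "multiple_integral M W n f X" "multiple_integral M W n g Y"
  shows "multiple_integral M W n (\<lambda>z. f z - g z) (\<lambda>\<omega>. X \<omega> - Y \<omega>)"
proof -
  from assms obtain N c R N' c' R' where
    el: "\<forall>p. \<forall>q<N p. elementary_cells n (R p q)" "\<forall>p. \<forall>q<N' p. elementary_cells n (R' p q)" and
    fg: "tendsto_L2 (points_measure n) (\<lambda>p. elementary_kernel n (N p) (c p) (R p)) f sequentially"
     "tendsto_L2 (points_measure n) (\<lambda>p. elementary_kernel n (N' p) (c' p) (R' p)) g sequentially" and
    XY: "tendsto_L2 M (\<lambda>p. elementary_integral W n (N p) (c p) (R p)) X sequentially"
     "tendsto_L2 M (\<lambda>p. elementary_integral W n (N' p) (c' p) (R' p)) Y sequentially" and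
    meas: "f \<in> borel_measurable (points_measure n)" "g \<in> borel_measurable (points_measure n)"
      "X \<in> borel_measurable M" "Y \<in> borel_measurable M"
    unfolding multiple_integral_iff by blast
  define e where "e p q = (if q < N p then c p q else - c' p (q - N p))" for p q
  define Q where "Q p q = (if q < N p then R p q else R' p (q - N p))" for p q
  have K: "elementary_kernel n (N p + N' p) (e p) (Q p) z
      = elementary_kernel n (N p) (c p) (R p) z + (-1) * elementary_kernel n (N' p) (c' p) (R' p) z" for p z
    unfolding elementary_kernel_def sum_distrib_left sum_lessThan_append[symmetric]
    by (intro sum.cong) (auto simp: e_def Q_def)
  have I: "elementary_integral W n (N p + N' p) (e p) (Q p) \<omega>
      = elementary_integral W n (N p) (c p) (R p) \<omega> + (-1) * elementary_integral W n (N' p) (c' p) (R' p) \<omega>" for p \<omega>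
    unfolding elementary_integral_def sum_distrib_left sum_lessThan_append[symmetric]
    by (intro sum.cong) (auto simp: e_def Q_def)
  have minus: "f z - g z = f z + (-1) * g z" "X \<omega> - Y \<omega> = X \<omega> + (-1) * Y \<omega>" for z \<omega> by simp_all
  have "tendsto_L2 (points_measure n) (\<lambda>p. elementary_kernel n (N p + N' p) (e p) (Q p)) (\<lambda>z. f z - g z) sequentially"
    unfolding K minus using fg meas by (intro tendsto_L2_add tendsto_L2_cmult) auto
  moreover have "tendsto_L2 M (\<lambda>p. elementary_integral W n (N p + N' p) (e p) (Q p)) (\<lambda>\<omega>. X \<omega> - Y \<omega>) sequentially"
    unfolding I minus using XY meas el
    by (intro tendsto_L2_add tendsto_L2_cmult borel_measurable_times borel_measurable_const elementary_integral_measurable) auto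
  moreover have "\<forall>p. \<forall>q<N p + N' p. elementary_cells n (Q p q)"
    using el by (auto simp: Q_def)
  ultimately show ?thesis unfolding multiple_integral_iff using meas
    by (intro conjI exI[of _ "\<lambda>p. N p + N' p"] exI[of _ e] exI[of _ Q]) auto
qed

lemma multiple_integral_cnj:
  assumes "multiple_integral M W n f X"
  shows "multiple_integral M W n (\<lambda>z. cnj (f z)) (\<lambda>\<omega>. cnj (X \<omega>))"
proof -
  from assms obtain N c R where el: "\<forall>p. \<forall>q<N p. elementary_cells n (R p q)" and
    lims: "tendsto_L2 (points_measure n) (\<lambda>p. elementary_kernel n (N p) (c p) (R p)) f sequentially"
      "tendsto_L2 M (\<lambda>p. elementary_integral W n (N p) (c p) (R p)) X sequentially" and
    [measurable]: "f \<in> borel_measurable (points_measure n)" "X \<in> borel_measurable M"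
    unfolding multiple_integral_iff by blast
  have "cnj (indicator A x) = indicator A x" for A and x :: "real \<times> real" by (simp add: indicator_def)
  then have "elementary_kernel n (N p) (\<lambda>q. cnj (c p q)) (R p) = (\<lambda>z. cnj (elementary_kernel n (N p) (c p) (R p) z))" for p
    by (simp add: elementary_kernel_def fun_eq_iff)
  moreover have "elementary_integral W n (N p) (\<lambda>q. cnj (c p q)) (R p) = (\<lambda>\<omega>. cnj (elementary_integral W n (N p) (c p) (R p) \<omega>))" for p
    by (simp add: elementary_integral_def fun_eq_iff case_prod_beta)
  ultimately show ?thesis unfolding multiple_integral_iff using el lims[THEN tendsto_L2_cnj]
    by (intro conjI exI[of _ N] exI[of _ "\<lambda>p q. cnj (c p q)"] exI[of _ R]) auto
qed

text \<open>Bessel's inequality for the zero kernel.\<close>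

lemma multiple_integral_unique:
  assumes "multiple_integral M W n f X" "multiple_integral M W n f Y"
  shows "AE \<omega> in M. X \<omega> = Y \<omega>"
proof -
  have "multiple_integral M W n (\<lambda>z. f z - f z) (\<lambda>\<omega>. X \<omega> - Y \<omega>)" using assms by (rule multiple_integral_diff)
  from multiple_integral_bessel[of "{n}" "\<lambda>_ z. f z - f z" "\<lambda>_ \<omega>. X \<omega> - Y \<omega>"] this
  have "L2_sq M (\<lambda>\<omega>. X \<omega> - Y \<omega>) \<le> 0" by (simp add: L2_sq_def)
  then have "AE \<omega> in M. X \<omega> - Y \<omega> = 0"
    using assms by (intro L2_sq_zeroD) (auto simp: multiple_integral_iff)
  then show ?thesis by simp
qed

lemma chaos_sum_unique:
  assumes "chaos_sum M W f X" "chaos_sum M W f Y"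
  shows "AE \<omega> in M. X \<omega> = Y \<omega>"
proof -
  from assms obtain J J' where J: "\<And>n. multiple_integral M W n (f n) (J n)" "\<And>n. multiple_integral M W n (f n) (J' n)"
    and lim: "tendsto_L2 M (\<lambda>S \<omega>. \<Sum>n\<in>S. J n \<omega>) X (finite_subsets_at_top UNIV)"
      "tendsto_L2 M (\<lambda>S \<omega>. \<Sum>n\<in>S. J' n \<omega>) Y (finite_subsets_at_top UNIV)"
    and [measurable]: "X \<in> borel_measurable M" "Y \<in> borel_measurable M"
    unfolding chaos_sum_def by blast
  have Jm: "J n \<in> borel_measurable M" for n using J(1) by (simp add: multiple_integral_iff)
  have eq: "AE \<omega> in M. (\<Sum>n\<in>S. J' n \<omega>) = (\<Sum>n\<in>S. J n \<omega>)" for S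
  proof (cases "finite S")
    case True
    have "AE \<omega> in M. \<forall>n\<in>S. J' n \<omega> = J n \<omega>"
      using True J multiple_integral_unique by (intro AE_finite_allI) blast+
    then show ?thesis by eventually_elim simp
  qed simp
  have "tendsto_L2 M (\<lambda>S \<omega>. \<Sum>n\<in>S. J n \<omega>) Y (finite_subsets_at_top UNIV)"
    using lim(2) eq by (rule tendsto_L2_cong_AE) simp
  with lim(1) show ?thesis
    by (rule tendsto_L2_unique) (auto simp: finite_subsets_at_top_neq_bot intro!: borel_measurable_sum Jm)
qed

lemma chaos_sum_cnj:
  assumes "chaos_sum M W f X"
  shows "chaos_sum M W (\<lambda>n z. cnj (f n z)) (\<lambda>\<omega>. cnj (X \<omega>))"
proof -
  from assms obtain J where J: "\<And>n. multiple_integral M W n (f n) (J n)"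
    and lim: "tendsto_L2 M (\<lambda>S \<omega>. \<Sum>n\<in>S. J n \<omega>) X (finite_subsets_at_top UNIV)"
    and [measurable]: "X \<in> borel_measurable M"
    unfolding chaos_sum_def by blast
  show ?thesis unfolding chaos_sum_def
    using multiple_integral_cnj[OF J] tendsto_L2_cnj[OF lim]
    by (intro conjI exI[of _ "\<lambda>n \<omega>. cnj (J n \<omega>)"]) (auto simp: cnj_sum)
qed

lemma chaos_sum_bessel:
  assumes "chaos_sum M W f X"
    and B: "\<And>S. finite S \<Longrightarrow> (\<Sum>n\<in>S. ennreal (order_factorial n) * L2_sq (points_measure n) (f n)) \<le> B"
  shows "L2_sq M X \<le> B"
proof -
  from assms(1) obtain J where J: "\<And>n. multiple_integral M W n (f n) (J n)"
    and lim: "tendsto_L2 M (\<lambda>S \<omega>. \<Sum>n\<in>S. J n \<omega>) X (finite_subsets_at_top UNIV)"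
    and [measurable]: "X \<in> borel_measurable M"
    unfolding chaos_sum_def by blast
  have Jm: "J n \<in> borel_measurable M" for n using J by (simp add: multiple_integral_iff)
  show ?thesis
  proof (rule L2_sq_limit_le[OF lim _ _ _ _ tendsto_const])
    show "\<forall>\<^sub>F S in finite_subsets_at_top UNIV. L2_sq M (\<lambda>\<omega>. \<Sum>n\<in>S. J n \<omega>) \<le> B"
      using multiple_integral_bessel[of _ f J] J B
      by (intro eventually_finite_subsets_at_top_weakI) (meson order_trans)
  qed (auto simp: finite_subsets_at_top_neq_bot intro!: borel_measurable_sum Jm)
qed

end

section \<open>The kernels of the current\<close>

lemma sum_permutations_last:
  fixes h :: "nat \<Rightarrow> real"
  assumes "m > 0"
  shows "(\<Sum>\<sigma> | \<sigma> permutes {..<m}. h (\<sigma> (m - 1))) = fact (m - 1) * (\<Sum>l<m. h l)"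
proof -
  have ins: "{..<m} = insert (m - 1) {..<m - 1}" using assms by auto
  have "(\<Sum>\<sigma> | \<sigma> permutes {..<m}. h (\<sigma> (m - 1)))
      = (\<Sum>b\<in>insert (m - 1) {..<m - 1}. \<Sum>q | q permutes {..<m - 1}. h ((Transposition.transpose (m - 1) b \<circ> q) (m - 1)))"
    unfolding ins by (rule sum_over_permutations_insert) auto
  also have "\<dots> = (\<Sum>b\<in>insert (m - 1) {..<m - 1}. \<Sum>q | q permutes {..<m - 1}. h b)"
  proof (intro sum.cong refl)
    fix b q assume "q \<in> {q. q permutes {..<m - 1}}"
    then have "q (m - 1) = m - 1" by (simp add: permutes_def)
    then show "h ((Transposition.transpose (m - 1) b \<circ> q) (m - 1)) = h b" by simp
  qed
  also have "\<dots> = fact (m - 1) * (\<Sum>l<m. h l)"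
    unfolding ins[symmetric] by (simp add: card_permutations sum_distrib_left)
  finally show ?thesis .
qed

text \<open>The average over all permutations of a quantity that depends only on which variable comes last is the
  average over the variables.\<close>

lemma symmetrize_last:
  fixes h :: "nat \<Rightarrow> real"
  assumes "m > 0"
    and "\<And>\<sigma>. \<sigma> permutes {..<m} \<Longrightarrow> f (\<lambda>(k', l). if k' = k then z (k, \<sigma> l) else z (k', l)) = h (\<sigma> (m - 1))"
  shows "symmetrize k m f z = (\<Sum>l<m. h l) / real m"
proof -
  have "symmetrize k m f z = (\<Sum>\<sigma> | \<sigma> permutes {..<m}. h (\<sigma> (m - 1))) / fact m"
    unfolding symmetrize_def using assms(2) by simp
  also have "fact m = real m * fact (m - 1)" using assms(1) by (rule fact_reduce)
  finally show ?thesis unfolding sum_permutations_last[OF assms(1)] by simp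
qed

text \<open>Symmetrization permutes the points among the slots of one component. Conditions on the set of all points
  are not affected.\<close>

definition permute_slots :: "'d \<Rightarrow> (nat \<Rightarrow> nat) \<Rightarrow> 'd \<times> nat \<Rightarrow> 'd \<times> nat" where
  "permute_slots k \<sigma> = (\<lambda>(k', l). (k', if k' = k then \<sigma> l else l))"

lemma permute_slots_comp:
  "(\<lambda>(k', l). if k' = k then z (k, \<sigma> l) else z (k', l)) = z \<circ> permute_slots k \<sigma>"
proof
  fix a
  show "(case a of (k', l) \<Rightarrow> if k' = k then z (k, \<sigma> l) else z (k', l)) = (z \<circ> permute_slots k \<sigma>) a"
    by (cases a) (simp add: permute_slots_def)
qed

lemma permute_slots_image:
  assumes "\<sigma> permutes {..<n k}"
  shows "permute_slots k \<sigma> ` slots n = slots n"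
proof
  have mem: "\<sigma> l < n k" if "l < n k" for l
    using permutes_in_image[OF assms, of l] that by simp
  then show "permute_slots k \<sigma> ` slots n \<subseteq> slots n"
    by (auto simp: permute_slots_def slots_def)
  show "slots n \<subseteq> permute_slots k \<sigma> ` slots n"
  proof
    fix a assume a: "a \<in> slots n"
    obtain k' l where kl: "a = (k', l)" by (cases a)
    have "inv \<sigma> permutes {..<n k}" by (rule permutes_inv[OF assms])
    then have "(k', if k' = k then inv \<sigma> l else l) \<in> slots n"
      using a permutes_in_image[of "inv \<sigma>" "{..<n k}" l] by (auto simp: slots_def kl)
    moreover have "a = permute_slots k \<sigma> (k', if k' = k then inv \<sigma> l else l)"
      using permutes_inverses(1)[OF assms, of l] by (simp add: permute_slots_def kl)
    ultimately show "a \<in> permute_slots k \<sigma> ` slots n" by blast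
  qed
qed

lemma ball_slots_permute:
  assumes "\<sigma> permutes {..<n k}"
  shows "(\<forall>c\<in>slots n. P ((z \<circ> permute_slots k \<sigma>) c)) \<longleftrightarrow> (\<forall>c\<in>slots n. P (z c))"
  using permute_slots_image[of \<sigma> n k, OF assms] by (metis (no_types, lifting) comp_apply image_iff)

lemma ball_slots_drop_last:
  assumes "m k > 0"
  shows "(\<forall>c\<in>slots m. P c) \<longleftrightarrow> (\<forall>c\<in>slots (m(k := m k - 1)). P c) \<and> P (k, m k - 1)"
proof -
  have "slots m = insert (k, m k - 1) (slots (m(k := m k - 1)))"
    using assms by (auto simp: slots_def split: if_splits)
  then show ?thesis by auto
qed

lemma slots_drop_subset: "slots (n(k := n k - 1)) \<subseteq> slots n"
  by (auto simp: slots_def split: if_splits)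

lemma prod_prod_indicator:
  fixes m :: "'d::finite \<Rightarrow> nat"
  shows "(\<Prod>k\<in>UNIV. a k * (\<Prod>l<m k. indicator B (z (k, l)))) = (\<Prod>k\<in>UNIV. a k) * (of_bool (\<forall>c\<in>slots m. z c \<in> B) :: real)"
proof -
  have "(\<Prod>k\<in>UNIV. \<Prod>l<m k. indicator B (z (k, l))) = (\<Prod>c\<in>slots m. indicator B (z c) :: real)"
    unfolding slots_def by (simp add: prod.Sigma case_prod_beta)
  also have "\<dots> = of_bool (\<forall>c\<in>slots m. z c \<in> B)"
  proof (cases "\<forall>c\<in>slots m. z c \<in> B")
    case False
    then obtain c where "c \<in> slots m" "z c \<notin> B" by blast
    then have "(\<Prod>c\<in>slots m. indicator B (z c) :: real) = 0" by (intro prod_zero bexI[of _ c]) auto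
    with False show ?thesis by simp
  qed (auto intro!: prod.neutral)
  finally show ?thesis by (simp add: prod.distrib)
qed

definition dirac_product :: "real ^ 'd \<Rightarrow> ('d::finite \<Rightarrow> nat) \<Rightarrow> real \<Rightarrow> real \<Rightarrow> real" where
  "dirac_product x m u v = (\<Prod>k\<in>UNIV. dirac_coeff (m k) (x $ k) u v)"

text \<open>The indicators say that all points of the remaining slots, together with the two points
  \<open>(u1, v1)\<close> and \<open>w (j, l)\<close>, lie in the rectangle with upper right corner
  \<open>(u1, snd (w (j, l)))\<close>.\<close>

lemma inner_divergence:
  fixes m :: "'d::finite \<Rightarrow> nat"
  assumes w: "\<And>c. c \<in> slots m \<Longrightarrow> w c \<in> unit_square"
  shows "divergence j (\<lambda>(u2, v2). (\<lambda>n z. dirac_chaos x (u1, v2) n z * indicator {0..u1} u2 * indicator {0..v2} v1)) m w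
    = (\<Sum>l<m j. of_bool ((\<forall>c\<in>slots m. fst (w c) \<le> u1 \<and> snd (w c) \<le> snd (w (j, l))) \<and> 0 \<le> v1 \<and> v1 \<le> snd (w (j, l)))
         * dirac_product x (m(j := m j - 1)) u1 (snd (w (j, l)))) / real (m j)"
proof (cases "m j = 0")
  case True
  then show ?thesis by (simp add: divergence_def)
next
  case False
  have "m j > 0" using False by simp
  define h where "h l = of_bool ((\<forall>c\<in>slots m. fst (w c) \<le> u1 \<and> snd (w c) \<le> snd (w (j, l))) \<and> 0 \<le> v1 \<and> v1 \<le> snd (w (j, l)))
         * dirac_product x (m(j := m j - 1)) u1 (snd (w (j, l)))" for l
  let ?F = "\<lambda>(u2, v2). (\<lambda>n z. dirac_chaos x (u1, v2) n z * indicator {0..u1} u2 * indicator {0..v2} v1)"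
  have "symmetrize j (m j) (\<lambda>z. ?F (z (j, m j - 1)) (m(j := m j - 1)) z) w = (\<Sum>l<m j. h l) / real (m j)"
  proof (rule symmetrize_last)
    show "m j > 0" by fact
    fix \<sigma> assume \<sigma>: "\<sigma> permutes {..<m j}"
    let ?w = "w \<circ> permute_slots j \<sigma>"
    obtain u2 v2 where uv: "w (j, \<sigma> (m j - 1)) = (u2, v2)" by fastforce
    have last: "?w (j, m j - 1) = (u2, v2)" using uv by (simp add: permute_slots_def)
    have sq: "?w c \<in> unit_square" if "c \<in> slots m" for c
      using w permute_slots_image[of \<sigma> m j, OF \<sigma>] that by (metis comp_apply imageI)
    have h_eq: "h (\<sigma> (m j - 1)) = dirac_product x (m(j := m j - 1)) u1 v2 *
       of_bool ((\<forall>c\<in>slots m. fst (w c) \<le> u1 \<and> snd (w c) \<le> v2) \<and> 0 \<le> v1 \<and> v1 \<le> v2)"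
      unfolding h_def uv snd_conv by (rule mult.commute)
    have "?F (?w (j, m j - 1)) (m(j := m j - 1)) ?w
        = dirac_product x (m(j := m j - 1)) u1 v2 *
          of_bool (\<forall>c\<in>slots (m(j := m j - 1)). ?w c \<in> {0..u1} \<times> {0..v2}) * indicator {0..u1} u2 * indicator {0..v2} v1"
      unfolding last dirac_chaos_def prod.case dirac_product_def
      by (subst prod_prod_indicator[where m = "m(j := m j - 1)" and z = ?w]) (rule refl)
    also have "\<dots> = dirac_product x (m(j := m j - 1)) u1 v2 *
       of_bool (((\<forall>c\<in>slots (m(j := m j - 1)). ?w c \<in> {0..u1} \<times> {0..v2}) \<and> ?w (j, m j - 1) \<in> {0..u1} \<times> {0..v2}) \<and> 0 \<le> v1 \<and> v1 \<le> v2)"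
      unfolding last by (auto simp: indicator_def of_bool_def)
    also have "((\<forall>c\<in>slots (m(j := m j - 1)). ?w c \<in> {0..u1} \<times> {0..v2}) \<and> ?w (j, m j - 1) \<in> {0..u1} \<times> {0..v2})
        \<longleftrightarrow> (\<forall>c\<in>slots m. ?w c \<in> {0..u1} \<times> {0..v2})"
      by (rule ball_slots_drop_last[of m j "\<lambda>c. ?w c \<in> {0..u1} \<times> {0..v2}", OF \<open>m j > 0\<close>, symmetric])
    also have "\<dots> \<longleftrightarrow> (\<forall>c\<in>slots m. w c \<in> {0..u1} \<times> {0..v2})"
      by (rule ball_slots_permute[of \<sigma> m j "\<lambda>p. p \<in> {0..u1} \<times> {0..v2}" w, OF \<sigma>])
    also have "\<dots> \<longleftrightarrow> (\<forall>c\<in>slots m. fst (w c) \<le> u1 \<and> snd (w c) \<le> v2)"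
      using w by (fastforce simp: unit_square_def mem_Times_iff)
    finally show "?F ((\<lambda>(k', l). if k' = j then w (j, \<sigma> l) else w (k', l)) (j, m j - 1)) (m(j := m j - 1))
        (\<lambda>(k', l). if k' = j then w (j, \<sigma> l) else w (k', l)) = h (\<sigma> (m j - 1))"
      unfolding permute_slots_comp h_eq .
  qed
  with False show ?thesis by (simp add: divergence_def h_def)
qed

text \<open>The possible slots of the two variables introduced by the divergences, \<open>a\<close> for the outer and
  \<open>b\<close> for the inner one. Removing these two variables leaves the orders
  \<open>drop_orders i j n\<close>.\<close>

definition slot_pairs :: "'d \<Rightarrow> 'd \<Rightarrow> ('d \<Rightarrow> nat) \<Rightarrow> (('d \<times> nat) \<times> ('d \<times> nat)) set" where
  "slot_pairs i j n = {(a, b). a \<in> {i} \<times> {..<n i} \<and> b \<in> {j} \<times> {..<n j} \<and> a \<noteq> b}"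

definition drop_orders :: "'d \<Rightarrow> 'd \<Rightarrow> ('d \<Rightarrow> nat) \<Rightarrow> 'd \<Rightarrow> nat" where
  "drop_orders i j n = (let n' = n(i := n i - 1) in n'(j := n' j - 1))"

text \<open>The point at \<open>a\<close> is the rightmost and the point at \<open>b\<close> the highest of all
  points.\<close>

definition upper_right :: "('d \<Rightarrow> nat) \<Rightarrow> 'd points \<Rightarrow> 'd \<times> nat \<Rightarrow> 'd \<times> nat \<Rightarrow> bool" where
  "upper_right n z a b \<longleftrightarrow> (\<forall>c\<in>slots n. fst (z c) \<le> fst (z a) \<and> snd (z c) \<le> snd (z b))"

lemma slot_pairs_Sigma:
  "slot_pairs i j n = (SIGMA a:{i} \<times> {..<n i}. {j} \<times> {..<n j} - {a})"
  by (auto simp: slot_pairs_def)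

lemma finite_slot_pairs[simp]: "finite (slot_pairs i j n)"
  unfolding slot_pairs_Sigma by auto

lemma card_slot_pairs:
  "card (slot_pairs i j n) = n i * (n(i := n i - 1)) j"
proof -
  have "card ({j} \<times> {..<n j} - {a}) = (n(i := n i - 1)) j" if "a \<in> {i} \<times> {..<n i}" for a
  proof (cases "i = j")
    case True
    with that have "a \<in> {j} \<times> {..<n j}" by auto
    then show ?thesis using True by (simp add: card_cartesian_product)
  next
    case False
    with that have "{j} \<times> {..<n j} - {a} = {j} \<times> {..<n j}" by auto
    then show ?thesis using False by (simp add: card_cartesian_product)
  qed
  then show ?thesis unfolding slot_pairs_Sigma
    by (subst card_SigmaI) (auto simp: card_cartesian_product)
qed

text \<open>Symmetrization only decides which slots play the roles of \<open>(u\<^sub>1, v\<^sub>1)\<close> and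
  \<open>(u\<^sub>2, v\<^sub>2)\<close>; the indicators then require that these points be rightmost and
  highest.\<close>

lemma current_chaos_closed_form:
  fixes n :: "'d::finite \<Rightarrow> nat"
  assumes z: "\<And>c. c \<in> slots n \<Longrightarrow> z c \<in> unit_square"
  shows "current_chaos i j x n z
    = (\<Sum>(a, b)\<in>slot_pairs i j n. of_bool (upper_right n z a b) * dirac_product x (drop_orders i j n) (fst (z a)) (snd (z b)))
      / real (card (slot_pairs i j n))"
proof (cases "n i = 0")
  case True
  then show ?thesis by (simp add: current_chaos_def divergence_def card_slot_pairs)
next
  case False
  let ?n' = "n(i := n i - 1)"
  let ?G = "\<lambda>(u1, v1). divergence j (\<lambda>(u2, v2). (\<lambda>n z. dirac_chaos x (u1, v2) n z * indicator {0..u1} u2 * indicator {0..v2} v1))"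
  have "n i > 0" using False by simp
  define H where "H a b = of_bool (upper_right n z a b) * dirac_product x (drop_orders i j n) (fst (z a)) (snd (z b))" for a b
  define h where "h l' = (\<Sum>b\<in>{j} \<times> {..<n j} - {(i, l')}. H (i, l') b) / real (?n' j)" for l'
  have "symmetrize i (n i) (\<lambda>z. ?G (z (i, n i - 1)) ?n' z) z = (\<Sum>l<n i. h l) / real (n i)"
  proof (rule symmetrize_last)
    show "n i > 0" by fact
    fix \<sigma> assume \<sigma>: "\<sigma> permutes {..<n i}"
    let ?s = "permute_slots i \<sigma>"
    let ?w = "z \<circ> ?s"
    let ?a = "(i, \<sigma> (n i - 1))"
    have last: "?w (i, n i - 1) = z ?a" by (simp add: permute_slots_def)
    have a_in: "?a \<in> slots n"
      using permutes_in_image[OF \<sigma>, of "n i - 1"] False by (simp add: slots_def)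
    have sq: "?w c \<in> unit_square" if "c \<in> slots n" for c
      using z permute_slots_image[of \<sigma> n i, OF \<sigma>] that by (metis comp_apply imageI)
    have za: "0 \<le> snd (z ?a)" using z[OF a_in] by (auto simp: unit_square_def mem_Times_iff)
    have "?G (?w (i, n i - 1)) ?n' ?w = (\<Sum>l<?n' j. H ?a (?s (j, l))) / real (?n' j)"
    proof -
      have "?G (?w (i, n i - 1)) ?n' ?w = ?G (fst (z ?a), snd (z ?a)) ?n' ?w" unfolding last by simp
      also have "\<dots> = (\<Sum>l<?n' j. of_bool ((\<forall>c\<in>slots ?n'. fst (?w c) \<le> fst (z ?a) \<and> snd (?w c) \<le> snd (?w (j, l))) \<and> 0 \<le> snd (z ?a) \<and> snd (z ?a) \<le> snd (?w (j, l)))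
         * dirac_product x (?n'(j := ?n' j - 1)) (fst (z ?a)) (snd (?w (j, l)))) / real (?n' j)"
        unfolding prod.case using sq slots_drop_subset[of n i] by (intro inner_divergence) auto
      also have "\<dots> = (\<Sum>l<?n' j. H ?a (?s (j, l))) / real (?n' j)"
      proof (intro arg_cong2[where f = "(/)"] sum.cong refl)
        fix l assume "l \<in> {..<?n' j}"
        have "((\<forall>c\<in>slots ?n'. fst (?w c) \<le> fst (z ?a) \<and> snd (?w c) \<le> snd (?w (j, l))) \<and> 0 \<le> snd (z ?a) \<and> snd (z ?a) \<le> snd (?w (j, l)))
          \<longleftrightarrow> (\<forall>c\<in>slots n. fst (?w c) \<le> fst (z ?a) \<and> snd (?w c) \<le> snd (?w (j, l)))"
          using False za
          unfolding ball_slots_drop_last[of n i "\<lambda>c. fst (?w c) \<le> fst (z ?a) \<and> snd (?w c) \<le> snd (?w (j, l))", OF \<open>n i > 0\<close>] last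
          by auto
        also have "\<dots> \<longleftrightarrow> upper_right n z ?a (?s (j, l))"
          unfolding upper_right_def
          using ball_slots_permute[of \<sigma> n i "\<lambda>p. fst p \<le> fst (z ?a) \<and> snd p \<le> snd (?w (j, l))" z, OF \<sigma>] by simp
        finally show "of_bool ((\<forall>c\<in>slots ?n'. fst (?w c) \<le> fst (z ?a) \<and> snd (?w c) \<le> snd (?w (j, l))) \<and> 0 \<le> snd (z ?a) \<and> snd (z ?a) \<le> snd (?w (j, l)))
         * dirac_product x (?n'(j := ?n' j - 1)) (fst (z ?a)) (snd (?w (j, l))) = H ?a (?s (j, l))"
          by (simp add: H_def drop_orders_def Let_def)
      qed
      finally show ?thesis .
    qed
    also have "(\<Sum>l<?n' j. H ?a (?s (j, l))) = (\<Sum>b\<in>{j} \<times> {..<n j} - {?a}. H ?a b)"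
    proof -
      have inj: "inj_on (\<lambda>l. ?s (j, l)) {..<?n' j}"
        using injD[OF permutes_inj[OF \<sigma>]] by (intro inj_onI) (auto simp: permute_slots_def split: if_splits)
      have "(\<lambda>l. ?s (j, l)) ` {..<?n' j} = {j} \<times> {..<n j} - {?a}"
      proof (cases "i = j")
        case True
        have img: "\<sigma> ` {..<n i} = {..<n i}" using permutes_image[OF \<sigma>] .
        have "\<sigma> ` {..<n i - 1} = \<sigma> ` ({..<n i} - {n i - 1})" using False by (intro arg_cong[where f = "image \<sigma>"]) auto
        also have "\<dots> = {..<n i} - {\<sigma> (n i - 1)}"
          using img permutes_inj[OF \<sigma>] by (simp add: image_set_diff)
        finally have "\<sigma> ` {..<n i - 1} = {..<n i} - {\<sigma> (n i - 1)}" .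
        then have "Pair j ` \<sigma> ` {..<n i - 1} = {j} \<times> {..<n j} - {?a}" using True by auto
        then show ?thesis using True by (simp add: permute_slots_def image_image)
      next
        case False
        then show ?thesis by (auto simp: permute_slots_def)
      qed
      with inj show ?thesis by (metis (no_types, lifting) sum.reindex_cong)
    qed
    finally show "?G ((\<lambda>(k', l). if k' = i then z (i, \<sigma> l) else z (k', l)) (i, n i - 1)) ?n'
       (\<lambda>(k', l). if k' = i then z (i, \<sigma> l) else z (k', l)) = h (\<sigma> (n i - 1))"
      unfolding permute_slots_comp by (simp only: h_def)
  qed
  also have "(\<Sum>l<n i. h l) = (\<Sum>a\<in>{i} \<times> {..<n i}. \<Sum>b\<in>{j} \<times> {..<n j} - {a}. H a b) / real (?n' j)"
  proof -
    have "{i} \<times> {..<n i} = Pair i ` {..<n i}" by auto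
    then show ?thesis by (simp add: h_def sum_divide_distrib sum.reindex inj_on_def)
  qed
  also have "(\<Sum>a\<in>{i} \<times> {..<n i}. \<Sum>b\<in>{j} \<times> {..<n j} - {a}. H a b) = (\<Sum>(a, b)\<in>slot_pairs i j n. H a b)"
    unfolding slot_pairs_Sigma by (rule sum.Sigma) auto
  also have "(\<Sum>(a, b)\<in>slot_pairs i j n. H a b) / real (?n' j) / real (n i)
      = (\<Sum>(a, b)\<in>slot_pairs i j n. H a b) / real (card (slot_pairs i j n))"
    unfolding card_slot_pairs by (simp only: of_nat_mult divide_divide_eq_left mult.commute)
  finally have sym: "symmetrize i (n i) (\<lambda>z. ?G (z (i, n i - 1)) ?n' z) z
    = (\<Sum>(a, b)\<in>slot_pairs i j n. H a b) / real (card (slot_pairs i j n))" .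
  have unf: "divergence i F n = symmetrize i (n i) (\<lambda>z. F (z (i, n i - 1)) (n(i := n i - 1)) z)" for F
    using False by (simp add: divergence_def)
  show ?thesis unfolding current_chaos_def unf sym H_def ..
qed

section \<open>Fourier transform of the Dirac coefficients\<close>

text \<open>Up to a factor, the Hermite polynomials.\<close>

fun gauss_poly :: "nat \<Rightarrow> real poly" where
  "gauss_poly 0 = 1"
| "gauss_poly (Suc m) = pderiv (gauss_poly m) - [:0, 1:] * gauss_poly m"

definition gauss_deriv :: "nat \<Rightarrow> real \<Rightarrow> real" where
  "gauss_deriv m t = poly (gauss_poly m) t * exp (- t\<^sup>2 / 2)"

lemma gauss_deriv_has_derivative:
  "(gauss_deriv m has_real_derivative gauss_deriv (Suc m) t) (at t)"
  unfolding gauss_deriv_def[abs_def]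
  by (auto intro!: derivative_eq_intros poly_DERIV simp: algebra_simps power2_eq_square)

lemma gauss_deriv_eq: "(deriv ^^ m) (\<lambda>t. exp (- t\<^sup>2 / 2)) = gauss_deriv m"
proof (induction m)
  case 0
  then show ?case by (simp add: gauss_deriv_def fun_eq_iff)
next
  case (Suc m)
  have "deriv (gauss_deriv m) = gauss_deriv (Suc m)"
    by (rule ext) (rule DERIV_imp_deriv[OF gauss_deriv_has_derivative])
  with Suc show ?case by simp
qed

lemma monomial_gauss_integrable: "integrable lborel (\<lambda>t::real. t ^ i * exp (- t\<^sup>2 / 2))"
proof -
  have "integrable lborel (\<lambda>t. sqrt (2 * pi) * (std_normal_density t * t ^ i))"
    using integrable_normal_moment[of 1 0 i] by simp
  also have "(\<lambda>t. sqrt (2 * pi) * (std_normal_density t * t ^ i)) = (\<lambda>t. t ^ i * exp (- t\<^sup>2 / 2))"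
    by (simp add: normal_density_def fun_eq_iff)
  finally show ?thesis .
qed

lemma gauss_deriv_integrable: "integrable lborel (gauss_deriv m)"
proof -
  have "gauss_deriv m = (\<lambda>t. \<Sum>i\<le>degree (gauss_poly m). coeff (gauss_poly m) i * (t ^ i * exp (- t\<^sup>2 / 2)))"
    by (simp add: gauss_deriv_def fun_eq_iff poly_altdef sum_distrib_right mult.assoc)
  moreover have "integrable lborel (\<lambda>t. \<Sum>i\<le>degree (gauss_poly m). coeff (gauss_poly m) i * (t ^ i * exp (- t\<^sup>2 / 2)))"
    by (intro Bochner_Integration.integrable_sum integrable_mult_right monomial_gauss_integrable)
  ultimately show ?thesis by simp
qed

lemma monomial_gauss_tendsto_at_top: "((\<lambda>t::real. t ^ i * exp (- t\<^sup>2 / 2)) \<longlongrightarrow> 0) at_top"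
proof (rule Lim_null_comparison)
  show "((\<lambda>t::real. exp (1/2) * (t ^ i / exp t)) \<longlongrightarrow> 0) at_top"
    using tendsto_mult_right_zero[OF tendsto_power_div_exp_0[of i]] by simp
  show "\<forall>\<^sub>F t in at_top. norm (t ^ i * exp (- t\<^sup>2 / 2)) \<le> exp (1/2) * (t ^ i / exp t)"
    using eventually_ge_at_top[of "0::real"]
  proof eventually_elim
    case (elim t)
    have "0 \<le> (t - 1)\<^sup>2" by simp
    then have "- t\<^sup>2 / 2 \<le> 1 / 2 - t" by (simp add: power2_diff)
    then have "exp (- t\<^sup>2 / 2) \<le> exp (1 / 2 - t)" by simp
    also have "\<dots> = exp (1/2) / exp t" by (rule exp_diff)
    finally have "t ^ i * exp (- t\<^sup>2 / 2) \<le> t ^ i * (exp (1/2) / exp t)"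
      using elim by (intro mult_left_mono) auto
    with elim show ?case by (simp add: mult.commute)
  qed
qed

lemma gauss_deriv_tendsto_at_top: "(gauss_deriv m \<longlongrightarrow> 0) at_top"
proof -
  have "gauss_deriv m = (\<lambda>t. \<Sum>i\<le>degree (gauss_poly m). coeff (gauss_poly m) i * (t ^ i * exp (- t\<^sup>2 / 2)))"
    by (simp add: gauss_deriv_def fun_eq_iff poly_altdef sum_distrib_right mult.assoc)
  moreover have "((\<lambda>t. \<Sum>i\<le>degree (gauss_poly m). coeff (gauss_poly m) i * (t ^ i * exp (- t\<^sup>2 / 2))) \<longlongrightarrow> 0) at_top"
    by (intro tendsto_null_sum tendsto_mult_right_zero monomial_gauss_tendsto_at_top)
  ultimately show ?thesis by simp
qed

lemma gauss_deriv_tendsto_at_bot: "(gauss_deriv m \<longlongrightarrow> 0) at_bot"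
proof -
  have eq: "(\<lambda>t. gauss_deriv m (- t)) = (\<lambda>t. \<Sum>i\<le>degree (gauss_poly m). (coeff (gauss_poly m) i * (-1) ^ i) * (t ^ i * exp (- t\<^sup>2 / 2)))"
  proof
    fix t :: real
    have "(- t) ^ i = (-1) ^ i * t ^ i" for i by (rule power_minus)
    then show "gauss_deriv m (- t) = (\<Sum>i\<le>degree (gauss_poly m). (coeff (gauss_poly m) i * (-1) ^ i) * (t ^ i * exp (- t\<^sup>2 / 2)))"
      by (simp add: gauss_deriv_def poly_altdef sum_distrib_right mult.assoc)
  qed
  have "((\<lambda>t. gauss_deriv m (- t)) \<longlongrightarrow> 0) at_top" unfolding eq
    by (intro tendsto_null_sum tendsto_mult_right_zero monomial_gauss_tendsto_at_top)
  then show ?thesis by (simp add: filterlim_at_bot_mirror)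
qed

definition gauss_fourier :: "nat \<Rightarrow> real \<Rightarrow> complex" where
  "gauss_fourier m \<eta> = (CLINT t|lborel. exp (- \<i> * of_real (\<eta> * t)) * of_real (gauss_deriv m t))"

lemma gauss_deriv_measurable[measurable]: "gauss_deriv m \<in> borel_measurable borel"
  using borel_measurable_integrable[OF gauss_deriv_integrable] by simp

lemma gauss_fourier_integrable:
  "integrable lborel (\<lambda>t. exp (- \<i> * of_real (\<eta> * t)) * of_real (gauss_deriv m t) :: complex)"
proof (rule Bochner_Integration.integrable_bound[OF gauss_deriv_integrable[of m]])
  show "AE t in lborel. norm (exp (- \<i> * of_real (\<eta> * t)) * of_real (gauss_deriv m t) :: complex) \<le> norm (gauss_deriv m t)"
    by (simp add: norm_mult)
qed measurable

text \<open>Integration by parts, in the form that the derivative of \<open>exp (- \<i> \<eta> t)\<close> times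
  \<open>gauss_deriv m t\<close> has integral zero.\<close>

lemma gauss_fourier_Suc: "gauss_fourier (Suc m) \<eta> = (\<i> * of_real \<eta>) * gauss_fourier m \<eta>"
proof -
  let ?e = "\<lambda>t. exp (- \<i> * of_real (\<eta> * t)) :: complex"
  let ?F = "\<lambda>t. ?e t * of_real (gauss_deriv m t)"
  let ?f = "\<lambda>t. ?e t * of_real (gauss_deriv (Suc m) t) - (\<i> * of_real \<eta>) * (?e t * of_real (gauss_deriv m t))"
  have int_f: "integrable lborel ?f"
    by (intro Bochner_Integration.integrable_diff integrable_mult_right gauss_fourier_integrable)
  have deriv: "(?F has_vector_derivative ?f t) (at t)" for t
  proof -
    have e: "(?e has_vector_derivative (- \<i> * of_real \<eta>) * ?e t) (at t)"
    proof -
      have "((\<lambda>w. exp (- \<i> * (of_real \<eta> * w))) has_field_derivative (- \<i> * of_real \<eta>) * exp (- \<i> * (of_real \<eta> * of_real t))) (at (of_real t))"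
        by (auto intro!: derivative_eq_intros)
      from has_vector_derivative_real_field[OF this] show ?thesis by simp
    qed
    have g: "((\<lambda>t. of_real (gauss_deriv m t) :: complex) has_vector_derivative of_real (gauss_deriv (Suc m) t)) (at t)"
      by (intro has_vector_derivative_of_real gauss_deriv_has_derivative)
    show ?thesis using has_vector_derivative_mult[OF e g] by (simp add: algebra_simps)
  qed
  have lim0: "(?F \<longlongrightarrow> 0) F" if "(gauss_deriv m \<longlongrightarrow> 0) F" for F
    by (rule Lim_null_comparison[OF _ tendsto_rabs_zero[OF that]]) (simp add: norm_mult)
  have "(LBINT t=-\<infinity>..\<infinity>. ?f t) = 0 - 0"
  proof (rule interval_integral_FTC_integrable)
    show "set_integrable lborel (einterval (- \<infinity>) \<infinity>) ?f"
      using int_f by (simp add: set_integrable_def)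
    show "((?F \<circ> real_of_ereal) \<longlongrightarrow> 0) (at_right (- \<infinity>))"
      using lim0[OF gauss_deriv_tendsto_at_bot] by (simp only: ereal_tendsto_simps)
    show "((?F \<circ> real_of_ereal) \<longlongrightarrow> 0) (at_left \<infinity>)"
      using lim0[OF gauss_deriv_tendsto_at_top] by (simp only: ereal_tendsto_simps)
    show "isCont ?f t" for t
    proof -
      have "isCont (gauss_deriv k) t" for k by (rule DERIV_isCont[OF gauss_deriv_has_derivative])
      then show ?thesis by (intro continuous_intros) auto
    qed
    show "(?F has_vector_derivative ?f t) (at t)" for t by (rule deriv)
  qed simp
  then have "(CLINT t|lborel. ?f t) = 0"
    by (simp add: interval_lebesgue_integral_def set_lebesgue_integral_def)
  moreover have "(CLINT t|lborel. ?f t) = gauss_fourier (Suc m) \<eta> - (\<i> * of_real \<eta>) * gauss_fourier m \<eta>"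
    unfolding gauss_fourier_def integral_mult_right_zero[symmetric]
    by (rule Bochner_Integration.integral_diff) (intro integrable_mult_right gauss_fourier_integrable)+
  ultimately show ?thesis by simp
qed

lemma gauss_fourier_0: "gauss_fourier 0 \<eta> = of_real (sqrt (2 * pi) * exp (- \<eta>\<^sup>2 / 2))"
proof -
  have "of_real (exp (- (- \<eta>)\<^sup>2 / 2)) = char std_normal_distribution (- \<eta>)"
    by (simp add: char_std_normal_distribution)
  also have "\<dots> = (CLINT t|lborel. std_normal_density t *\<^sub>R iexp (- \<eta> * t))"
    unfolding char_def by (rule integral_density) (auto simp: normal_density_nonneg)
  also have "\<dots> = (CLINT t|lborel. of_real (1 / sqrt (2 * pi)) * (exp (- \<i> * of_real (\<eta> * t)) * of_real (gauss_deriv 0 t)))"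
    by (intro Bochner_Integration.integral_cong refl)
       (simp add: normal_density_def gauss_deriv_def scaleR_conv_of_real mult_ac)
  also have "\<dots> = of_real (1 / sqrt (2 * pi)) * gauss_fourier 0 \<eta>"
    unfolding gauss_fourier_def by (rule integral_mult_right_zero)
  finally have "complex_of_real (exp (- \<eta>\<^sup>2 / 2)) = of_real (1 / sqrt (2 * pi)) * gauss_fourier 0 \<eta>" by simp
  then have "of_real (sqrt (2 * pi)) * complex_of_real (exp (- \<eta>\<^sup>2 / 2)) = gauss_fourier 0 \<eta>"
    by (simp add: field_simps flip: of_real_mult)
  then show ?thesis by simp
qed

lemma gauss_fourier_eq: "gauss_fourier m \<eta> = (\<i> * of_real \<eta>) ^ m * of_real (sqrt (2 * pi) * exp (- \<eta>\<^sup>2 / 2))"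
  by (induction m) (simp_all add: gauss_fourier_0 gauss_fourier_Suc)

lemma dirac_coeff_eq:
  assumes "u * v > 0"
  shows "dirac_coeff m x u v = ((u * v) powr (- real m / 2) * ((-1) ^ m / (fact m * sqrt (2 * pi * (u * v))))) * gauss_deriv m (x / sqrt (u * v))"
proof -
  have "x\<^sup>2 / (2 * (u * v)) = (x / sqrt (u * v))\<^sup>2 / 2"
    using assms by (simp add: power_divide)
  then have "exp (- x\<^sup>2 / (2 * (u * v))) * exp ((x / sqrt (u * v))\<^sup>2 / 2) = 1"
    by (simp flip: exp_add)
  then show ?thesis
    unfolding dirac_coeff_def heat_kernel_def hermite_def gauss_deriv_eq
    by (simp add: field_simps)
qed

text \<open>The case distinction reflects that \<open>dirac_coeff\<close> vanishes on the axes, where the heat kernel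
  degenerates.\<close>

definition dirac_fourier :: "nat \<Rightarrow> real \<Rightarrow> real \<Rightarrow> real \<Rightarrow> complex" where
  "dirac_fourier m \<eta> u v = (if u * v > 0 then (- \<i> * of_real \<eta>) ^ m / fact m * of_real (exp (- (u * v) * \<eta>\<^sup>2 / 2)) else 0)"

lemma dirac_coeff_fourier:
  assumes uv: "u \<ge> 0" "v \<ge> 0"
  shows "integrable lborel (\<lambda>x. exp (- \<i> * of_real (\<eta> * x)) * of_real (dirac_coeff m x u v) :: complex)"
    and "(CLINT x|lborel. exp (- \<i> * of_real (\<eta> * x)) * of_real (dirac_coeff m x u v)) = dirac_fourier m \<eta> u v"
proof -
  have "integrable lborel (\<lambda>x. exp (- \<i> * of_real (\<eta> * x)) * of_real (dirac_coeff m x u v) :: complex) \<and>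
    (CLINT x|lborel. exp (- \<i> * of_real (\<eta> * x)) * of_real (dirac_coeff m x u v)) = dirac_fourier m \<eta> u v"
  proof (cases "u * v > 0")
    case False
    then have "u * v = 0" using uv by (metis mult_nonneg_nonneg less_eq_real_def)
    then have "dirac_coeff m x u v = 0" for x by (simp add: dirac_coeff_def)
    with False show ?thesis by (simp add: dirac_fourier_def)
  next
    case True
    define s where "s = sqrt (u * v)"
    have s: "s > 0" "s\<^sup>2 = u * v" using True by (auto simp: s_def)
    define C where "C = (u * v) powr (- real m / 2) * ((-1) ^ m / (fact m * sqrt (2 * pi * (u * v))))"
    let ?g = "\<lambda>t. exp (- \<i> * of_real ((\<eta> * s) * t)) * of_real (gauss_deriv m t) :: complex"
    have eq: "exp (- \<i> * of_real (\<eta> * x)) * of_real (dirac_coeff m x u v) = of_real C * ?g (0 + (1 / s) * x)" for x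
      unfolding dirac_coeff_eq[OF True] C_def[symmetric] s_def[symmetric] using s by (simp add: mult_ac)
    have "integrable lborel (\<lambda>x. ?g (0 + (1 / s) * x))"
      using s by (intro lborel_integrable_real_affine gauss_fourier_integrable) auto
    then have int: "integrable lborel (\<lambda>x. of_real C * ?g (0 + (1 / s) * x))" by (rule integrable_mult_right)
    have "gauss_fourier m (\<eta> * s) = \<bar>1 / s\<bar> *\<^sub>R (CLINT x|lborel. ?g (0 + (1 / s) * x))"
      unfolding gauss_fourier_def using s by (intro lborel_integral_real_affine) auto
    then have aff: "(CLINT x|lborel. ?g (0 + (1 / s) * x)) = of_real s * gauss_fourier m (\<eta> * s)"
      using s by (simp add: scaleR_conv_of_real field_simps)
    have "(CLINT x|lborel. of_real C * ?g (0 + (1 / s) * x)) = of_real C * (of_real s * gauss_fourier m (\<eta> * s))"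
      unfolding aff[symmetric] by (rule integral_mult_right_zero)
    also have "\<dots> = (of_real C * of_real s * of_real (sqrt (2 * pi)) * of_real (s ^ m)) * ((\<i> * of_real \<eta>) ^ m * of_real (exp (- (u * v) * \<eta>\<^sup>2 / 2)))"
      unfolding gauss_fourier_eq by (simp add: power_mult_distrib s(2) mult_ac)
    also have "of_real C * of_real s * of_real (sqrt (2 * pi)) * of_real (s ^ m) = complex_of_real ((-1) ^ m / fact m)"
    proof -
      have "(u * v) powr (- real m / 2) = 1 / s ^ m"
      proof -
        have "(u * v) powr (- real m / 2) = (s powr 2) powr (- real m / 2)" using s by simp
        also have "\<dots> = s powr (- real m)" by (simp add: powr_powr)
        also have "\<dots> = 1 / s ^ m" using s by (simp add: powr_minus_divide powr_realpow)
        finally show ?thesis .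
      qed
      moreover have "sqrt (2 * pi * (u * v)) = sqrt (2 * pi) * s" by (simp add: s_def real_sqrt_mult)
      ultimately have "C * s * sqrt (2 * pi) * s ^ m = (-1) ^ m / fact m"
        using s by (simp add: C_def field_simps)
      then show ?thesis by (simp only: of_real_mult[symmetric])
    qed
    also have "complex_of_real ((-1) ^ m / fact m) * ((\<i> * of_real \<eta>) ^ m * of_real (exp (- (u * v) * \<eta>\<^sup>2 / 2))) = dirac_fourier m \<eta> u v"
    proof -
      have "(- \<i> * of_real \<eta> :: complex) ^ m = (-1) ^ m * (\<i> * of_real \<eta>) ^ m"
        by (metis mult_minus_left power_minus)
      then show ?thesis using True by (simp add: dirac_fourier_def)
    qed
    finally show ?thesis unfolding eq using int by blast
  qed
  then show "integrable lborel (\<lambda>x. exp (- \<i> * of_real (\<eta> * x)) * of_real (dirac_coeff m x u v) :: complex)"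
    "(CLINT x|lborel. exp (- \<i> * of_real (\<eta> * x)) * of_real (dirac_coeff m x u v)) = dirac_fourier m \<eta> u v" by auto
qed

interpretation lborel_product: product_sigma_finite "\<lambda>_. lborel :: real measure"
  by standard

lemma vec_lambda_measurable: "(\<lambda>f. \<chi> k. f k) \<in> borel_measurable (PiM (UNIV :: 'd::finite set) (\<lambda>_. lborel :: real measure))"
proof (subst borel_measurable_euclidean_space, rule ballI)
  fix b :: "real ^ 'd" assume "b \<in> Basis"
  then obtain k where b: "b = axis k 1" by (auto simp: Basis_vec_def)
  have "(\<lambda>f. f k) \<in> borel_measurable (PiM (UNIV :: 'd set) (\<lambda>_. lborel :: real measure))"
    using measurable_component_singleton[of k UNIV "\<lambda>_. lborel :: real measure"] by simp
  then show "(\<lambda>f. (\<chi> k. f k) \<bullet> b) \<in> borel_measurable (PiM (UNIV :: 'd set) (\<lambda>_. lborel :: real measure))"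
    by (simp add: b inner_axis)
qed

lemma lborel_vec_eq_PiM:
  "(lborel :: (real ^ 'd::finite) measure) = distr (PiM UNIV (\<lambda>_. lborel)) borel (\<lambda>f. \<chi> k. f k)"
proof (rule lborel_eqI)
  fix l u :: "real ^ 'd" assume lu: "\<And>b. b \<in> Basis \<Longrightarrow> l \<bullet> b \<le> u \<bullet> b"
  have le: "l $ k \<le> u $ k" for k using lu[of "axis k 1"] by (simp add: inner_axis axis_in_Basis_iff)
  have "(\<lambda>f. \<chi> k. f k) -` box l u \<inter> space (PiM UNIV (\<lambda>_. lborel)) = PiE UNIV (\<lambda>k. {l $ k<..<u $ k})"
    by (auto simp: space_PiM mem_box_cart PiE_iff)
  then have "emeasure (distr (PiM UNIV (\<lambda>_. lborel)) borel (\<lambda>f. \<chi> k. f k)) (box l u)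
      = emeasure (PiM UNIV (\<lambda>_. lborel)) (PiE UNIV (\<lambda>k. {l $ k<..<u $ k}))"
    by (subst emeasure_distr[OF vec_lambda_measurable]) auto
  also have "\<dots> = (\<Prod>k\<in>UNIV. ennreal (u $ k - l $ k))"
    using le by (subst lborel_product.emeasure_PiM) auto
  also have "\<dots> = ennreal (\<Prod>k\<in>UNIV. u $ k - l $ k)"
    using le by (intro prod_ennreal) auto
  also have "(\<Prod>k\<in>UNIV. u $ k - l $ k) = (\<Prod>b\<in>Basis. (u - l) \<bullet> b)"
  proof -
    have B: "(Basis :: (real ^ 'd) set) = (\<lambda>k. axis k 1) ` UNIV" by (auto simp: Basis_vec_def)
    have "inj (\<lambda>k :: 'd. axis k (1 :: real))" by (auto simp: inj_on_def axis_eq_axis)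
    then show ?thesis unfolding B by (subst prod.reindex) (simp_all add: inner_axis)
  qed
  finally show "emeasure (distr (PiM UNIV (\<lambda>_. lborel)) borel (\<lambda>f. \<chi> k. f k)) (box l u) = (\<Prod>b\<in>Basis. (u - l) \<bullet> b)" .
qed simp

lemma fourier_product:
  fixes g :: "'d::finite \<Rightarrow> real \<Rightarrow> complex" and y :: "real ^ 'd"
  assumes int: "\<And>k. integrable lborel (\<lambda>t. exp (- \<i> * of_real (y $ k * t)) * g k t)"
    and g[measurable]: "\<And>k. g k \<in> borel_measurable borel"
  shows "integrable lborel (\<lambda>x. exp (- \<i> * of_real (y \<bullet> x)) * (\<Prod>k\<in>UNIV. g k (x $ k)))"
    and "fourier (\<lambda>x. \<Prod>k\<in>UNIV. g k (x $ k)) y = (\<Prod>k\<in>UNIV. CLINT t|lborel. exp (- \<i> * of_real (y $ k * t)) * g k t)"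
proof -
  let ?P = "PiM (UNIV :: 'd set) (\<lambda>_. lborel :: real measure)"
  let ?G = "\<lambda>x. exp (- \<i> * of_real (y \<bullet> x)) * (\<Prod>k\<in>UNIV. g k (x $ k))"
  have [measurable]: "(\<lambda>x :: real ^ 'd. x $ k) \<in> borel_measurable borel" for k
    by (intro borel_measurable_continuous_onI continuous_intros)
  have meas: "?G \<in> borel_measurable borel" by measurable
  have eq: "?G (\<chi> k. f k) = (\<Prod>k\<in>UNIV. exp (- \<i> * of_real (y $ k * f k)) * g k (f k))" for f
  proof -
    have "exp (- \<i> * of_real (y \<bullet> (\<chi> k. f k))) = (\<Prod>k\<in>UNIV. exp (- \<i> * of_real (y $ k * f k)))"
      by (simp add: inner_vec_def sum_distrib_left exp_sum flip: sum_negf)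
    then show ?thesis by (simp add: prod.distrib)
  qed
  have "integrable ?P (\<lambda>f. \<Prod>k\<in>UNIV. exp (- \<i> * of_real (y $ k * f k)) * g k (f k))"
    by (rule lborel_product.product_integrable_prod[OF finite int])
  then show "integrable lborel ?G"
    unfolding lborel_vec_eq_PiM by (subst integrable_distr_eq[OF vec_lambda_measurable meas]) (simp only: eq)
  have "fourier (\<lambda>x. \<Prod>k\<in>UNIV. g k (x $ k)) y = (CLINT f|?P. ?G (\<chi> k. f k))"
    unfolding fourier_def by (subst lborel_vec_eq_PiM, rule integral_distr[OF vec_lambda_measurable meas])
  also have "\<dots> = (\<Prod>k\<in>UNIV. CLINT t|lborel. exp (- \<i> * of_real (y $ k * t)) * g k t)"
    unfolding eq by (rule lborel_product.product_integral_prod[OF finite int])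
  finally show "fourier (\<lambda>x. \<Prod>k\<in>UNIV. g k (x $ k)) y = (\<Prod>k\<in>UNIV. CLINT t|lborel. exp (- \<i> * of_real (y $ k * t)) * g k t)" .
qed

section \<open>The energy of the Fourier transformed current\<close>

lemma dirac_coeff_measurable:
  assumes "u \<ge> 0" "v \<ge> 0"
  shows "(\<lambda>x. dirac_coeff m x u v) \<in> borel_measurable borel"
proof (cases "u * v > 0")
  case True
  show ?thesis unfolding dirac_coeff_eq[OF True] by measurable
next
  case False
  then have "u * v = 0" using mult_nonneg_nonneg[OF assms] by linarith
  then have "dirac_coeff m x u v = 0" for x by (simp add: dirac_coeff_def)
  then show ?thesis by simp
qed

text \<open>The Fourier transform of \<open>dirac_product\<close> depends on the rectangle only through its area
  \<open>s\<close>.\<close>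

definition current_weight :: "('d::finite \<Rightarrow> nat) \<Rightarrow> real ^ 'd \<Rightarrow> real \<Rightarrow> complex" where
  "current_weight m y s = (if s > 0 then (\<Prod>k\<in>UNIV. (- \<i> * of_real (y $ k)) ^ m k / fact (m k)) * of_real (exp (- s * (norm y)\<^sup>2 / 2)) else 0)"

definition corner_kernel :: "'d \<Rightarrow> 'd \<Rightarrow> real ^ 'd \<Rightarrow> ('d::finite \<Rightarrow> nat) \<Rightarrow> 'd points \<Rightarrow> complex" where
  "corner_kernel i j y n z =
    (\<Sum>(a, b)\<in>slot_pairs i j n. of_bool (upper_right n z a b) * current_weight (drop_orders i j n) y (fst (z a) * snd (z b)))
      / of_nat (card (slot_pairs i j n))"

lemma norm_vec_sq: "(norm (y :: real ^ 'd::finite))\<^sup>2 = (\<Sum>k\<in>UNIV. (y $ k)\<^sup>2)"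
  unfolding power2_norm_eq_inner inner_vec_def by (simp add: power2_eq_square)

lemma prod_dirac_fourier:
  fixes y :: "real ^ 'd::finite"
  shows "(\<Prod>k\<in>UNIV. dirac_fourier (m k) (y $ k) u v) = current_weight m y (u * v)"
proof (cases "u * v > 0")
  case True
  have "(\<Prod>k\<in>UNIV. complex_of_real (exp (- (u * v) * (y $ k)\<^sup>2 / 2))) = of_real (exp (\<Sum>k\<in>UNIV. - (u * v) * (y $ k)\<^sup>2 / 2))"
    by (simp add: exp_sum)
  also have "(\<Sum>k\<in>UNIV. - (u * v) * (y $ k)\<^sup>2 / 2) = - (u * v) * (norm y)\<^sup>2 / 2"
    by (simp add: norm_vec_sq sum_distrib_left sum_divide_distrib sum_negf)
  finally have e: "(\<Prod>k\<in>UNIV. complex_of_real (exp (- (u * v) * (y $ k)\<^sup>2 / 2))) = of_real (exp (- (u * v) * (norm y)\<^sup>2 / 2))" .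
  show ?thesis
    unfolding dirac_fourier_def current_weight_def if_P[OF True] prod.distrib e ..
qed (simp add: dirac_fourier_def current_weight_def)

lemma slot_pairs_in_slots:
  "(a, b) \<in> slot_pairs i j n \<Longrightarrow> a \<in> slots n \<and> b \<in> slots n \<and> a \<noteq> b"
  by (auto simp: slot_pairs_def slots_def)

lemma fourier_dirac_product:
  fixes y :: "real ^ 'd::finite"
  assumes "u \<ge> 0" "v \<ge> 0"
  shows "integrable lborel (\<lambda>x. exp (- \<i> * of_real (y \<bullet> x)) * of_real (dirac_product x m u v))"
    and "(CLINT x|lborel. exp (- \<i> * of_real (y \<bullet> x)) * of_real (dirac_product x m u v)) = current_weight m y (u * v)"
proof -
  have eq: "complex_of_real (dirac_product x m u v) = (\<Prod>k\<in>UNIV. complex_of_real (dirac_coeff (m k) (x $ k) u v))" for x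
    by (simp add: dirac_product_def)
  have meas: "(\<lambda>t. complex_of_real (dirac_coeff (m k) t u v)) \<in> borel_measurable borel" for k
    using dirac_coeff_measurable[OF assms] by simp
  note int = dirac_coeff_fourier(1)[OF assms]
  show "integrable lborel (\<lambda>x. exp (- \<i> * of_real (y \<bullet> x)) * of_real (dirac_product x m u v))"
    unfolding eq by (rule fourier_product(1)[where g = "\<lambda>k t. complex_of_real (dirac_coeff (m k) t u v)", OF int meas])
  have "(CLINT x|lborel. exp (- \<i> * of_real (y \<bullet> x)) * of_real (dirac_product x m u v))
      = (\<Prod>k\<in>UNIV. CLINT t|lborel. exp (- \<i> * of_real (y $ k * t)) * complex_of_real (dirac_coeff (m k) t u v))"
    unfolding eq fourier_def[symmetric]
    by (rule fourier_product(2)[where g = "\<lambda>k t. complex_of_real (dirac_coeff (m k) t u v)", OF int meas])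
  also have "\<dots> = current_weight m y (u * v)"
    unfolding dirac_coeff_fourier(2)[OF assms] by (rule prod_dirac_fourier)
  finally show "(CLINT x|lborel. exp (- \<i> * of_real (y \<bullet> x)) * of_real (dirac_product x m u v)) = current_weight m y (u * v)" .
qed

lemma fourier_current:
  fixes n :: "'d::finite \<Rightarrow> nat"
  assumes z: "z \<in> space (points_measure n)"
  shows "fourier_chaos (current_chaos i j) y n z = corner_kernel i j y n z"
proof -
  let ?P = "slot_pairs i j n" and ?m = "drop_orders i j n"
  let ?e = "\<lambda>x. exp (- \<i> * of_real (y \<bullet> x)) :: complex"
  have sq: "z c \<in> unit_square" if "c \<in> slots n" for c
    using z that by (auto simp: space_points_measure)
  have pos: "fst (z c) \<ge> 0" "snd (z c) \<ge> 0" if "c \<in> slots n" for c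
    using sq[OF that] by (auto simp: unit_square_def mem_Times_iff)
  have int: "integrable lborel (\<lambda>x. ?e x * of_real (dirac_product x ?m (fst (z (fst p))) (snd (z (snd p)))))"
    and val: "(CLINT x|lborel. ?e x * of_real (dirac_product x ?m (fst (z (fst p))) (snd (z (snd p)))))
       = current_weight ?m y (fst (z (fst p)) * snd (z (snd p)))" if "p \<in> ?P" for p
    using fourier_dirac_product[OF pos(1) pos(2), of "fst p" "snd p"] slot_pairs_in_slots[of "fst p" "snd p" i j n] that by auto
  have "fourier_chaos (current_chaos i j) y n z
      = (CLINT x|lborel. (\<Sum>p\<in>?P. of_bool (upper_right n z (fst p) (snd p)) * (?e x * of_real (dirac_product x ?m (fst (z (fst p))) (snd (z (snd p)))))) / of_nat (card ?P))"
    unfolding fourier_chaos_def fourier_def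
  proof (intro Bochner_Integration.integral_cong refl)
    fix x
    have "current_chaos i j x n z = (\<Sum>p\<in>?P. of_bool (upper_right n z (fst p) (snd p)) * dirac_product x ?m (fst (z (fst p))) (snd (z (snd p)))) / real (card ?P)"
      by (subst current_chaos_closed_form) (rule sq, assumption, simp only: case_prod_unfold)
    then have cc: "complex_of_real (current_chaos i j x n z) = (\<Sum>p\<in>?P. of_bool (upper_right n z (fst p) (snd p)) * of_real (dirac_product x ?m (fst (z (fst p))) (snd (z (snd p))))) / of_nat (card ?P)"
      by simp
    show "?e x * of_real (current_chaos i j x n z) = (\<Sum>p\<in>?P. of_bool (upper_right n z (fst p) (snd p)) * (?e x * of_real (dirac_product x ?m (fst (z (fst p))) (snd (z (snd p)))))) / of_nat (card ?P)"
      unfolding cc by (simp only: sum_distrib_left times_divide_eq_right mult.left_commute)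
  qed
  also have "\<dots> = (\<Sum>p\<in>?P. of_bool (upper_right n z (fst p) (snd p)) * current_weight ?m y (fst (z (fst p)) * snd (z (snd p)))) / of_nat (card ?P)"
    unfolding integral_divide_zero
    by (subst Bochner_Integration.integral_sum, rule integrable_mult_right, rule int, assumption,
        simp only: integral_mult_right_zero val cong: sum.cong)
  also have "\<dots> = corner_kernel i j y n z" by (simp add: corner_kernel_def case_prod_beta)
  finally show ?thesis .
qed

text \<open>Distinct coordinates make the rightmost and the highest point unique, and they prevent two points from
  being rounded to the same corner of a fine mesh.\<close>

definition generic_points :: "('d::finite \<Rightarrow> nat) \<Rightarrow> 'd points set" where
  "generic_points n = {z. (\<forall>a\<in>slots n. 0 < fst (z a) \<and> 0 < snd (z a)) \<and>
     (\<forall>a\<in>slots n. \<forall>b\<in>slots n. a \<noteq> b \<longrightarrow> fst (z a) \<noteq> fst (z b) \<and> snd (z a) \<noteq> snd (z b))}"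

lemma AE_square_coordinate:
  "AE p in square_measure. fst p \<noteq> c" "AE p in square_measure. snd p \<noteq> c"
proof -
  have "{c} \<times> UNIV \<in> null_sets (lborel \<Otimes>\<^sub>M lborel :: (real \<times> real) measure)"
    by (auto simp: null_sets_def lborel.emeasure_pair_measure_Times)
  then have "AE p in lborel. p \<notin> {c} \<times> (UNIV :: real set)"
    unfolding lborel_prod by (rule AE_not_in)
  then show "AE p in square_measure. fst p \<noteq> c"
    by (subst AE_restrict_space_iff) (auto elim!: eventually_mono)
  have "UNIV \<times> {c} \<in> null_sets (lborel \<Otimes>\<^sub>M lborel :: (real \<times> real) measure)"
    by (auto simp: null_sets_def lborel.emeasure_pair_measure_Times)
  then have "AE p in lborel. p \<notin> (UNIV :: real set) \<times> {c}"
    unfolding lborel_prod by (rule AE_not_in)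
  then show "AE p in square_measure. snd p \<noteq> c"
    by (subst AE_restrict_space_iff) (auto elim!: eventually_mono)
qed

lemma fst_borel[measurable]: "(fst :: real \<times> real \<Rightarrow> real) \<in> borel_measurable borel"
  and snd_borel[measurable]: "(snd :: real \<times> real \<Rightarrow> real) \<in> borel_measurable borel"
  by (auto intro!: borel_measurable_continuous_onI continuous_intros)

lemma coordinate_fst_measurable[measurable (raw)]: "a \<in> slots n \<Longrightarrow> (\<lambda>z. fst (z a)) \<in> borel_measurable (points_measure n)"
  and coordinate_snd_measurable[measurable (raw)]: "a \<in> slots n \<Longrightarrow> (\<lambda>z. snd (z a)) \<in> borel_measurable (points_measure n)"
  using measurable_compose[OF coordinate_measurable fst_borel] measurable_compose[OF coordinate_measurable snd_borel] by auto

text \<open>Given all other points, \<open>z a\<close> must avoid a line.\<close>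

lemma AE_distinct_coordinates:
  fixes n :: "'d::finite \<Rightarrow> nat" and \<pi> :: "real \<times> real \<Rightarrow> real"
  assumes \<pi>[measurable]: "\<pi> \<in> borel_measurable borel" and null: "\<And>c. AE p in square_measure. \<pi> p \<noteq> c"
    and ab: "a \<in> slots n" "b \<in> slots n" "a \<noteq> b"
  shows "AE z in points_measure n. \<pi> (z a) \<noteq> \<pi> (z b)"
proof -
  define I where "I = slots n - {a}"
  have I: "slots n = insert a I" "a \<notin> I" "finite I" "b \<in> I" using ab by (auto simp: I_def)
  let ?f = "\<lambda>z. indicator {0} (\<pi> (z a) - \<pi> (z b)) :: ennreal"
  have m: "\<And>c. c \<in> slots n \<Longrightarrow> (\<lambda>z. \<pi> (z c)) \<in> borel_measurable (points_measure n)"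
    by (rule measurable_compose[OF coordinate_measurable \<pi>])
  then have f: "?f \<in> borel_measurable (points_measure n)"
    by (intro measurable_compose[OF borel_measurable_diff borel_measurable_indicator] m ab) auto
  have "(\<integral>\<^sup>+ z. ?f z \<partial>points_measure n) = (\<integral>\<^sup>+ x. (\<integral>\<^sup>+ p. ?f (x(a := p)) \<partial>square_measure) \<partial>PiM I (\<lambda>_. square_measure))"
    unfolding points_measure_def I(1)
    by (rule points.product_nn_integral_insert[OF I(3,2)]) (use f in \<open>simp add: points_measure_def I(1)\<close>)
  also have "\<dots> = (\<integral>\<^sup>+ x. 0 \<partial>PiM I (\<lambda>_. square_measure))"
  proof (intro nn_integral_cong)
    fix x
    have "(\<integral>\<^sup>+ p. ?f (x(a := p)) \<partial>square_measure) = (\<integral>\<^sup>+ p. 0 \<partial>square_measure)"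
      using null[of "\<pi> (x b)"] ab by (intro nn_integral_cong_AE) (auto elim!: eventually_mono)
    then show "(\<integral>\<^sup>+ p. ?f (x(a := p)) \<partial>square_measure) = 0" by simp
  qed
  also have "\<dots> = 0" by simp
  finally have "AE z in points_measure n. ?f z = 0"
    unfolding nn_integral_0_iff_AE[OF f] .
  then show ?thesis by eventually_elim (auto simp: indicator_def split: if_splits)
qed

lemma AE_generic_points: "AE z in points_measure (n :: 'd::finite \<Rightarrow> nat). z \<in> generic_points n"
proof -
  have pos: "AE z in points_measure n. 0 < fst (z a) \<and> 0 < snd (z a)" if a: "a \<in> slots n" for a
  proof -
    have "AE p in square_measure. 0 < fst p \<and> 0 < snd p"
      using AE_square_coordinate(1)[of 0] AE_square_coordinate(2)[of 0] AE_space
      by eventually_elim (auto simp: space_restrict_space unit_square_def less_le)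
    then show ?thesis unfolding points_measure_def
      by (rule AE_PiM_component[OF prob_space_square_measure a])
  qed
  have "AE z in points_measure n. \<forall>a\<in>slots n. 0 < fst (z a) \<and> 0 < snd (z a)"
    by (intro AE_finite_allI pos) auto
  moreover have "AE z in points_measure n. \<forall>a\<in>slots n. \<forall>b\<in>slots n. a \<noteq> b \<longrightarrow> fst (z a) \<noteq> fst (z b) \<and> snd (z a) \<noteq> snd (z b)"
  proof (intro AE_finite_allI finite_slots)
    fix a b assume ab: "a \<in> slots n" "b \<in> slots n"
    show "AE z in points_measure n. a \<noteq> b \<longrightarrow> fst (z a) \<noteq> fst (z b) \<and> snd (z a) \<noteq> snd (z b)"
    proof (cases "a = b")
      case False
      have "AE z in points_measure n. fst (z a) \<noteq> fst (z b)" "AE z in points_measure n. snd (z a) \<noteq> snd (z b)"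
        using ab False by (auto intro!: AE_distinct_coordinates AE_square_coordinate)
      then show ?thesis by eventually_elim simp
    qed simp
  qed
  ultimately show ?thesis by eventually_elim (simp add: generic_points_def)
qed

lemma emeasure_lower_left:
  assumes "p \<in> unit_square" "q \<in> unit_square"
  shows "(\<integral>\<^sup>+ w. indicator {w. fst w \<le> fst p \<and> snd w \<le> snd q} w \<partial>square_measure) = ennreal (fst p * snd q)"
proof -
  have pq: "0 \<le> fst p" "fst p \<le> 1" "0 \<le> snd q" "snd q \<le> 1" using assms by (auto simp: unit_square_def)
  let ?B = "{0..fst p} \<times> {0..snd q}"
  have sub: "?B \<subseteq> unit_square" using pq by (auto simp: unit_square_def)
  have B: "?B \<in> sets borel" by (intro borel_closed closed_Times) auto
  have "(\<integral>\<^sup>+ w. indicator {w. fst w \<le> fst p \<and> snd w \<le> snd q} w \<partial>square_measure) = (\<integral>\<^sup>+ w. indicator ?B w \<partial>square_measure)"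
    by (intro nn_integral_cong) (auto simp: space_restrict_space unit_square_def indicator_def)
  also have "\<dots> = emeasure square_measure ?B"
    using sub B by (intro nn_integral_indicator) (simp add: sets_restrict_space_iff)
  also have "\<dots> = emeasure (lborel \<Otimes>\<^sub>M lborel) ?B"
    unfolding lborel_prod using sub by (subst emeasure_restrict_space) auto
  also have "\<dots> = ennreal (fst p) * ennreal (snd q)"
    using pq by (subst lborel.emeasure_pair_measure_Times) auto
  also have "\<dots> = ennreal (fst p * snd q)" using pq by (simp add: ennreal_mult)
  finally show ?thesis .
qed

text \<open>The points other than those at \<open>a\<close> and \<open>b\<close> lie in a rectangle of area
  \<open>fst p * snd q\<close>, which gives the power. The constraints on the points at
  \<open>a\<close> and \<open>b\<close> themselves are discarded.\<close>

lemma upper_right_integral_le: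
  fixes n :: "'d::finite \<Rightarrow> nat" and F :: "real \<Rightarrow> ennreal"
  assumes F[measurable]: "F \<in> borel_measurable borel" and ab: "a \<in> slots n" "b \<in> slots n" "a \<noteq> b"
  shows "(\<integral>\<^sup>+ z. of_bool (upper_right n z a b) * F (fst (z a) * snd (z b)) \<partial>points_measure n)
    \<le> (\<integral>\<^sup>+ p. \<integral>\<^sup>+ q. ennreal ((fst p * snd q) ^ (card (slots n) - 2)) * F (fst p * snd q) \<partial>square_measure \<partial>square_measure)"
proof -
  define J where "J = slots n - {a, b}"
  define I where "I = insert b J"
  have J: "slots n = insert a I" "a \<notin> I" "finite I" "b \<notin> J" "finite J" "card J = card (slots n) - 2"
    using ab by (auto simp: J_def I_def card_Diff_subset)
  let ?ind = "\<lambda>w p q. indicator {w. fst w \<le> fst p \<and> snd w \<le> snd q} w :: ennreal"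
  let ?h = "\<lambda>z. F (fst (z a) * snd (z b)) * (\<Prod>c\<in>J. ?ind (z c) (z a) (z b))"
  have sqm: "fst \<in> borel_measurable square_measure" "snd \<in> borel_measurable square_measure"
    by (auto intro: measurable_restrict_space1)
  have h_meas: "?h \<in> borel_measurable (PiM K (\<lambda>_. square_measure))" if K: "insert a I \<subseteq> K" for K
  proof -
    have c[measurable]: "(\<lambda>z. fst (z c)) \<in> borel_measurable (PiM K (\<lambda>_. square_measure))"
      "(\<lambda>z. snd (z c)) \<in> borel_measurable (PiM K (\<lambda>_. square_measure))" if "c \<in> insert a I" for c
      using measurable_compose[OF measurable_component_singleton[of c K "\<lambda>_. square_measure"] sqm(1)]
        measurable_compose[OF measurable_component_singleton[of c K "\<lambda>_. square_measure"] sqm(2)] K that by auto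
    have ind: "?ind w p q = indicator {0..} (fst p - fst w) * indicator {0..} (snd q - snd w)" for w p q :: "real \<times> real"
      by (cases "fst w \<le> fst p"; cases "snd w \<le> snd q") (simp_all add: indicator_def)
    have "b \<in> insert a I" "\<And>c. c \<in> J \<Longrightarrow> c \<in> insert a I" by (auto simp: I_def)
    then show ?thesis unfolding ind
      by (intro borel_measurable_times_ennreal borel_measurable_prod_ennreal measurable_compose[OF _ F]
           measurable_compose[OF _ borel_measurable_indicator[of "{0..} :: real set" borel]] borel_measurable_diff borel_measurable_times c) auto
  qed
  have "(\<integral>\<^sup>+ z. of_bool (upper_right n z a b) * F (fst (z a) * snd (z b)) \<partial>points_measure n) \<le> (\<integral>\<^sup>+ z. ?h z \<partial>points_measure n)"
  proof (intro nn_integral_mono)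
    fix z
    show "of_bool (upper_right n z a b) * F (fst (z a) * snd (z b)) \<le> ?h z"
    proof (cases "upper_right n z a b")
      case True
      then have "(\<Prod>c\<in>J. ?ind (z c) (z a) (z b)) = 1"
        by (intro prod.neutral) (auto simp: upper_right_def J_def)
      with True show ?thesis by simp
    qed simp
  qed
  also have "\<dots> = (\<integral>\<^sup>+ p. (\<integral>\<^sup>+ x. ?h (x(a := p)) \<partial>PiM I (\<lambda>_. square_measure)) \<partial>square_measure)"
    unfolding points_measure_def J(1) by (rule points.product_nn_integral_insert_rev[OF J(3,2)]) (rule h_meas, simp)
  also have "\<dots> = (\<integral>\<^sup>+ p. \<integral>\<^sup>+ q. ennreal ((fst p * snd q) ^ (card (slots n) - 2)) * F (fst p * snd q) \<partial>square_measure \<partial>square_measure)"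
  proof (intro nn_integral_cong)
    fix p assume p: "p \<in> space square_measure"
    have "(\<lambda>x. x(a := p)) \<in> measurable (PiM I (\<lambda>_. square_measure)) (PiM (insert a I) (\<lambda>_. square_measure))"
      by (rule measurable_fun_upd[where J = I]) (use p in auto)
    from measurable_compose[OF this h_meas[OF order_refl]]
    have hp: "(\<lambda>x. ?h (x(a := p))) \<in> borel_measurable (PiM (insert b J) (\<lambda>_. square_measure))"
      unfolding I_def .
    have "(\<integral>\<^sup>+ x. ?h (x(a := p)) \<partial>PiM I (\<lambda>_. square_measure))
        = (\<integral>\<^sup>+ q. (\<integral>\<^sup>+ x. ?h ((x(b := q))(a := p)) \<partial>PiM J (\<lambda>_. square_measure)) \<partial>square_measure)"
      unfolding I_def by (rule points.product_nn_integral_insert_rev[OF J(5,4) hp])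
    also have "\<dots> = (\<integral>\<^sup>+ q. ennreal ((fst p * snd q) ^ (card (slots n) - 2)) * F (fst p * snd q) \<partial>square_measure)"
    proof (intro nn_integral_cong)
      fix q assume q: "q \<in> space square_measure"
      have pq: "p \<in> unit_square" "q \<in> unit_square" using p q by (auto simp: space_restrict_space)
      have aJ: "a \<notin> J" by (auto simp: J_def)
      have "?h ((x(b := q))(a := p)) = F (fst p * snd q) * (\<Prod>c\<in>J. ?ind (x c) p q)" for x
      proof -
        have "(\<Prod>c\<in>J. ?ind (((x(b := q))(a := p)) c) p q) = (\<Prod>c\<in>J. ?ind (x c) p q)"
          using aJ J(4) by (intro prod.cong refl) auto
        then show ?thesis using ab by simp
      qed
      moreover have ind_meas: "(\<lambda>w. ?ind w p q) \<in> borel_measurable square_measure"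
      proof -
        have "{w. fst w \<le> fst p \<and> snd w \<le> snd q} = {..fst p} \<times> {..snd q}" by auto
        then have "{w. fst w \<le> fst p \<and> snd w \<le> snd q} \<in> sets borel"
          using closed_Times[OF closed_atMost[of "fst p"] closed_atMost[of "snd q"]] by (simp only: borel_closed)
        then show ?thesis by (intro measurable_restrict_space1) simp
      qed
      ultimately have "(\<integral>\<^sup>+ x. ?h ((x(b := q))(a := p)) \<partial>PiM J (\<lambda>_. square_measure))
          = (\<integral>\<^sup>+ x. F (fst p * snd q) * (\<Prod>c\<in>J. ?ind (x c) p q) \<partial>PiM J (\<lambda>_. square_measure))" by simp
      also have "\<dots> = F (fst p * snd q) * (\<integral>\<^sup>+ x. (\<Prod>c\<in>J. ?ind (x c) p q) \<partial>PiM J (\<lambda>_. square_measure))"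
        by (intro nn_integral_cmult borel_measurable_prod_ennreal measurable_compose[OF measurable_component_singleton[where M = "\<lambda>_. square_measure"] ind_meas])
      also have "(\<integral>\<^sup>+ x. (\<Prod>c\<in>J. ?ind (x c) p q) \<partial>PiM J (\<lambda>_. square_measure)) = (\<Prod>c\<in>J. \<integral>\<^sup>+ w. ?ind w p q \<partial>square_measure)"
        by (rule points.product_nn_integral_prod[OF J(5) ind_meas])
      also have "\<dots> = ennreal ((fst p * snd q) ^ (card (slots n) - 2))"
        unfolding emeasure_lower_left[OF pq] prod_constant J(6)
        using pq by (intro ennreal_power) (auto simp: unit_square_def)
      finally show "(\<integral>\<^sup>+ x. ?h ((x(b := q))(a := p)) \<partial>PiM J (\<lambda>_. square_measure))
          = ennreal ((fst p * snd q) ^ (card (slots n) - 2)) * F (fst p * snd q)" by (simp only: mult.commute)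
    qed
    finally show "(\<integral>\<^sup>+ x. ?h (x(a := p)) \<partial>PiM I (\<lambda>_. square_measure))
      = (\<integral>\<^sup>+ q. ennreal ((fst p * snd q) ^ (card (slots n) - 2)) * F (fst p * snd q) \<partial>square_measure)" .
  qed
  finally show ?thesis .
qed

lemma card_slots: "card (slots (n :: 'd::finite \<Rightarrow> nat)) = (\<Sum>k\<in>UNIV. n k)"
  by (simp add: slots_def card_SigmaI)

lemma drop_one_order:
  fixes n :: "'d::finite \<Rightarrow> nat"
  assumes "n k > 0"
  shows "(\<Prod>l\<in>UNIV. fact (n l) :: real) = real (n k) * (\<Prod>l\<in>UNIV. fact ((n(k := n k - 1)) l))"
    and "(\<Sum>l\<in>UNIV. n l) = Suc (\<Sum>l\<in>UNIV. (n(k := n k - 1)) l)"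
proof -
  have "(\<Prod>l\<in>UNIV. fact (n l) :: real) = fact (n k) * (\<Prod>l\<in>UNIV - {k}. fact (n l))" by (rule prod.remove) auto
  moreover have "(\<Prod>l\<in>UNIV. fact ((n(k := n k - 1)) l) :: real) = fact (n k - 1) * (\<Prod>l\<in>UNIV - {k}. fact (n l))"
    by (subst prod.remove[of _ k]) auto
  ultimately show "(\<Prod>l\<in>UNIV. fact (n l) :: real) = real (n k) * (\<Prod>l\<in>UNIV. fact ((n(k := n k - 1)) l))"
    using fact_reduce[OF assms, where 'a = real] by simp
  have "(\<Sum>l\<in>UNIV. n l) = n k + (\<Sum>l\<in>UNIV - {k}. n l)" by (rule sum.remove) auto
  moreover have "(\<Sum>l\<in>UNIV. (n(k := n k - 1)) l) = (n k - 1) + (\<Sum>l\<in>UNIV - {k}. n l)"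
    by (subst sum.remove[of _ k]) auto
  ultimately show "(\<Sum>l\<in>UNIV. n l) = Suc (\<Sum>l\<in>UNIV. (n(k := n k - 1)) l)" using assms by simp
qed

lemma slot_pairs_nonempty:
  assumes "slot_pairs i j n \<noteq> {}"
  shows "n i > 0" "(n(i := n i - 1)) j > 0"
proof -
  have "card (slot_pairs i j n) > 0" using assms by (simp add: card_gt_0_iff)
  then show "n i > 0" "(n(i := n i - 1)) j > 0" unfolding card_slot_pairs by auto
qed

text \<open>The first identity makes the number of pairs cancel: of the mean over the pairs, one factor is used up by
  the number of terms and the other one turns \<open>n!\<close> into the factorial of the reduced order.\<close>

lemma drop_orders_identities:
  fixes n :: "'d::finite \<Rightarrow> nat"
  assumes "slot_pairs i j n \<noteq> {}"
  shows "(\<Prod>k\<in>UNIV. fact (n k) :: real) = real (card (slot_pairs i j n)) * (\<Prod>k\<in>UNIV. fact (drop_orders i j n k))"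
    and "card (slots n) - 2 = (\<Sum>k\<in>UNIV. drop_orders i j n k)"
  using drop_one_order[of n i, OF slot_pairs_nonempty(1)[OF assms]]
    drop_one_order[of "n(i := n i - 1)" j, OF slot_pairs_nonempty(2)[OF assms]]
  by (simp_all only: card_slots card_slot_pairs drop_orders_def Let_def of_nat_mult mult.assoc
      numeral_2_eq_2 diff_Suc_Suc diff_zero)

lemma inj_on_drop_orders: "inj_on (drop_orders i j) {n :: 'd::finite \<Rightarrow> nat. slot_pairs i j n \<noteq> {}}"
proof (rule inj_onI)
  fix n m :: "'d \<Rightarrow> nat"
  assume "n \<in> {n. slot_pairs i j n \<noteq> {}}" "m \<in> {n. slot_pairs i j n \<noteq> {}}" and eq: "drop_orders i j n = drop_orders i j m"
  then have "slot_pairs i j n \<noteq> {}" "slot_pairs i j m \<noteq> {}" by auto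
  note pos = slot_pairs_nonempty[OF this(1)] slot_pairs_nonempty[OF this(2)]
  have restore: "f = g" if "f(k := f k - 1) = g(k := g k - 1)" "f k > 0" "g k > 0" for f g :: "'d \<Rightarrow> nat" and k
  proof
    fix l
    from that(1) have "(f(k := f k - 1)) l = (g(k := g k - 1)) l" by (rule fun_cong)
    with that(2,3) show "f l = g l" by (cases "l = k") auto
  qed
  have "n(i := n i - 1) = m(i := m i - 1)"
    by (rule restore[where f = "n(i := n i - 1)" and g = "m(i := m i - 1)", OF eq[unfolded drop_orders_def Let_def] pos(2,4)])
  then show "n = m" by (rule restore[where f = n and g = m, OF _ pos(1,3)])
qed

text \<open>A finite set of multi-indices is contained in a box, and the sum over a box is a product of partial sums
  of exponential series.\<close>

lemma sum_multi_exponential_le: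
  fixes x :: "'d::finite \<Rightarrow> real"
  assumes fin: "finite T" and x: "\<And>k. x k \<ge> 0"
  shows "(\<Sum>m\<in>T. \<Prod>k\<in>UNIV. x k ^ m k / fact (m k)) \<le> exp (\<Sum>k\<in>UNIV. x k)"
proof -
  define K where "K = Max (insert 0 ((\<lambda>(m, k). m k) ` (T \<times> UNIV)))"
  have "m k \<le> K" if "m \<in> T" for m k
    unfolding K_def using fin that by (intro Max_ge) force+
  then have sub: "T \<subseteq> PiE UNIV (\<lambda>_. {..K})" by auto
  have "(\<Sum>m\<in>T. \<Prod>k\<in>UNIV. x k ^ m k / fact (m k)) \<le> (\<Sum>m\<in>PiE UNIV (\<lambda>_. {..K}). \<Prod>k\<in>UNIV. x k ^ m k / fact (m k))"
    using sub x by (intro sum_mono2 prod_nonneg finite_PiE) auto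
  also have "\<dots> = (\<Prod>k\<in>UNIV. \<Sum>l\<le>K. x k ^ l / fact l)"
    by (subst prod_sum_PiE) auto
  also have "\<dots> \<le> (\<Prod>k\<in>UNIV. exp (x k))"
  proof (intro prod_mono conjI sum_nonneg)
    fix k
    have "(\<lambda>l. x k ^ l / fact l) sums exp (x k)"
      using exp_converges[of "x k"] by (simp add: divide_inverse mult.commute)
    then show "(\<Sum>l\<le>K. x k ^ l / fact l) \<le> exp (x k)"
      using sum_le_suminf[OF sums_summable, of "\<lambda>l. x k ^ l / fact l" "exp (x k)" "{..K}"] x[of k]
      by (simp add: sums_iff)
  qed (use x in auto)
  also have "\<dots> = exp (\<Sum>k\<in>UNIV. x k)" by (simp add: exp_sum)
  finally show ?thesis .
qed

text \<open>The summand of multi-index \<open>m\<close> in the expansion of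
  \<open>exp (s * (norm y)\<^sup>2)\<close>, normalized to total mass one.\<close>

definition current_energy :: "('d::finite \<Rightarrow> nat) \<Rightarrow> real ^ 'd \<Rightarrow> real \<Rightarrow> real" where
  "current_energy m y s = (\<Prod>k\<in>UNIV. (s * (y $ k)\<^sup>2) ^ m k / fact (m k)) * exp (- s * (norm y)\<^sup>2)"

lemma current_energy_nonneg: "s \<ge> 0 \<Longrightarrow> current_energy m y s \<ge> 0"
  by (auto simp: current_energy_def intro!: mult_nonneg_nonneg prod_nonneg)

lemma current_energy_measurable[measurable]: "current_energy m y \<in> borel_measurable borel"
  unfolding current_energy_def[abs_def] by measurable

lemma current_weight_measurable[measurable]: "current_weight m y \<in> borel_measurable borel"
  unfolding current_weight_def[abs_def] by measurable

lemma current_weight_energy: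
  fixes y :: "real ^ 'd::finite"
  assumes "s \<ge> 0"
  shows "(\<Prod>k\<in>UNIV. fact (m k)) * s ^ (\<Sum>k\<in>UNIV. m k) * (norm (current_weight m y s))\<^sup>2 \<le> current_energy m y s"
proof (cases "s > 0")
  case False
  then show ?thesis using current_energy_nonneg[OF assms, of m y] by (simp add: current_weight_def)
next
  case True
  have "(norm (current_weight m y s))\<^sup>2 = (\<Prod>k\<in>UNIV. ((y $ k)\<^sup>2) ^ m k / (fact (m k))\<^sup>2) * exp (- s * (norm y)\<^sup>2)"
  proof -
    have "norm (current_weight m y s) = (\<Prod>k\<in>UNIV. \<bar>y $ k\<bar> ^ m k / fact (m k)) * exp (- s * (norm y)\<^sup>2 / 2)"
      using True by (simp add: current_weight_def norm_mult norm_divide norm_power flip: prod_norm)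
    moreover have "(\<Prod>k\<in>UNIV. \<bar>y $ k\<bar> ^ m k / fact (m k))\<^sup>2 = (\<Prod>k\<in>UNIV. ((y $ k)\<^sup>2) ^ m k / (fact (m k))\<^sup>2)"
    proof -
      have "(\<bar>a\<bar> ^ l)\<^sup>2 = (a\<^sup>2) ^ l" for a :: real and l by (metis power2_abs power_commutes power_mult mult.commute)
      then show ?thesis by (simp add: prod_power_distrib power_divide)
    qed
    moreover have "(exp (- s * (norm y)\<^sup>2 / 2))\<^sup>2 = exp (- s * (norm y)\<^sup>2)"
      by (simp add: power2_eq_square flip: exp_add)
    ultimately show ?thesis by (simp add: power_mult_distrib)
  qed
  moreover have "s ^ (\<Sum>k\<in>UNIV. m k) = (\<Prod>k\<in>UNIV. s ^ m k)" by (rule power_sum)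
  moreover have "(\<Prod>k\<in>UNIV. fact (m k)) * (\<Prod>k\<in>UNIV. s ^ m k) * (\<Prod>k\<in>UNIV. ((y $ k)\<^sup>2) ^ m k / (fact (m k))\<^sup>2)
      = (\<Prod>k\<in>UNIV. (s * (y $ k)\<^sup>2) ^ m k / fact (m k))"
    unfolding prod.distrib[symmetric]
    by (intro prod.cong refl) (simp add: power_mult_distrib power2_eq_square)
  ultimately show ?thesis by (simp add: current_energy_def)
qed

lemma sum_current_energy_le:
  assumes "finite T" "s \<ge> 0"
  shows "(\<Sum>m\<in>T. current_energy m y s) \<le> 1"
proof -
  have "(\<Sum>m\<in>T. current_energy m y s) = (\<Sum>m\<in>T. \<Prod>k\<in>UNIV. (s * (y $ k)\<^sup>2) ^ m k / fact (m k)) * exp (- s * (norm y)\<^sup>2)"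
    by (simp add: current_energy_def sum_distrib_right)
  also have "\<dots> \<le> exp (\<Sum>k\<in>UNIV. s * (y $ k)\<^sup>2) * exp (- s * (norm y)\<^sup>2)"
    using assms by (intro mult_right_mono sum_multi_exponential_le) auto
  also have "\<dots> = 1"
  proof -
    have "(\<Sum>k\<in>UNIV. s * (y $ k)\<^sup>2) = s * (norm y)\<^sup>2" by (simp add: norm_vec_sq sum_distrib_left)
    then show ?thesis by (simp flip: exp_add)
  qed
  finally show ?thesis .
qed

text \<open>This is the disjointness of supports that removes the cross terms from the squared norm of the kernel.\<close>

lemma upper_right_unique:
  assumes z: "z \<in> generic_points n" and "(a, b) \<in> slot_pairs i j n" "(a', b') \<in> slot_pairs i j n"
    and ur: "upper_right n z a b" "upper_right n z a' b'"
  shows "(a, b) = (a', b')"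
proof -
  have s: "a \<in> slots n" "b \<in> slots n" "a' \<in> slots n" "b' \<in> slots n"
    using slot_pairs_in_slots[OF assms(2)] slot_pairs_in_slots[OF assms(3)] by auto
  have "fst (z a) = fst (z a')" "snd (z b) = snd (z b')"
    using ur s unfolding upper_right_def by (meson order_antisym)+
  moreover have "fst (z a) \<noteq> fst (z a')" if "a \<noteq> a'" using z s that by (simp add: generic_points_def)
  moreover have "snd (z b) \<noteq> snd (z b')" if "b \<noteq> b'" using z s that by (simp add: generic_points_def)
  ultimately show ?thesis by auto
qed

lemma corner_kernel_norm_le:
  assumes z: "z \<in> generic_points n"
  shows "(norm (corner_kernel i j y n z))\<^sup>2 \<le> (\<Sum>p\<in>slot_pairs i j n.
      of_bool (upper_right n z (fst p) (snd p)) * (norm (current_weight (drop_orders i j n) y (fst (z (fst p)) * snd (z (snd p)))))\<^sup>2)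
      / (real (card (slot_pairs i j n)))\<^sup>2"
proof -
  let ?P = "slot_pairs i j n"
  let ?f = "\<lambda>p. of_bool (upper_right n z (fst p) (snd p)) * current_weight (drop_orders i j n) y (fst (z (fst p)) * snd (z (snd p)))"
  let ?g = "\<lambda>p. of_bool (upper_right n z (fst p) (snd p)) * (norm (current_weight (drop_orders i j n) y (fst (z (fst p)) * snd (z (snd p)))))\<^sup>2"
  have "(norm (\<Sum>p\<in>?P. ?f p))\<^sup>2 \<le> (\<Sum>p\<in>?P. ?g p)"
  proof (cases "\<exists>p\<in>?P. upper_right n z (fst p) (snd p)")
    case True
    then obtain p where p: "p \<in> ?P" "upper_right n z (fst p) (snd p)" by blast
    have "\<not> upper_right n z (fst q) (snd q)" if "q \<in> ?P - {p}" for q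
      using upper_right_unique[OF z, of "fst p" "snd p" i j "fst q" "snd q"] p that by auto
    then have "(\<Sum>q\<in>?P - {p}. ?f q) = 0" by (intro sum.neutral) auto
    then have "(\<Sum>q\<in>?P. ?f q) = ?f p" using sum.remove[OF finite_slot_pairs p(1), of ?f] by simp
    moreover have "(norm (?f p))\<^sup>2 = ?g p" using p by simp
    moreover have "?g p \<le> (\<Sum>q\<in>?P. ?g q)" by (rule member_le_sum[OF p(1)]) auto
    ultimately show ?thesis by simp
  next
    case False
    then have "(\<Sum>p\<in>?P. ?f p) = 0" by (intro sum.neutral) auto
    moreover have "(\<Sum>p\<in>?P. ?g p) \<ge> 0" by (intro sum_nonneg) auto
    ultimately show ?thesis by simp
  qed
  moreover have "corner_kernel i j y n z = (\<Sum>p\<in>?P. ?f p) / of_nat (card ?P)"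
    by (simp only: corner_kernel_def case_prod_unfold)
  ultimately show ?thesis
    by (simp only: norm_divide power_divide norm_of_nat) (intro divide_right_mono; simp)
qed

lemma square_coordinates_measurable[measurable]:
  "fst \<in> borel_measurable square_measure" "snd \<in> borel_measurable square_measure"
  by (auto intro: measurable_restrict_space1)

lemma upper_right_measurable:
  assumes s: "a \<in> slots n" "b \<in> slots (n :: 'd::finite \<Rightarrow> nat)"
  shows "Measurable.pred (points_measure n) (\<lambda>z. upper_right n z a b)"
proof -
  have "Measurable.pred (points_measure n) (\<lambda>z. fst (z c) \<le> fst (z a) \<and> snd (z c) \<le> snd (z b))"
    if c: "c \<in> slots n" for c
  proof -
    note [measurable] =
      borel_measurable_le[OF coordinate_fst_measurable[OF c] coordinate_fst_measurable[OF s(1)], folded pred_def]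
      borel_measurable_le[OF coordinate_snd_measurable[OF c] coordinate_snd_measurable[OF s(2)], folded pred_def]
    show ?thesis by measurable
  qed
  then show ?thesis unfolding upper_right_def by (intro pred_intros_finite finite_slots)
qed

text \<open>Each pair of slots contributes the same bound. Here the square measure in \<open>p\<close> and
  \<open>q\<close> carries the points at the two extremal slots.\<close>

lemma current_energy_term:
  fixes n :: "'d::finite \<Rightarrow> nat"
  assumes ne: "slot_pairs i j n \<noteq> {}"
  shows "ennreal (\<Prod>k\<in>UNIV. fact (n k)) * L2_sq (points_measure n) (corner_kernel i j y n)
    \<le> (\<integral>\<^sup>+ p. \<integral>\<^sup>+ q. ennreal (current_energy (drop_orders i j n) y (fst p * snd q)) \<partial>square_measure \<partial>square_measure)"
proof -
  let ?P = "slot_pairs i j n" and ?m = "drop_orders i j n"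
  define C where "C = real (card ?P)"
  have C: "C > 0" using ne by (simp add: C_def card_gt_0_iff)
  let ?F = "\<lambda>s. ennreal ((norm (current_weight ?m y s))\<^sup>2)"
  let ?Q = "\<integral>\<^sup>+ p. \<integral>\<^sup>+ q. ennreal ((fst p * snd q) ^ (card (slots n) - 2)) * ?F (fst p * snd q) \<partial>square_measure \<partial>square_measure"
  let ?u = "\<lambda>p z. of_bool (upper_right n z (fst p) (snd p)) * ?F (fst (z (fst p)) * snd (z (snd p)))"
  have u_meas: "?u p \<in> borel_measurable (points_measure n)" if "p \<in> ?P" for p
  proof -
    have s: "fst p \<in> slots n" "snd p \<in> slots n" using slot_pairs_in_slots[of "fst p" "snd p"] that by auto
    have "Measurable.pred (points_measure n) (\<lambda>z. upper_right n z (fst p) (snd p))"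
      by (rule upper_right_measurable[OF s])
    then have "(\<lambda>z. of_bool (upper_right n z (fst p) (snd p)) :: ennreal) \<in> borel_measurable (points_measure n)"
      unfolding of_bool_def by measurable
    moreover have "(\<lambda>z. ?F (fst (z (fst p)) * snd (z (snd p)))) \<in> borel_measurable (points_measure n)"
      by (rule measurable_compose[where N = borel, OF borel_measurable_times[OF coordinate_fst_measurable[OF s(1)] coordinate_snd_measurable[OF s(2)]]]) measurable
    ultimately show ?thesis by (rule borel_measurable_times_ennreal)
  qed
  have "L2_sq (points_measure n) (corner_kernel i j y n) \<le> (\<integral>\<^sup>+ z. ennreal (1 / C\<^sup>2) * (\<Sum>p\<in>?P. ?u p z) \<partial>points_measure n)"
    unfolding L2_sq_def
  proof (rule nn_integral_mono_AE)
    show "AE z in points_measure n. ennreal ((norm (corner_kernel i j y n z))\<^sup>2) \<le> ennreal (1 / C\<^sup>2) * (\<Sum>p\<in>?P. ?u p z)"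
      using AE_generic_points
    proof eventually_elim
      case (elim z)
      let ?g = "\<lambda>p. of_bool (upper_right n z (fst p) (snd p)) * (norm (current_weight ?m y (fst (z (fst p)) * snd (z (snd p)))))\<^sup>2"
      have "ennreal ((norm (corner_kernel i j y n z))\<^sup>2) \<le> ennreal (1 / C\<^sup>2 * (\<Sum>p\<in>?P. ?g p))"
        using corner_kernel_norm_le[OF elim, of i j y] by (intro ennreal_leI) (simp add: C_def)
      also have "\<dots> = ennreal (1 / C\<^sup>2) * ennreal (\<Sum>p\<in>?P. ?g p)"
        by (intro ennreal_mult sum_nonneg) auto
      also have "ennreal (\<Sum>p\<in>?P. ?g p) = (\<Sum>p\<in>?P. ennreal (?g p))"
        by (intro sum_ennreal[symmetric]) auto
      also have "\<dots> = (\<Sum>p\<in>?P. ?u p z)"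
        by (intro sum.cong refl) (auto simp: of_bool_def)
      finally show ?case .
    qed
  qed
  also have "\<dots> = ennreal (1 / C\<^sup>2) * (\<integral>\<^sup>+ z. (\<Sum>p\<in>?P. ?u p z) \<partial>points_measure n)"
    by (intro nn_integral_cmult borel_measurable_sum u_meas)
  also have "\<dots> = ennreal (1 / C\<^sup>2) * (\<Sum>p\<in>?P. \<integral>\<^sup>+ z. ?u p z \<partial>points_measure n)"
    by (subst nn_integral_sum) (rule u_meas, assumption, rule refl)
  also have "\<dots> \<le> ennreal (1 / C\<^sup>2) * (\<Sum>p\<in>?P. ?Q)"
  proof (intro mult_left_mono sum_mono)
    fix p assume "p \<in> ?P"
    then have s: "fst p \<in> slots n" "snd p \<in> slots n" "fst p \<noteq> snd p" using slot_pairs_in_slots[of "fst p" "snd p"] by auto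
    show "(\<integral>\<^sup>+ z. ?u p z \<partial>points_measure n) \<le> ?Q"
      by (rule upper_right_integral_le[OF _ s]) measurable
  qed simp
  also have "\<dots> = ennreal (1 / C\<^sup>2) * (ennreal C * ?Q)" by (simp add: C_def ennreal_of_nat_eq_real_of_nat)
  also have "\<dots> = ennreal (1 / C) * ?Q"
    using C by (simp add: mult.assoc[symmetric] ennreal_mult[symmetric] power2_eq_square)
  finally have "ennreal (\<Prod>k\<in>UNIV. fact (n k)) * L2_sq (points_measure n) (corner_kernel i j y n)
      \<le> ennreal (C * (\<Prod>k\<in>UNIV. fact (?m k))) * (ennreal (1 / C) * ?Q)"
    unfolding drop_orders_identities(1)[OF ne] C_def[symmetric] by (rule mult_left_mono) simp
  also have "\<dots> = ennreal (\<Prod>k\<in>UNIV. fact (?m k)) * ?Q"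
    using C by (simp add: mult.assoc[symmetric] ennreal_mult[symmetric] prod_nonneg)
  also have "\<dots> = (\<integral>\<^sup>+ p. \<integral>\<^sup>+ q. ennreal (\<Prod>k\<in>UNIV. fact (?m k)) * (ennreal ((fst p * snd q) ^ (card (slots n) - 2)) * ?F (fst p * snd q)) \<partial>square_measure \<partial>square_measure)"
    by (subst nn_integral_cmult[symmetric], measurable, subst nn_integral_cmult[symmetric], measurable)
  also have "\<dots> \<le> (\<integral>\<^sup>+ p. \<integral>\<^sup>+ q. ennreal (current_energy ?m y (fst p * snd q)) \<partial>square_measure \<partial>square_measure)"
  proof (intro nn_integral_mono)
    fix p q assume "p \<in> space square_measure" "q \<in> space square_measure"
    then have s: "fst p * snd q \<ge> 0" by (auto simp: space_restrict_space unit_square_def mem_Times_iff)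
    have "ennreal (\<Prod>k\<in>UNIV. fact (?m k)) * (ennreal ((fst p * snd q) ^ (card (slots n) - 2)) * ?F (fst p * snd q))
      = ennreal ((\<Prod>k\<in>UNIV. fact (?m k)) * (fst p * snd q) ^ (\<Sum>k\<in>UNIV. ?m k) * (norm (current_weight ?m y (fst p * snd q)))\<^sup>2)"
      unfolding drop_orders_identities(2)[OF ne] using s by (simp add: ennreal_mult prod_nonneg mult.assoc)
    also have "\<dots> \<le> ennreal (current_energy ?m y (fst p * snd q))"
      by (intro ennreal_leI current_weight_energy s)
    finally show "ennreal (\<Prod>k\<in>UNIV. fact (?m k)) * (ennreal ((fst p * snd q) ^ (card (slots n) - 2)) * ?F (fst p * snd q))
      \<le> ennreal (current_energy ?m y (fst p * snd q))" .
  qed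
  finally show ?thesis .
qed

text \<open>The reduced orders are distinct for distinct orders, so the sum is at most a partial sum of the
  exponential series for each fixed area.\<close>

lemma current_energy_bound:
  fixes S :: "('d::finite \<Rightarrow> nat) set"
  assumes "finite S"
  shows "(\<Sum>n\<in>S. ennreal (\<Prod>k\<in>UNIV. fact (n k)) * L2_sq (points_measure n) (corner_kernel i j y n)) \<le> 1"
proof -
  define S' where "S' = {n \<in> S. slot_pairs i j n \<noteq> {}}"
  have S': "finite S'" "S' \<subseteq> S" using assms by (auto simp: S'_def)
  let ?E = "\<lambda>m p q. ennreal (current_energy m y (fst p * snd q))"
  have "(\<Sum>n\<in>S. ennreal (\<Prod>k\<in>UNIV. fact (n k)) * L2_sq (points_measure n) (corner_kernel i j y n))
      = (\<Sum>n\<in>S'. ennreal (\<Prod>k\<in>UNIV. fact (n k)) * L2_sq (points_measure n) (corner_kernel i j y n))"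
    using assms S' by (intro sum.mono_neutral_right) (auto simp: S'_def corner_kernel_def L2_sq_def)
  also have "\<dots> \<le> (\<Sum>n\<in>S'. \<integral>\<^sup>+ p. \<integral>\<^sup>+ q. ?E (drop_orders i j n) p q \<partial>square_measure \<partial>square_measure)"
    by (intro sum_mono current_energy_term) (simp add: S'_def)
  also have "\<dots> = (\<Sum>m\<in>drop_orders i j ` S'. \<integral>\<^sup>+ p. \<integral>\<^sup>+ q. ?E m p q \<partial>square_measure \<partial>square_measure)"
  proof -
    have "inj_on (drop_orders i j) S'" by (rule inj_on_subset[OF inj_on_drop_orders]) (auto simp: S'_def)
    then show ?thesis by (simp add: sum.reindex)
  qed
  also have "\<dots> = (\<integral>\<^sup>+ p. (\<Sum>m\<in>drop_orders i j ` S'. \<integral>\<^sup>+ q. ?E m p q \<partial>square_measure) \<partial>square_measure)"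
    by (rule nn_integral_sum[symmetric]) measurable
  also have "\<dots> = (\<integral>\<^sup>+ p. \<integral>\<^sup>+ q. (\<Sum>m\<in>drop_orders i j ` S'. ?E m p q) \<partial>square_measure \<partial>square_measure)"
    by (intro nn_integral_cong nn_integral_sum[symmetric]) measurable
  also have "\<dots> \<le> (\<integral>\<^sup>+ p. \<integral>\<^sup>+ q. 1 \<partial>square_measure \<partial>square_measure)"
  proof (intro nn_integral_mono)
    fix p q assume "p \<in> space square_measure" "q \<in> space square_measure"
    then have s: "fst p * snd q \<ge> 0" by (auto simp: space_restrict_space unit_square_def mem_Times_iff)
    then have "(\<Sum>m\<in>drop_orders i j ` S'. ?E m p q) = ennreal (\<Sum>m\<in>drop_orders i j ` S'. current_energy m y (fst p * snd q))"
      by (intro sum_ennreal current_energy_nonneg)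
    also have "\<dots> \<le> ennreal 1" using S' s by (intro ennreal_leI sum_current_energy_le) auto
    finally show "(\<Sum>m\<in>drop_orders i j ` S'. ?E m p q) \<le> 1" by simp
  qed
  also have "\<dots> = 1" using square.emeasure_space_1 by (simp only: nn_integral_const mult_1)
  finally show ?thesis .
qed

section \<open>Existence of multiple integrals\<close>

definition mesh :: "nat \<Rightarrow> real set" where
  "mesh p = (\<lambda>j. real j / real (Suc p)) ` {..Suc p}"

text \<open>Rounding up, because the cells of a grid contain their upper right corners.\<close>

definition round_up :: "nat \<Rightarrow> real \<Rightarrow> real" where
  "round_up p x = real_of_int \<lceil>x * real (Suc p)\<rceil> / real (Suc p)"

lemma mesh_is_grid: "is_grid (mesh p)"
proof -
  have "real 0 / real (Suc p) \<in> mesh p" "real (Suc p) / real (Suc p) \<in> mesh p"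
    unfolding mesh_def by (intro imageI; simp)+
  then have "{0, 1} \<subseteq> mesh p" by simp
  moreover have "mesh p \<subseteq> {0..1}" by (auto simp: mesh_def)
  ultimately show ?thesis by (simp add: is_grid_def mesh_def)
qed

lemma round_up_bounds: "x \<le> round_up p x" "round_up p x < x + 1 / real (Suc p)"
proof -
  have "x * real (Suc p) \<le> real_of_int \<lceil>x * real (Suc p)\<rceil>" "real_of_int \<lceil>x * real (Suc p)\<rceil> < x * real (Suc p) + 1"
    using ceiling_correct[of "x * real (Suc p)"] by linarith+
  then show "x \<le> round_up p x" "round_up p x < x + 1 / real (Suc p)"
    unfolding round_up_def by (simp_all add: field_simps del: of_nat_Suc)
qed

lemma round_up_mono: "x \<le> y \<Longrightarrow> round_up p x \<le> round_up p y"
  unfolding round_up_def by (intro divide_right_mono) (auto intro!: ceiling_mono mult_right_mono)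

lemma round_up_tendsto: "(\<lambda>p. round_up p x) \<longlonglongrightarrow> x"
proof (rule tendsto_sandwich[where f = "\<lambda>_. x" and h = "\<lambda>p. x + 1 / real (Suc p)"])
  show "(\<lambda>p. x + 1 / real (Suc p)) \<longlonglongrightarrow> x"
    using tendsto_add[OF tendsto_const[of x] LIMSEQ_inverse_real_of_nat] by (simp add: inverse_eq_divide)
  show "\<forall>\<^sub>F p in sequentially. x \<le> round_up p x" using round_up_bounds(1) by simp
  show "\<forall>\<^sub>F p in sequentially. round_up p x \<le> x + 1 / real (Suc p)"
    using round_up_bounds(2) by (intro always_eventually allI less_imp_le)
qed (rule tendsto_const)

lemma round_up_mesh:
  assumes "0 < x" "x \<le> 1"
  shows "round_up p x \<in> mesh p - {0}" "grid_pred (mesh p) (round_up p x) < x"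
proof -
  let ?c = "\<lceil>x * real (Suc p)\<rceil>"
  have "0 < x * real (Suc p)" using assms by simp
  then have c0: "?c > 0" by simp
  have c1: "?c \<le> int (Suc p)" using assms by (simp add: ceiling_le_iff)
  have "round_up p x = real (nat ?c) / real (Suc p)" using c0 by (simp add: round_up_def)
  moreover have "nat ?c \<in> {..Suc p}" using c1 by (simp add: nat_le_iff del: of_nat_Suc)
  ultimately have "round_up p x \<in> mesh p" unfolding mesh_def by (rule image_eqI)
  moreover have "round_up p x \<noteq> 0" using round_up_bounds(1)[of x p] assms by linarith
  ultimately show m: "round_up p x \<in> mesh p - {0}" by simp
  have "grid_pred (mesh p) (round_up p x) \<in> mesh p" "grid_pred (mesh p) (round_up p x) < round_up p x"
    using grid_pred(1,2)[OF mesh_is_grid m] .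
  then obtain j where j: "grid_pred (mesh p) (round_up p x) = real j / real (Suc p)" "real j / real (Suc p) < real_of_int ?c / real (Suc p)"
    unfolding mesh_def round_up_def by auto
  then have "real j < real_of_int ?c" by (simp add: divide_less_cancel del: of_nat_Suc)
  then have "int j < ?c" by linarith
  then have "real j < x * real (Suc p)" by (simp add: less_ceiling_iff)
  then show "grid_pred (mesh p) (round_up p x) < x" unfolding j by (simp add: field_simps del: of_nat_Suc)
qed

definition round_points :: "nat \<Rightarrow> ('d::finite \<Rightarrow> nat) \<Rightarrow> 'd points \<Rightarrow> 'd points" where
  "round_points p n z = (\<lambda>a\<in>slots n. (round_up p (fst (z a)), round_up p (snd (z a))))"

lemma round_points_cell:
  assumes z: "z \<in> generic_points n" "z \<in> space (points_measure n)" and a: "a \<in> slots n"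
  shows "round_points p n z a \<in> grid_corners (mesh p)" "z a \<in> cell (grid_cell (mesh p) (round_points p n z a))"
proof -
  have b: "0 < fst (z a)" "fst (z a) \<le> 1" "0 < snd (z a)" "snd (z a) \<le> 1"
    using z a by (auto simp: generic_points_def space_points_measure unit_square_def mem_Times_iff PiE_iff)
  show "round_points p n z a \<in> grid_corners (mesh p)"
    using round_up_mesh(1)[OF b(1,2)] round_up_mesh(1)[OF b(3,4)] a by (simp add: round_points_def grid_corners_def)
  show "z a \<in> cell (grid_cell (mesh p) (round_points p n z a))"
    using round_up_mesh(2)[OF b(1,2)] round_up_mesh(2)[OF b(3,4)] round_up_bounds(1) a
    by (simp add: round_points_def cell_def grid_cell_def mem_Times_iff)
qed

text \<open>The kernel \<open>f\<close> sampled at the corners of the mesh, with the cells meeting the diagonals left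
  out.\<close>

definition grid_kernel :: "nat \<Rightarrow> ('d::finite \<Rightarrow> nat) \<Rightarrow> ('d points \<Rightarrow> complex) \<Rightarrow> 'd points \<Rightarrow> complex" where
  "grid_kernel p n f z = (\<Sum>\<gamma>\<in>placements (mesh p) n. f \<gamma> * (\<Prod>a\<in>slots n. indicator (cell (grid_cell (mesh p) (\<gamma> a))) (z a)))"

lemma grid_kernel_generic:
  assumes z: "z \<in> generic_points n" "z \<in> space (points_measure n)"
  shows "grid_kernel p n f z = (if inj_on (tag (round_points p n z)) (slots n) then f (round_points p n z) else 0)"
proof -
  let ?r = "round_points p n z"
  let ?I = "\<lambda>\<gamma>. (\<Prod>a\<in>slots n. indicator (cell (grid_cell (mesh p) (\<gamma> a))) (z a)) :: complex"
  have r: "?r \<in> PiE (slots n) (\<lambda>_. grid_corners (mesh p))"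
    using round_points_cell(1)[OF z] by (auto simp: round_points_def)
  have I0: "?I \<gamma> = 0" if \<gamma>: "\<gamma> \<in> placements (mesh p) n" "\<gamma> \<noteq> ?r" for \<gamma>
  proof -
    have P: "\<gamma> \<in> PiE (slots n) (\<lambda>_. grid_corners (mesh p))" using \<gamma> by (simp add: placements_def)
    with r \<gamma> obtain a where a: "a \<in> slots n" "\<gamma> a \<noteq> ?r a" by (meson PiE_ext)
    have "z a \<notin> cell (grid_cell (mesh p) (\<gamma> a))"
      using grid_cells_disjoint[OF mesh_is_grid PiE_mem[OF P a(1)] round_points_cell(1)[OF z a(1)] _ round_points_cell(2)[OF z a(1)]] a(2) by blast
    then have "indicator (cell (grid_cell (mesh p) (\<gamma> a))) (z a) = (0 :: complex)" by (rule indicator_simps(2))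
    then show ?thesis using a(1) by (intro prod_zero finite_slots bexI)
  qed
  show ?thesis
  proof (cases "inj_on (tag ?r) (slots n)")
    case True
    then have rp: "?r \<in> placements (mesh p) n" using r by (simp add: placements_def)
    have "?I ?r = 1"
      using round_points_cell(2)[OF z] by (intro prod.neutral ballI indicator_simps(1))
    moreover have "(\<Sum>\<gamma>\<in>placements (mesh p) n - {?r}. f \<gamma> * ?I \<gamma>) = 0"
    proof (intro sum.neutral ballI)
      fix \<gamma> assume "\<gamma> \<in> placements (mesh p) n - {?r}"
      then have "?I \<gamma> = 0" by (intro I0) auto
      then show "f \<gamma> * ?I \<gamma> = 0" by (simp only: mult_zero_right)
    qed
    ultimately show ?thesis
      using True unfolding grid_kernel_def sum.remove[OF finite_placements[OF mesh_is_grid] rp] by simp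
  next
    case False
    then have "?r \<notin> placements (mesh p) n" by (simp add: placements_def)
    then have ne: "\<And>\<gamma>. \<gamma> \<in> placements (mesh p) n \<Longrightarrow> \<gamma> \<noteq> ?r" by auto
    have "grid_kernel p n f z = 0"
      unfolding grid_kernel_def
    proof (intro sum.neutral ballI)
      fix \<gamma> assume "\<gamma> \<in> placements (mesh p) n"
      then have "?I \<gamma> = 0" using ne by (intro I0)
      then show "f \<gamma> * ?I \<gamma> = 0" by (simp only: mult_zero_right)
    qed
    with False show ?thesis by simp
  qed
qed

lemma eventually_inj_round_points:
  assumes z: "z \<in> generic_points n"
  shows "\<forall>\<^sub>F p in sequentially. inj_on (tag (round_points p n z)) (slots n)"
proof -
  have "\<forall>\<^sub>F p in sequentially. \<forall>a\<in>slots n. \<forall>b\<in>slots n. a \<noteq> b \<longrightarrow> round_up p (fst (z a)) \<noteq> round_up p (fst (z b))"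
  proof (intro eventually_ball_finite finite_slots ballI)
    fix a b assume ab: "a \<in> slots n" "b \<in> slots n"
    show "\<forall>\<^sub>F p in sequentially. a \<noteq> b \<longrightarrow> round_up p (fst (z a)) \<noteq> round_up p (fst (z b))"
    proof (cases "a = b")
      case False
      then have "fst (z a) - fst (z b) \<noteq> 0" using z ab by (simp add: generic_points_def)
      moreover have "(\<lambda>p. round_up p (fst (z a)) - round_up p (fst (z b))) \<longlonglongrightarrow> fst (z a) - fst (z b)"
        by (intro tendsto_diff round_up_tendsto)
      ultimately have "\<forall>\<^sub>F p in sequentially. round_up p (fst (z a)) - round_up p (fst (z b)) \<noteq> 0"
        by (rule tendsto_imp_eventually_ne[rotated])
      then show ?thesis by eventually_elim simp
    qed simp
  qed
  then show ?thesis
  proof eventually_elim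
    case (elim p)
    show ?case
    proof (rule inj_onI)
      fix a b assume ab: "a \<in> slots n" "b \<in> slots n" "tag (round_points p n z) a = tag (round_points p n z) b"
      then have "round_up p (fst (z a)) = round_up p (fst (z b))" by (simp add: tag_def round_points_def)
      then show "a = b" using elim ab by blast
    qed
  qed
qed

text \<open>A generic point is eventually rounded to a placement, so the sampled kernel converges to \<open>f\<close>
  almost everywhere, and boundedness gives convergence in \<open>L\<^sup>2\<close>.\<close>

lemma grid_kernel_tendsto_L2:
  fixes n :: "'d::finite \<Rightarrow> nat"
  assumes f[measurable]: "f \<in> borel_measurable (points_measure n)" and B: "\<And>z. norm (f z) \<le> B"
    and K: "\<And>p. grid_kernel p n f \<in> borel_measurable (points_measure n)"
    and conv: "\<And>z. z \<in> generic_points n \<Longrightarrow> z \<in> space (points_measure n) \<Longrightarrow> (\<lambda>p. f (round_points p n z)) \<longlonglongrightarrow> f z"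
  shows "tendsto_L2 (points_measure n) (\<lambda>p. grid_kernel p n f) f sequentially"
proof -
  interpret P: prob_space "points_measure n" by (rule prob_space_points_measure)
  note [measurable] = K
  have B0: "B \<ge> 0" using B[of undefined] norm_ge_zero order_trans by blast
  have "(\<lambda>p. \<integral>\<^sup>+ z. ennreal ((norm (grid_kernel p n f z - f z))\<^sup>2) \<partial>points_measure n) \<longlonglongrightarrow> (\<integral>\<^sup>+ z. 0 \<partial>points_measure n)"
  proof (rule nn_integral_dominated_convergence[where w = "\<lambda>_. ennreal ((2 * B)\<^sup>2)"])
    show "AE z in points_measure n. ennreal ((norm (grid_kernel p n f z - f z))\<^sup>2) \<le> ennreal ((2 * B)\<^sup>2)" for p
      using AE_generic_points AE_space
    proof eventually_elim
      case (elim z)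
      have "norm (grid_kernel p n f z) \<le> B" using B B0 by (simp add: grid_kernel_generic[OF elim])
      then have "norm (grid_kernel p n f z - f z) \<le> 2 * B"
        using norm_triangle_ineq4[of "grid_kernel p n f z" "f z"] B[of z] by linarith
      then show ?case by (intro ennreal_leI power_mono) auto
    qed
    show "AE z in points_measure n. (\<lambda>p. ennreal ((norm (grid_kernel p n f z - f z))\<^sup>2)) \<longlonglongrightarrow> 0"
      using AE_generic_points AE_space
    proof eventually_elim
      case (elim z)
      have "\<forall>\<^sub>F p in sequentially. f (round_points p n z) = grid_kernel p n f z"
        using eventually_inj_round_points[OF elim(1)] by eventually_elim (simp add: grid_kernel_generic[OF elim])
      then have "(\<lambda>p. grid_kernel p n f z) \<longlonglongrightarrow> f z"
        by (rule Lim_transform_eventually[OF conv[OF elim], rotated])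
      then have "(\<lambda>p. ennreal ((norm (grid_kernel p n f z - f z))\<^sup>2)) \<longlonglongrightarrow> ennreal ((norm (f z - f z))\<^sup>2)"
        by (intro tendsto_intros)
      then show ?case by simp
    qed
  qed (auto simp: P.emeasure_space_1 ennreal_mult_less_top)
  then show ?thesis by (simp add: tendsto_L2_def)
qed

context brownian_sheet_space
begin

definition grid_integral :: "nat \<Rightarrow> ('d \<Rightarrow> nat) \<Rightarrow> ('d points \<Rightarrow> complex) \<Rightarrow> 'w \<Rightarrow> complex" where
  "grid_integral p n f \<omega> = (\<Sum>\<gamma>\<in>placements (mesh p) n. f \<gamma> * (\<Prod>a\<in>slots n. of_real (grid_increment (mesh p) (fst a, \<gamma> a) \<omega>)))"

lemma grid_elementary:
  obtains N e where "\<And>f. grid_kernel p n f = elementary_kernel n N (\<lambda>q. f (e q)) (\<lambda>q a. grid_cell (mesh p) (e q a))"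
    "\<And>f. grid_integral p n f = elementary_integral W n N (\<lambda>q. f (e q)) (\<lambda>q a. grid_cell (mesh p) (e q a))"
    "\<forall>q<N. elementary_cells n (\<lambda>a. grid_cell (mesh p) (e q a))"
proof -
  let ?P = "placements (mesh p) n"
  obtain e where "bij_betw e {0..<card ?P} ?P"
    using ex_bij_betw_nat_finite[OF finite_placements[OF mesh_is_grid]] by blast
  then have e: "bij_betw e {..<card ?P} ?P" by (simp add: atLeast0LessThan)
  show thesis
  proof (rule that[of "card ?P" e])
    show "grid_kernel p n f = elementary_kernel n (card ?P) (\<lambda>q. f (e q)) (\<lambda>q a. grid_cell (mesh p) (e q a))" for f
      unfolding grid_kernel_def[abs_def] elementary_kernel_def[abs_def]
      by (rule ext) (rule sum.reindex_bij_betw[OF e, symmetric])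
    show "grid_integral p n f = elementary_integral W n (card ?P) (\<lambda>q. f (e q)) (\<lambda>q a. grid_cell (mesh p) (e q a))" for f
    proof
      fix \<omega>
      have "elementary_integral W n (card ?P) (\<lambda>q. f (e q)) (\<lambda>q a. grid_cell (mesh p) (e q a)) \<omega>
        = (\<Sum>q<card ?P. f (e q) * (\<Prod>a\<in>slots n. of_real (grid_increment (mesh p) (fst a, e q a) \<omega>)))"
        by (simp add: elementary_integral_def grid_increment_def case_prod_unfold)
      also have "\<dots> = grid_integral p n f \<omega>"
        unfolding grid_integral_def by (rule sum.reindex_bij_betw[OF e])
      finally show "grid_integral p n f \<omega> = elementary_integral W n (card ?P) (\<lambda>q. f (e q)) (\<lambda>q a. grid_cell (mesh p) (e q a)) \<omega>" ..
    qed
    show "\<forall>q<card ?P. elementary_cells n (\<lambda>a. grid_cell (mesh p) (e q a))"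
    proof (intro allI impI)
      fix q assume "q < card ?P"
      then have "e q \<in> ?P" using e by (auto simp: bij_betw_def)
      then have eq: "\<And>a. a \<in> slots n \<Longrightarrow> e q a \<in> grid_corners (mesh p)" "inj_on (tag (e q)) (slots n)"
        by (auto simp: placements_def)
      show "elementary_cells n (\<lambda>a. grid_cell (mesh p) (e q a))"
        unfolding elementary_cells_def
      proof (intro conjI ballI allI)
        fix a assume a: "a \<in> slots n"
        obtain b c where bc: "e q a = (b, c)" by (cases "e q a")
        then have m: "b \<in> mesh p - {0}" "c \<in> mesh p - {0}" using eq(1)[OF a] by (auto simp: grid_corners_def)
        show "case grid_cell (mesh p) (e q a) of ((s, t), (s', t')) \<Rightarrow> 0 \<le> s \<and> s \<le> s' \<and> s' \<le> 1 \<and> 0 \<le> t \<and> t \<le> t' \<and> t' \<le> 1"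
          using grid_pred(1,2)[OF mesh_is_grid m(1)] grid_pred(1,2)[OF mesh_is_grid m(2)] m mesh_is_grid[of p]
          by (auto simp: bc grid_cell_def is_grid_def)
      next
        fix k
        show "disjoint_family_on (\<lambda>l. cell (grid_cell (mesh p) (e q (k, l)))) {..<n k}"
          unfolding disjoint_family_on_def
        proof (intro ballI impI, rule ccontr)
          fix l l' assume l: "l \<in> {..<n k}" "l' \<in> {..<n k}" "l \<noteq> l'"
            and "cell (grid_cell (mesh p) (e q (k, l))) \<inter> cell (grid_cell (mesh p) (e q (k, l'))) \<noteq> {}"
          then obtain w where w: "w \<in> cell (grid_cell (mesh p) (e q (k, l)))" "w \<in> cell (grid_cell (mesh p) (e q (k, l')))" by auto
          have s: "(k, l) \<in> slots n" "(k, l') \<in> slots n" using l by (auto simp: slots_def)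
          have "e q (k, l) = e q (k, l')" using grid_cells_disjoint[OF mesh_is_grid eq(1)[OF s(1)] eq(1)[OF s(2)] w] .
          then have "tag (e q) (k, l) = tag (e q) (k, l')" by (simp add: tag_def)
          then show False using inj_onD[OF eq(2) _ s] l(3) by blast
        qed
      qed
    qed
  qed
qed

lemma grid_multiple_integral:
  "multiple_integral M W n (grid_kernel p n f) (grid_integral p n f)"
proof -
  obtain N e where K: "grid_kernel p n f = elementary_kernel n N (\<lambda>q. f (e q)) (\<lambda>q a. grid_cell (mesh p) (e q a))"
    and I: "grid_integral p n f = elementary_integral W n N (\<lambda>q. f (e q)) (\<lambda>q a. grid_cell (mesh p) (e q a))"
    and el: "\<forall>q<N. elementary_cells n (\<lambda>a. grid_cell (mesh p) (e q a))"
    by (rule grid_elementary[of p n]) blast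
  show ?thesis
    unfolding multiple_integral_iff
  proof (intro conjI exI)
    show "grid_kernel p n f \<in> borel_measurable (points_measure n)" unfolding K by measurable
    show "grid_integral p n f \<in> borel_measurable M" unfolding I by (rule elementary_integral_measurable[OF el])
    show "\<forall>q' :: nat. \<forall>q<N. elementary_cells n (\<lambda>a. grid_cell (mesh p) (e q a))" using el by blast
    show "tendsto_L2 (points_measure n) (\<lambda>_. elementary_kernel n N (\<lambda>q. f (e q)) (\<lambda>q a. grid_cell (mesh p) (e q a))) (grid_kernel p n f) sequentially"
      unfolding K by (simp add: tendsto_L2_def)
    show "tendsto_L2 M (\<lambda>_. elementary_integral W n N (\<lambda>q. f (e q)) (\<lambda>q a. grid_cell (mesh p) (e q a))) (grid_integral p n f) sequentially"
      unfolding I by (simp add: tendsto_L2_def)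
  qed
qed

lemma multiple_integral_L2_diff:
  assumes "multiple_integral M W n f X" "multiple_integral M W n g Y"
  shows "L2_sq M (\<lambda>\<omega>. X \<omega> - Y \<omega>) \<le> ennreal (order_factorial n) * L2_sq (points_measure n) (\<lambda>z. f z - g z)"
  using multiple_integral_bessel[of "{n}" "\<lambda>_ z. f z - g z" "\<lambda>_ \<omega>. X \<omega> - Y \<omega>"] multiple_integral_diff[OF assms] by simp

text \<open>The sampled kernels have integrals that depend measurably on the parameter, since only finitely many
  values of the kernel enter. They form a Cauchy sequence by Bessel's inequality.\<close>

lemma multiple_integral_exists:
  fixes f :: "'y \<Rightarrow> 'd points \<Rightarrow> complex"
  assumes f: "\<And>y. y \<in> space N \<Longrightarrow> f y \<in> borel_measurable (points_measure n)"
    and fy: "\<And>\<gamma>. (\<lambda>y. f y \<gamma>) \<in> borel_measurable N"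
    and B: "\<And>y z. norm (f y z) \<le> B y"
    and conv: "\<And>y z. y \<in> space N \<Longrightarrow> z \<in> generic_points n \<Longrightarrow> z \<in> space (points_measure n) \<Longrightarrow>
        (\<lambda>p. f y (round_points p n z)) \<longlonglongrightarrow> f y z"
  obtains J where "J \<in> borel_measurable (N \<Otimes>\<^sub>M M)"
    "\<And>y. y \<in> space N \<Longrightarrow> multiple_integral M W n (f y) (\<lambda>\<omega>. J (y, \<omega>))"
proof -
  have K_meas: "grid_kernel p n g \<in> borel_measurable (points_measure n)" for p g
    using grid_multiple_integral[of n p g] by (simp add: multiple_integral_iff)
  have lim: "tendsto_L2 (points_measure n) (\<lambda>p. grid_kernel p n (f y)) (f y) sequentially" if y: "y \<in> space N" for y
    by (rule grid_kernel_tendsto_L2[OF f[OF y] B K_meas conv[OF y]])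
  define X where "X p = (\<lambda>(y, \<omega>). grid_integral p n (f y) \<omega>)" for p
  have X_meas: "X p \<in> borel_measurable (N \<Otimes>\<^sub>M M)" for p
  proof -
    have incr: "(\<lambda>x. complex_of_real (grid_increment (mesh p) (fst a, \<gamma> a) (snd x))) \<in> borel_measurable (N \<Otimes>\<^sub>M M)"
      if "\<gamma> \<in> placements (mesh p) n" "a \<in> slots n" for \<gamma> a
    proof -
      have "grid_increment (mesh p) (fst a, \<gamma> a) \<in> borel_measurable M"
        using that by (intro grid_increment_measurable mesh_is_grid) (auto simp: placements_def)
      then show ?thesis by measurable
    qed
    then show ?thesis unfolding X_def grid_integral_def case_prod_unfold
      by (intro borel_measurable_sum borel_measurable_times borel_measurable_prod
           measurable_compose[OF measurable_fst fy] incr)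
  qed
  have cauchy: "\<exists>P. \<forall>p\<ge>P. \<forall>q\<ge>P. L2_sq M (\<lambda>\<omega>. X p (y, \<omega>) - X q (y, \<omega>)) \<le> ennreal e"
    if y: "y \<in> space N" and e: "e > 0" for y e
  proof -
    define c where "c = (order_factorial n :: real)"
    have c: "c > 0" unfolding c_def by (intro prod_pos) auto
    have "\<forall>\<^sub>F p in sequentially. L2_sq (points_measure n) (\<lambda>z. grid_kernel p n (f y) z - f y z) < ennreal (e / (4 * c))"
      using lim[OF y] e c unfolding tendsto_L2_iff by (intro order_tendstoD(2)) auto
    then obtain P where P: "\<And>p. p \<ge> P \<Longrightarrow> L2_sq (points_measure n) (\<lambda>z. grid_kernel p n (f y) z - f y z) < ennreal (e / (4 * c))"
      by (auto simp: eventually_sequentially)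
    show ?thesis
    proof (intro exI[of _ P] allI impI)
      fix p q assume pq: "p \<ge> P" "q \<ge> P"
      have "L2_sq M (\<lambda>\<omega>. X p (y, \<omega>) - X q (y, \<omega>)) \<le> ennreal c * L2_sq (points_measure n) (\<lambda>z. grid_kernel p n (f y) z - grid_kernel q n (f y) z)"
        unfolding X_def prod.case c_def by (rule multiple_integral_L2_diff[OF grid_multiple_integral grid_multiple_integral])
      also have "L2_sq (points_measure n) (\<lambda>z. grid_kernel p n (f y) z - grid_kernel q n (f y) z)
          = L2_sq (points_measure n) (\<lambda>z. (grid_kernel p n (f y) z - f y z) + (f y z - grid_kernel q n (f y) z))" by simp
      also have "\<dots> \<le> 2 * L2_sq (points_measure n) (\<lambda>z. grid_kernel p n (f y) z - f y z) + 2 * L2_sq (points_measure n) (\<lambda>z. f y z - grid_kernel q n (f y) z)"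
        using K_meas f[OF y] by (intro L2_sq_add_le2) auto
      also have "\<dots> \<le> 2 * ennreal (e / (4 * c)) + 2 * ennreal (e / (4 * c))"
        using P[OF pq(1)] P[OF pq(2)] by (intro add_mono mult_left_mono) (auto simp: L2_sq_minus_commute[of _ "f y"])
      also have "\<dots> = ennreal (e / c)"
        using e c by (simp add: ennreal_plus[symmetric] ennreal_mult[symmetric] flip: ennreal_numeral del: ennreal_plus)
      finally have "L2_sq M (\<lambda>\<omega>. X p (y, \<omega>) - X q (y, \<omega>)) \<le> ennreal c * ennreal (e / c)"
        by (simp add: mult_left_mono)
      then show "L2_sq M (\<lambda>\<omega>. X p (y, \<omega>) - X q (y, \<omega>)) \<le> ennreal e"
        using e c by (simp add: ennreal_mult[symmetric])
    qed
  qed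
  obtain J where J: "J \<in> borel_measurable (N \<Otimes>\<^sub>M M)"
    and JL: "\<And>y. y \<in> space N \<Longrightarrow> tendsto_L2 M (\<lambda>p \<omega>. X p (y, \<omega>)) (\<lambda>\<omega>. J (y, \<omega>)) sequentially"
    using L2_limit_jointly_measurable[OF X_meas cauchy] by blast
  have "\<forall>p. \<exists>N e. (\<forall>f. grid_kernel p n f = elementary_kernel n N (\<lambda>q. f (e q)) (\<lambda>q a. grid_cell (mesh p) (e q a))) \<and>
    (\<forall>f. grid_integral p n f = elementary_integral W n N (\<lambda>q. f (e q)) (\<lambda>q a. grid_cell (mesh p) (e q a))) \<and>
    (\<forall>q<N. elementary_cells n (\<lambda>a. grid_cell (mesh p) (e q a)))"
  proof
    fix p
    obtain N e where h1: "\<And>f. grid_kernel p n f = elementary_kernel n N (\<lambda>q. f (e q)) (\<lambda>q a. grid_cell (mesh p) (e q a))"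
      and h2: "\<And>f. grid_integral p n f = elementary_integral W n N (\<lambda>q. f (e q)) (\<lambda>q a. grid_cell (mesh p) (e q a))"
      and h3: "\<forall>q<N. elementary_cells n (\<lambda>a. grid_cell (mesh p) (e q a))"
      by (rule grid_elementary[of p n]) (rule that)
    show "\<exists>N e. (\<forall>f. grid_kernel p n f = elementary_kernel n N (\<lambda>q. f (e q)) (\<lambda>q a. grid_cell (mesh p) (e q a))) \<and>
      (\<forall>f. grid_integral p n f = elementary_integral W n N (\<lambda>q. f (e q)) (\<lambda>q a. grid_cell (mesh p) (e q a))) \<and>
      (\<forall>q<N. elementary_cells n (\<lambda>a. grid_cell (mesh p) (e q a)))"
      by (intro exI[of _ N] exI[of _ e] conjI) (rule allI, rule h1, rule allI, rule h2, rule h3)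
  qed
  then obtain Ne e where
    K: "\<And>p f. grid_kernel p n f = elementary_kernel n (Ne p) (\<lambda>q. f (e p q)) (\<lambda>q a. grid_cell (mesh p) (e p q a))" and
    I: "\<And>p f. grid_integral p n f = elementary_integral W n (Ne p) (\<lambda>q. f (e p q)) (\<lambda>q a. grid_cell (mesh p) (e p q a))" and
    el: "\<And>p. \<forall>q<Ne p. elementary_cells n (\<lambda>a. grid_cell (mesh p) (e p q a))"
    by metis
  show thesis
  proof (rule that[OF J])
    fix y assume y: "y \<in> space N"
    show "multiple_integral M W n (f y) (\<lambda>\<omega>. J (y, \<omega>))"
      unfolding multiple_integral_iff
    proof (intro conjI exI)
      show "f y \<in> borel_measurable (points_measure n)" by (rule f[OF y])
      show "(\<lambda>\<omega>. J (y, \<omega>)) \<in> borel_measurable M" using J y by (rule measurable_compose[OF measurable_Pair1', rotated])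
      show "\<forall>p. \<forall>q<Ne p. elementary_cells n (\<lambda>a. grid_cell (mesh p) (e p q a))" using el by blast
      show "tendsto_L2 (points_measure n) (\<lambda>p. elementary_kernel n (Ne p) (\<lambda>q. f y (e p q)) (\<lambda>q a. grid_cell (mesh p) (e p q a))) (f y) sequentially"
        unfolding K[symmetric] by (rule lim[OF y])
      show "tendsto_L2 M (\<lambda>p. elementary_integral W n (Ne p) (\<lambda>q. f y (e p q)) (\<lambda>q a. grid_cell (mesh p) (e p q a))) (\<lambda>\<omega>. J (y, \<omega>)) sequentially"
        unfolding I[symmetric] using JL[OF y] by (simp add: X_def)
    qed
  qed
qed

end

section \<open>Existence of the Fourier transformed current\<close>

lemma fourier_reflect: "fourier (\<lambda>x. of_real (f x)) (- y) = cnj (fourier (\<lambda>x. of_real (f x)) y)"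
proof -
  have "exp (- \<i> * of_real (- y \<bullet> x)) * of_real (f x) = cnj (exp (- \<i> * of_real (y \<bullet> x)) * of_real (f x))" for x
    by (simp add: exp_cnj)
  then have "fourier (\<lambda>x. of_real (f x)) (- y) = (CLINT x|lborel. cnj (exp (- \<i> * of_real (y \<bullet> x)) * of_real (f x)))"
    unfolding fourier_def by (intro Bochner_Integration.integral_cong refl)
  also have "\<dots> = cnj (fourier (\<lambda>x. of_real (f x)) y)"
    unfolding fourier_def by (rule Bochner_Integration.integral_cnj)
  finally show ?thesis .
qed

lemma current_weight_norm_le:
  "norm (current_weight m y s) \<le> (\<Prod>k\<in>UNIV. \<bar>y $ k\<bar> ^ m k / fact (m k))"
proof (cases "s > 0")
  case True
  have "norm (current_weight m y s) = (\<Prod>k\<in>UNIV. \<bar>y $ k\<bar> ^ m k / fact (m k)) * exp (- s * (norm y)\<^sup>2 / 2)"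
    using True by (simp add: current_weight_def norm_mult norm_divide norm_power flip: prod_norm)
  also have "\<dots> \<le> (\<Prod>k\<in>UNIV. \<bar>y $ k\<bar> ^ m k / fact (m k)) * 1"
    using True by (intro mult_left_mono prod_nonneg) auto
  finally show ?thesis by simp
qed (auto simp: current_weight_def intro!: prod_nonneg)

lemma corner_kernel_bounded:
  "norm (corner_kernel i j y n z) \<le> (\<Prod>k\<in>UNIV. \<bar>y $ k\<bar> ^ drop_orders i j n k / fact (drop_orders i j n k))"
proof -
  let ?P = "slot_pairs i j n"
  let ?B = "\<Prod>k\<in>UNIV. \<bar>y $ k\<bar> ^ drop_orders i j n k / fact (drop_orders i j n k)"
  have B: "?B \<ge> 0" by (intro prod_nonneg) auto
  let ?f = "\<lambda>p. of_bool (upper_right n z (fst p) (snd p)) * current_weight (drop_orders i j n) y (fst (z (fst p)) * snd (z (snd p)))"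
  have f: "norm (?f p) \<le> ?B" for p
    using current_weight_norm_le[of "drop_orders i j n" y "fst (z (fst p)) * snd (z (snd p))"] B
    by (cases "upper_right n z (fst p) (snd p)") (simp_all only: of_bool_eq mult_1 mult_zero_left norm_zero)
  have "norm (\<Sum>p\<in>?P. ?f p) \<le> of_nat (card ?P) * ?B"
    using f by (rule sum_norm_bound)
  then have "norm (\<Sum>p\<in>?P. ?f p) / real (card ?P) \<le> ?B"
    using B by (cases "card ?P = 0") (simp_all add: divide_le_eq mult.commute)
  moreover have "corner_kernel i j y n z = (\<Sum>p\<in>?P. ?f p) / of_nat (card ?P)"
    by (simp only: corner_kernel_def case_prod_unfold)
  ultimately show ?thesis by (simp only: norm_divide norm_of_nat)
qed

lemma current_weight_measurable_frequency: "(\<lambda>y. current_weight m y s) \<in> borel_measurable borel"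
proof -
  have [measurable]: "(\<lambda>x :: real ^ 'd. x $ k) \<in> borel_measurable borel" for k
    by (intro borel_measurable_continuous_onI continuous_intros)
  show ?thesis unfolding current_weight_def by measurable
qed

lemma corner_kernel_measurable_frequency: "(\<lambda>y. corner_kernel i j y n z) \<in> borel_measurable borel"
  unfolding corner_kernel_def case_prod_unfold
  by (intro borel_measurable_divide borel_measurable_sum borel_measurable_times borel_measurable_const current_weight_measurable_frequency)

lemma corner_kernel_measurable:
  fixes n :: "'d::finite \<Rightarrow> nat"
  shows "corner_kernel i j y n \<in> borel_measurable (points_measure n)"
proof -
  have "(\<lambda>z. of_bool (upper_right n z (fst p) (snd p)) * current_weight (drop_orders i j n) y (fst (z (fst p)) * snd (z (snd p))))
      \<in> borel_measurable (points_measure n)" if p: "p \<in> slot_pairs i j n" for p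
  proof -
    have s: "fst p \<in> slots n" "snd p \<in> slots n" using slot_pairs_in_slots[of "fst p" "snd p"] p by auto
    have "(\<lambda>z. of_bool (upper_right n z (fst p) (snd p)) :: complex) \<in> borel_measurable (points_measure n)"
      unfolding of_bool_def using upper_right_measurable[OF s] by measurable
    moreover have "(\<lambda>z. current_weight (drop_orders i j n) y (fst (z (fst p)) * snd (z (snd p)))) \<in> borel_measurable (points_measure n)"
      by (rule measurable_compose[OF borel_measurable_times[OF coordinate_fst_measurable[OF s(1)] coordinate_snd_measurable[OF s(2)]] current_weight_measurable])
    ultimately show ?thesis by (rule borel_measurable_times)
  qed
  then show ?thesis unfolding corner_kernel_def[abs_def] case_prod_unfold
    by (intro borel_measurable_divide borel_measurable_sum borel_measurable_const)
qed

text \<open>Rounding up preserves weak inequalities between coordinates, and strict inequalities are preserved on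
  fine meshes, so the indicators are eventually constant.\<close>

lemma corner_kernel_round_points:
  fixes n :: "'d::finite \<Rightarrow> nat"
  assumes z: "z \<in> generic_points n"
  shows "(\<lambda>p. corner_kernel i j y n (round_points p n z)) \<longlonglongrightarrow> corner_kernel i j y n z"
proof -
  let ?m = "drop_orders i j n"
  have "(\<lambda>p. of_bool (upper_right n (round_points p n z) a b) * current_weight ?m y (fst (round_points p n z a) * snd (round_points p n z b)))
      \<longlonglongrightarrow> of_bool (upper_right n z a b) * current_weight ?m y (fst (z a) * snd (z b))"
    if ab: "(a, b) \<in> slot_pairs i j n" for a b
  proof (rule tendsto_mult)
    have s: "a \<in> slots n" "b \<in> slots n" using slot_pairs_in_slots[OF ab] by auto
    have rp: "fst (round_points p n z c) = round_up p (fst (z c))" "snd (round_points p n z c) = round_up p (snd (z c))"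
      if "c \<in> slots n" for c p using that by (simp_all add: round_points_def)
    have less: "\<forall>\<^sub>F p in sequentially. round_up p x < round_up p x'" if "x < x'" for x x'
    proof -
      have "(\<lambda>p. round_up p x' - round_up p x) \<longlonglongrightarrow> x' - x" by (intro tendsto_diff round_up_tendsto)
      then have "\<forall>\<^sub>F p in sequentially. 0 < round_up p x' - round_up p x"
        using that by (intro order_tendstoD(1)) auto
      then show ?thesis by eventually_elim simp
    qed
    have "\<forall>\<^sub>F p in sequentially. upper_right n (round_points p n z) a b = upper_right n z a b"
    proof (cases "upper_right n z a b")
      case True
      then have "upper_right n (round_points p n z) a b" for p
        using s by (auto simp: upper_right_def rp intro!: round_up_mono)
      with True show ?thesis by simp
    next
      case False
      then obtain c where c: "c \<in> slots n" "fst (z a) < fst (z c) \<or> snd (z b) < snd (z c)"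
        by (auto simp: upper_right_def not_le)
      have "\<forall>\<^sub>F p in sequentially. round_up p (fst (z a)) < round_up p (fst (z c)) \<or> round_up p (snd (z b)) < round_up p (snd (z c))"
        using c(2)
      proof
        assume "fst (z a) < fst (z c)"
        from less[OF this] show ?thesis by eventually_elim simp
      next
        assume "snd (z b) < snd (z c)"
        from less[OF this] show ?thesis by eventually_elim simp
      qed
      then show ?thesis
      proof eventually_elim
        case (elim p)
        then have "\<not> upper_right n (round_points p n z) a b"
          using c(1) s unfolding upper_right_def by (auto simp: rp not_le intro!: bexI[of _ c])
        with False show ?case by simp
      qed
    qed
    then have "\<forall>\<^sub>F p in sequentially. of_bool (upper_right n (round_points p n z) a b) = (of_bool (upper_right n z a b) :: complex)"
      by eventually_elim simp
    then show "(\<lambda>p. of_bool (upper_right n (round_points p n z) a b) :: complex) \<longlonglongrightarrow> of_bool (upper_right n z a b)"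
      by (rule tendsto_eventually)
    have pos: "0 < fst (z a)" "0 < snd (z b)" using z s by (auto simp: generic_points_def)
    have pos': "0 < round_up p (fst (z a)) * round_up p (snd (z b))" for p
      using pos round_up_bounds(1) by (intro mult_pos_pos) (auto intro: less_le_trans)
    show "(\<lambda>p. current_weight ?m y (fst (round_points p n z a) * snd (round_points p n z b))) \<longlonglongrightarrow> current_weight ?m y (fst (z a) * snd (z b))"
      unfolding rp[OF s(1)] rp[OF s(2)] current_weight_def if_P[OF pos'] if_P[OF mult_pos_pos[OF pos]]
      by (intro tendsto_intros round_up_tendsto) simp
  qed
  then show ?thesis
    unfolding corner_kernel_def divide_inverse by (intro tendsto_mult tendsto_sum tendsto_const) auto
qed

lemma partial_sum_tail:
  fixes g :: "'b \<Rightarrow> ennreal"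
  assumes B: "\<And>S. finite S \<Longrightarrow> sum g S \<le> 1" and e: "e > 0"
  obtains S0 where "finite S0" "\<And>S. finite S \<Longrightarrow> S \<inter> S0 = {} \<Longrightarrow> sum g S \<le> ennreal e"
proof -
  define r where "r n = enn2real (g n)" for n
  have g: "g n = ennreal (r n)" for n
  proof -
    have "g n \<le> 1" using B[of "{n}"] by simp
    then have "g n < top" by (rule le_less_trans) simp
    then show ?thesis unfolding r_def by (rule ennreal_enn2real[symmetric])
  qed
  have r: "r n \<ge> 0" for n by (simp add: r_def)
  have gS: "sum g S = ennreal (sum r S)" for S unfolding g using r by (intro sum_ennreal) auto
  have rB: "sum r S \<le> 1" if "finite S" for S
    using B[OF that] r unfolding gS by (simp add: sum_nonneg)
  let ?A = "sum r ` {S. finite S}"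
  have bdd: "bdd_above ?A" using rB by (intro bdd_aboveI[of _ 1]) auto
  have "Sup ?A - e < Sup ?A" using e by simp
  then obtain S0 where S0: "finite S0" "Sup ?A - e < sum r S0"
    using less_cSup_iff[of ?A "Sup ?A - e"] bdd by auto
  show thesis
  proof (rule that[OF S0(1)])
    fix S assume S: "finite S" "S \<inter> S0 = {}"
    have "sum r S + sum r S0 = sum r (S \<union> S0)" using S S0 by (simp add: sum.union_disjoint)
    also have "\<dots> \<le> Sup ?A" using S S0 bdd by (intro cSup_upper) auto
    finally have "sum r S \<le> e" using S0(2) by linarith
    then show "sum g S \<le> ennreal e" unfolding gS by (rule ennreal_leI)
  qed
qed

lemma finite_bounded_orders: "finite {n :: 'd::finite \<Rightarrow> nat. \<forall>k. n k < p}"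
proof -
  have "{n :: 'd \<Rightarrow> nat. \<forall>k. n k < p} = PiE UNIV (\<lambda>_. {..<p})" by auto
  then show ?thesis by (simp add: finite_PiE)
qed

lemma finite_orders_bounded:
  assumes "finite (S :: ('d::finite \<Rightarrow> nat) set)"
  obtains p where "S \<subseteq> {n. \<forall>k. n k < p}"
proof -
  define K where "K = Suc (Max (insert 0 ((\<lambda>(m, k). m k) ` (S \<times> UNIV))))"
  have "m k < K" if "m \<in> S" for m k
    unfolding K_def using assms that by (intro le_imp_less_Suc Max_ge) force+
  then show thesis by (intro that[of K]) auto
qed

context brownian_sheet_space
begin

lemma multiple_integral_cong:
  assumes "\<And>z. z \<in> space (points_measure n) \<Longrightarrow> f z = g z"
  shows "multiple_integral M W n f X \<longleftrightarrow> multiple_integral M W n g X"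
proof -
  have "f \<in> borel_measurable (points_measure n) \<longleftrightarrow> g \<in> borel_measurable (points_measure n)"
    using assms by (rule measurable_cong)
  moreover have "tendsto_L2 (points_measure n) K f F \<longleftrightarrow> tendsto_L2 (points_measure n) K g F" for K :: "nat \<Rightarrow> _" and F
    unfolding tendsto_L2_def using assms by (simp cong: nn_integral_cong)
  ultimately show ?thesis unfolding multiple_integral_def by simp
qed

text \<open>A bound on the energy of all finite partial sums makes the tails small, hence the net of partial sums is
  Cauchy. The limit is constructed along boxes of multi-indices, because this is a sequence.\<close>

lemma chaos_sum_exists:
  fixes J :: "('d \<Rightarrow> nat) \<Rightarrow> 'y \<times> 'w \<Rightarrow> complex"
  assumes J: "\<And>n. J n \<in> borel_measurable (N \<Otimes>\<^sub>M M)"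
    and mi: "\<And>y n. y \<in> space N \<Longrightarrow> multiple_integral M W n (f y n) (\<lambda>\<omega>. J n (y, \<omega>))"
    and B: "\<And>y S. y \<in> space N \<Longrightarrow> finite S \<Longrightarrow> (\<Sum>n\<in>S. ennreal (order_factorial n) * L2_sq (points_measure n) (f y n)) \<le> 1"
  obtains X where "X \<in> borel_measurable (N \<Otimes>\<^sub>M M)" "\<And>y. y \<in> space N \<Longrightarrow> chaos_sum M W (f y) (\<lambda>\<omega>. X (y, \<omega>))"
proof -
  have Jm: "(\<lambda>\<omega>. J n (y, \<omega>)) \<in> borel_measurable M" if "y \<in> space N" for n y
    using mi[OF that, of n] by (simp add: multiple_integral_iff)
  have close: "\<exists>S0. finite S0 \<and> (\<forall>S T. finite S \<longrightarrow> finite T \<longrightarrow> S0 \<subseteq> S \<longrightarrow> S0 \<subseteq> T \<longrightarrow>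
      L2_sq M (\<lambda>\<omega>. (\<Sum>n\<in>S. J n (y, \<omega>)) - (\<Sum>n\<in>T. J n (y, \<omega>))) \<le> ennreal e)" if y: "y \<in> space N" and e: "e > 0" for y e
  proof -
    have "e / 4 > 0" using e by simp
    from partial_sum_tail[OF B[OF y] this]
    obtain S0 where S0: "finite S0" "\<And>S. finite S \<Longrightarrow> S \<inter> S0 = {} \<Longrightarrow>
        (\<Sum>n\<in>S. ennreal (order_factorial n) * L2_sq (points_measure n) (f y n)) \<le> ennreal (e / 4)" by blast
    have small: "L2_sq M (\<lambda>\<omega>. \<Sum>n\<in>S. J n (y, \<omega>)) \<le> ennreal (e / 4)" if "finite S" "S \<inter> S0 = {}" for S
      using multiple_integral_bessel[OF that(1), of "f y" "\<lambda>n \<omega>. J n (y, \<omega>)"] mi[OF y] S0(2)[OF that] order_trans by blast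
    have "L2_sq M (\<lambda>\<omega>. (\<Sum>n\<in>S. J n (y, \<omega>)) - (\<Sum>n\<in>T. J n (y, \<omega>))) \<le> ennreal e"
      if "finite S" "finite T" "S0 \<subseteq> S" "S0 \<subseteq> T" for S T
    proof -
      have "(\<Sum>n\<in>S. J n (y, \<omega>)) - (\<Sum>n\<in>T. J n (y, \<omega>)) = (\<Sum>n\<in>S - T. J n (y, \<omega>)) + (- (\<Sum>n\<in>T - S. J n (y, \<omega>)))" for \<omega>
        using sum.Int_Diff[OF that(1), of "\<lambda>n. J n (y, \<omega>)" T] sum.Int_Diff[OF that(2), of "\<lambda>n. J n (y, \<omega>)" S]
        by (simp add: Int_commute)
      then have "L2_sq M (\<lambda>\<omega>. (\<Sum>n\<in>S. J n (y, \<omega>)) - (\<Sum>n\<in>T. J n (y, \<omega>)))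
          \<le> 2 * L2_sq M (\<lambda>\<omega>. \<Sum>n\<in>S - T. J n (y, \<omega>)) + 2 * L2_sq M (\<lambda>\<omega>. - (\<Sum>n\<in>T - S. J n (y, \<omega>)))"
        using Jm[OF y] by (simp only:) (intro L2_sq_add_le2 borel_measurable_sum borel_measurable_uminus; simp)
      also have "L2_sq M (\<lambda>\<omega>. - (\<Sum>n\<in>T - S. J n (y, \<omega>))) = L2_sq M (\<lambda>\<omega>. \<Sum>n\<in>T - S. J n (y, \<omega>))"
        by (intro L2_sq_norm_cong) simp
      also have "2 * L2_sq M (\<lambda>\<omega>. \<Sum>n\<in>S - T. J n (y, \<omega>)) + 2 * L2_sq M (\<lambda>\<omega>. \<Sum>n\<in>T - S. J n (y, \<omega>))
          \<le> 2 * ennreal (e / 4) + 2 * ennreal (e / 4)"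
        using that by (intro add_mono mult_left_mono small) auto
      also have "\<dots> = ennreal e"
        using e by (simp add: ennreal_plus[symmetric] ennreal_mult[symmetric] flip: ennreal_numeral del: ennreal_plus)
      finally show ?thesis .
    qed
    with S0(1) show ?thesis by blast
  qed
  define X where "X p x = (\<Sum>n\<in>{n. \<forall>k. n k < p}. J n x)" for p x
  have X_meas: "X p \<in> borel_measurable (N \<Otimes>\<^sub>M M)" for p
    unfolding X_def[abs_def] using J by (intro borel_measurable_sum)
  have cauchy: "\<exists>P. \<forall>p\<ge>P. \<forall>q\<ge>P. L2_sq M (\<lambda>\<omega>. X p (y, \<omega>) - X q (y, \<omega>)) \<le> ennreal e"
    if y: "y \<in> space N" and e: "e > 0" for y e
  proof -
    obtain S0 where S0: "finite S0" "\<And>S T. finite S \<Longrightarrow> finite T \<Longrightarrow> S0 \<subseteq> S \<Longrightarrow> S0 \<subseteq> T \<Longrightarrow>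
      L2_sq M (\<lambda>\<omega>. (\<Sum>n\<in>S. J n (y, \<omega>)) - (\<Sum>n\<in>T. J n (y, \<omega>))) \<le> ennreal e"
      using close[OF y e] by blast
    obtain P where P: "S0 \<subseteq> {n. \<forall>k. n k < P}" using finite_orders_bounded[OF S0(1)] .
    have sub: "S0 \<subseteq> {n. \<forall>k. n k < p}" if "p \<ge> P" for p
      using P that by (auto intro: less_le_trans)
    show ?thesis unfolding X_def
      by (intro exI[of _ P] allI impI S0(2) finite_bounded_orders sub)
  qed
  obtain Y where Y: "Y \<in> borel_measurable (N \<Otimes>\<^sub>M M)"
    and lim: "\<And>y. y \<in> space N \<Longrightarrow> tendsto_L2 M (\<lambda>p \<omega>. X p (y, \<omega>)) (\<lambda>\<omega>. Y (y, \<omega>)) sequentially"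
    using L2_limit_jointly_measurable[OF X_meas cauchy] by blast
  show thesis
  proof (rule that[OF Y])
    fix y assume y: "y \<in> space N"
    have Ym: "(\<lambda>\<omega>. Y (y, \<omega>)) \<in> borel_measurable M" using Y y by (rule measurable_compose[OF measurable_Pair1', rotated])
    have "tendsto_L2 M (\<lambda>S \<omega>. \<Sum>n\<in>S. J n (y, \<omega>)) (\<lambda>\<omega>. Y (y, \<omega>)) (finite_subsets_at_top UNIV)"
      unfolding tendsto_L2_iff
    proof (rule tendsto_sandwich[OF _ _ tendsto_const])
      show "((\<lambda>S. L2_sq M (\<lambda>\<omega>. (\<Sum>n\<in>S. J n (y, \<omega>)) - Y (y, \<omega>))) \<longlongrightarrow> 0) (finite_subsets_at_top UNIV)"
      proof (rule order_tendstoI)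
        fix e :: ennreal assume "0 < e"
        then obtain t where t: "0 < t" "t < e" using dense by blast
        then have "t < top" by (meson less_le_trans top_greatest)
        define e' where "e' = enn2real t"
        have e': "0 < e'" "ennreal e' < e"
          using t \<open>t < top\<close> by (simp_all add: e'_def enn2real_positive_iff)
        obtain S0 where S0: "finite S0" "\<And>S T. finite S \<Longrightarrow> finite T \<Longrightarrow> S0 \<subseteq> S \<Longrightarrow> S0 \<subseteq> T \<Longrightarrow>
          L2_sq M (\<lambda>\<omega>. (\<Sum>n\<in>S. J n (y, \<omega>)) - (\<Sum>n\<in>T. J n (y, \<omega>))) \<le> ennreal (e' / 4)"
          using close[OF y, of "e' / 4"] e' by auto
        obtain P where P: "S0 \<subseteq> {n. \<forall>k. n k < P}" using finite_orders_bounded[OF S0(1)] .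
        have sub: "S0 \<subseteq> {n. \<forall>k. n k < p}" if "p \<ge> P" for p
          using P that by (auto intro: less_le_trans)
        have "\<forall>\<^sub>F p in sequentially. L2_sq M (\<lambda>\<omega>. X p (y, \<omega>) - Y (y, \<omega>)) < ennreal (e' / 4)"
          using lim[OF y] e' unfolding tendsto_L2_iff by (intro order_tendstoD(2)) auto
        then obtain p where p: "p \<ge> P" "L2_sq M (\<lambda>\<omega>. X p (y, \<omega>) - Y (y, \<omega>)) < ennreal (e' / 4)"
          unfolding eventually_sequentially by (metis nle_le order_trans)
        have "L2_sq M (\<lambda>\<omega>. (\<Sum>n\<in>S. J n (y, \<omega>)) - Y (y, \<omega>)) < e" if S: "finite S" "S0 \<subseteq> S" for S
        proof -
          have "L2_sq M (\<lambda>\<omega>. (\<Sum>n\<in>S. J n (y, \<omega>)) - Y (y, \<omega>))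
              = L2_sq M (\<lambda>\<omega>. ((\<Sum>n\<in>S. J n (y, \<omega>)) - X p (y, \<omega>)) + (X p (y, \<omega>) - Y (y, \<omega>)))" by simp
          also have "\<dots> \<le> 2 * L2_sq M (\<lambda>\<omega>. (\<Sum>n\<in>S. J n (y, \<omega>)) - X p (y, \<omega>)) + 2 * L2_sq M (\<lambda>\<omega>. X p (y, \<omega>) - Y (y, \<omega>))"
            unfolding X_def using Jm[OF y] Ym
            by (intro L2_sq_add_le2 borel_measurable_diff borel_measurable_sum)
          also have "\<dots> \<le> 2 * ennreal (e' / 4) + 2 * ennreal (e' / 4)"
            unfolding X_def using p(2) S0(2)[OF S(1) finite_bounded_orders S(2) sub[OF p(1)]]
            by (intro add_mono mult_left_mono) (auto simp: X_def)
          also have "\<dots> = ennreal e'"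
            using e' by (simp add: ennreal_plus[symmetric] ennreal_mult[symmetric] flip: ennreal_numeral del: ennreal_plus)
          finally show ?thesis using e'(2) by (rule le_less_trans)
        qed
        then show "\<forall>\<^sub>F S in finite_subsets_at_top UNIV. L2_sq M (\<lambda>\<omega>. (\<Sum>n\<in>S. J n (y, \<omega>)) - Y (y, \<omega>)) < e"
          unfolding eventually_finite_subsets_at_top using S0(1) by blast
      qed simp
    qed auto
    then show "chaos_sum M W (f y) (\<lambda>\<omega>. Y (y, \<omega>))"
      unfolding chaos_sum_def using mi[OF y] Ym by (intro conjI exI[of _ "\<lambda>n \<omega>. J n (y, \<omega>)"]) auto
  qed
qed

lemma fourier_current_measurable_version:
  obtains X where "X \<in> borel_measurable (borel \<Otimes>\<^sub>M M)"
    "\<And>y. chaos_sum M W (fourier_chaos (current_chaos i j) y) (\<lambda>\<omega>. X (y, \<omega>))"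
proof -
  have "\<exists>J. J \<in> borel_measurable (borel \<Otimes>\<^sub>M M) \<and> (\<forall>y. multiple_integral M W n (corner_kernel i j y n) (\<lambda>\<omega>. J (y, \<omega>)))" for n
  proof -
    obtain J where "J \<in> borel_measurable (borel \<Otimes>\<^sub>M M)"
      "\<And>y. y \<in> space borel \<Longrightarrow> multiple_integral M W n (corner_kernel i j y n) (\<lambda>\<omega>. J (y, \<omega>))"
      by (rule multiple_integral_exists[of borel "\<lambda>y. corner_kernel i j y n" n, OF corner_kernel_measurable
           corner_kernel_measurable_frequency corner_kernel_bounded corner_kernel_round_points]) (auto intro: that)
    then show ?thesis by auto
  qed
  then obtain J where J: "\<And>n. J n \<in> borel_measurable (borel \<Otimes>\<^sub>M M)"
    "\<And>n y. multiple_integral M W n (corner_kernel i j y n) (\<lambda>\<omega>. J n (y, \<omega>))" by metis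
  have mi: "multiple_integral M W n (fourier_chaos (current_chaos i j) y n) (\<lambda>\<omega>. J n (y, \<omega>))" for n y
    using J(2) by (subst multiple_integral_cong[OF fourier_current])
  have "L2_sq (points_measure n) (fourier_chaos (current_chaos i j) y n) = L2_sq (points_measure n) (corner_kernel i j y n)" for n y
    by (intro L2_sq_norm_cong) (simp add: fourier_current)
  then have B: "(\<Sum>n\<in>S. ennreal (order_factorial n) * L2_sq (points_measure n) (fourier_chaos (current_chaos i j) y n)) \<le> 1"
    if "finite S" for y S using current_energy_bound[OF that, of i j y] by simp
  obtain X where "X \<in> borel_measurable (borel \<Otimes>\<^sub>M M)"
    "\<And>y. y \<in> space borel \<Longrightarrow> chaos_sum M W (fourier_chaos (current_chaos i j) y) (\<lambda>\<omega>. X (y, \<omega>))"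
    using chaos_sum_exists[where N = borel and f = "fourier_chaos (current_chaos i j)", OF J(1) mi B] by blast
  then show thesis by (intro that[of X]) auto
qed

lemma fourier_current_energy:
  assumes "chaos_sum M W (fourier_chaos (current_chaos i j) y) X"
  shows "L2_sq M X \<le> 1"
proof (rule chaos_sum_bessel[OF assms])
  fix S :: "('d \<Rightarrow> nat) set" assume S: "finite S"
  have "L2_sq (points_measure n) (fourier_chaos (current_chaos i j) y n) = L2_sq (points_measure n) (corner_kernel i j y n)" for n
    by (intro L2_sq_norm_cong) (simp add: fourier_current)
  then show "(\<Sum>n\<in>S. ennreal (order_factorial n) * L2_sq (points_measure n) (fourier_chaos (current_chaos i j) y n)) \<le> 1"
    using current_energy_bound[OF S, of i j y] by simp
qed

end

section \<open>Sobolev regularity\<close>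

text \<open>On the half-line the integrand is at most a constant times
  \<open>(1 + t) powr (- (2 * s))\<close>, which has an explicit antiderivative, and it is even.\<close>

lemma bessel_weight_1d_finite:
  fixes s :: real
  assumes s: "s > 1/2"
  shows "(\<integral>\<^sup>+ t. ennreal ((1 + t\<^sup>2) powr (- s)) \<partial>lborel) < \<infinity>"
proof -
  let ?g = "\<lambda>t::real. ennreal ((1 + t\<^sup>2) powr (- s))"
  let ?F = "\<lambda>t::real. (1 + t) powr (1 - 2 * s) / (1 - 2 * s)"
  have half: "(\<integral>\<^sup>+ t. ?g t * indicator {0..} t \<partial>lborel) < \<infinity>"
  proof -
    have "(\<integral>\<^sup>+ t. ?g t * indicator {0..} t \<partial>lborel)
        \<le> (\<integral>\<^sup>+ t. ennreal (2 powr s) * (ennreal ((1 + t) powr (- (2 * s))) * indicator {0..} t) \<partial>lborel)"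
    proof (intro nn_integral_mono)
      fix t :: real
      show "?g t * indicator {0..} t \<le> ennreal (2 powr s) * (ennreal ((1 + t) powr (- (2 * s))) * indicator {0..} t)"
      proof (cases "t \<ge> 0")
        case True
        \<comment> \<open>the mean of two squares dominates the square of the mean\<close>
        have "0 \<le> (t - 1)\<^sup>2" by simp
        then have "(1 + t)\<^sup>2 / 2 \<le> 1 + t\<^sup>2" by (simp add: power2_eq_square field_simps)
        then have "(1 + t\<^sup>2) powr (- s) \<le> ((1 + t)\<^sup>2 / 2) powr (- s)"
          using True s by (intro powr_mono2') auto
        also have "((1 + t)\<^sup>2 / 2) powr (- s) = ((1 + t) powr 2) powr (- s) / 2 powr (- s)"
          using True by (simp add: powr_divide)
        also have "\<dots> = 2 powr s * (1 + t) powr (- (2 * s))"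
          by (simp add: powr_powr powr_minus_divide)
        finally have "?g t \<le> ennreal (2 powr s * (1 + t) powr (- (2 * s)))" by (rule ennreal_leI)
        then show ?thesis using True by (simp add: ennreal_mult)
      qed simp
    qed
    also have "\<dots> = ennreal (2 powr s) * (\<integral>\<^sup>+ t. ennreal ((1 + t) powr (- (2 * s))) * indicator {0..} t \<partial>lborel)"
      by (intro nn_integral_cmult) measurable
    also have "(\<integral>\<^sup>+ t. ennreal ((1 + t) powr (- (2 * s))) * indicator {0..} t \<partial>lborel) = ennreal (0 - ?F 0)"
    proof (rule nn_integral_FTC_atLeast)
      show "DERIV ?F t :> (1 + t) powr (- (2 * s))" if "0 \<le> t" for t
      proof -
        have "((\<lambda>t. (1 + t) powr (1 - 2 * s)) has_real_derivative (1 - 2 * s) * (1 + t) powr (- (2 * s))) (at t)"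
          using that by (auto intro!: derivative_eq_intros)
        from DERIV_cdivide[OF this, of "1 - 2 * s"] show ?thesis using s by simp
      qed
      have "((\<lambda>t::real. (1 + t) powr (1 - 2 * s)) \<longlongrightarrow> 0) at_top"
        using s by (intro tendsto_neg_powr filterlim_tendsto_add_at_top[OF tendsto_const] filterlim_ident) auto
      then show "(?F \<longlongrightarrow> 0) at_top" by (rule tendsto_divide_zero)
    qed auto
    finally show ?thesis by (rule le_less_trans) (simp add: ennreal_mult_less_top)
  qed
  have "(\<integral>\<^sup>+ t. ?g t \<partial>lborel) \<le> (\<integral>\<^sup>+ t. ?g t * indicator {0..} t + ?g t * indicator {..0} t \<partial>lborel)"
    by (intro nn_integral_mono) (auto simp: indicator_def)
  also have "\<dots> = (\<integral>\<^sup>+ t. ?g t * indicator {0..} t \<partial>lborel) + (\<integral>\<^sup>+ t. ?g t * indicator {..0} t \<partial>lborel)"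
    by (intro nn_integral_add) measurable
  also have "(\<integral>\<^sup>+ t. ?g t * indicator {..0} t \<partial>lborel) = ennreal \<bar>-1\<bar> * (\<integral>\<^sup>+ t. ?g (0 + (-1) * t) * indicator {..0} (0 + (-1) * t) \<partial>lborel)"
    by (rule nn_integral_real_affine[where f = "\<lambda>t. ?g t * indicator {..0} t"]) auto
  also have "\<dots> = (\<integral>\<^sup>+ t. ?g t * indicator {0..} t \<partial>lborel)"
    by (simp add: indicator_def)
  also have "(\<integral>\<^sup>+ t. ?g t * indicator {0..} t \<partial>lborel) + (\<integral>\<^sup>+ t. ?g t * indicator {0..} t \<partial>lborel) < \<infinity>"
    using half by simp
  finally show ?thesis .
qed

text \<open>Since \<open>1 + |y|\<^sup>2\<close> dominates every \<open>1 + y\<^sub>k\<^sup>2\<close>, the weight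
  is at most the product of the one-dimensional weights with exponent \<open>r / d > 1/2\<close>.\<close>

lemma bessel_weight_finite:
  assumes r: "r > real CARD('d::finite) / 2"
  shows "(\<integral>\<^sup>+ y. ennreal ((1 + (norm (y :: real ^ 'd))\<^sup>2) powr (- r)) \<partial>lborel) < \<infinity>"
proof -
  define s where "s = r / real CARD('d)"
  have s: "s > 1/2" using r by (simp add: s_def field_simps)
  let ?w = "\<lambda>t::real. ennreal ((1 + t\<^sup>2) powr (- s))"
  have [measurable]: "(\<lambda>y :: real ^ 'd. y $ k) \<in> borel_measurable borel" for k
    by (intro borel_measurable_continuous_onI continuous_intros)
  have "(\<integral>\<^sup>+ y. ennreal ((1 + (norm (y :: real ^ 'd))\<^sup>2) powr (- r)) \<partial>lborel) \<le> (\<integral>\<^sup>+ y. (\<Prod>k\<in>UNIV. ?w ((y :: real ^ 'd) $ k)) \<partial>lborel)"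
  proof (intro nn_integral_mono)
    fix y :: "real ^ 'd"
    have le: "(1 + (norm y)\<^sup>2) powr (- s) \<le> (1 + (y $ k)\<^sup>2) powr (- s)" for k
    proof -
      have "\<bar>y $ k\<bar> \<le> norm y" by (rule component_le_norm_cart)
      then have "(y $ k)\<^sup>2 \<le> (norm y)\<^sup>2" by (metis abs_ge_zero power2_abs power_mono)
      then show ?thesis using s by (intro powr_mono2') (auto intro: add_pos_nonneg)
    qed
    have "1 + (norm y)\<^sup>2 > 0" by (intro add_pos_nonneg) auto
    then have "(1 + (norm y)\<^sup>2) powr (- r) = ((1 + (norm y)\<^sup>2) powr (- s)) ^ CARD('d)"
      by (simp add: powr_powr s_def flip: powr_realpow)
    also have "\<dots> = (\<Prod>k\<in>(UNIV :: 'd set). (1 + (norm y)\<^sup>2) powr (- s))" by simp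
    also have "\<dots> \<le> (\<Prod>k\<in>UNIV. (1 + (y $ k)\<^sup>2) powr (- s))"
      by (intro prod_mono conjI le) auto
    finally have "ennreal ((1 + (norm y)\<^sup>2) powr (- r)) \<le> ennreal (\<Prod>k\<in>UNIV. (1 + (y $ k)\<^sup>2) powr (- s))" by (rule ennreal_leI)
    also have "\<dots> = (\<Prod>k\<in>UNIV. ?w (y $ k))" by (intro prod_ennreal[symmetric]) auto
    finally show "ennreal ((1 + (norm y)\<^sup>2) powr (- r)) \<le> (\<Prod>k\<in>UNIV. ?w (y $ k))" .
  qed
  also have "\<dots> = (\<integral>\<^sup>+ f. (\<Prod>k\<in>UNIV. ?w ((\<chi> k. f k) $ k)) \<partial>PiM (UNIV :: 'd set) (\<lambda>_. lborel))"
    by (subst lborel_vec_eq_PiM, rule nn_integral_distr[OF vec_lambda_measurable]) measurable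
  also have "\<dots> = (\<Prod>k\<in>(UNIV :: 'd set). \<integral>\<^sup>+ t. ?w t \<partial>lborel)"
    unfolding vec_lambda_beta by (rule lborel_product.product_nn_integral_prod) auto
  also have "\<dots> < \<infinity>" using bessel_weight_1d_finite[OF s]
    unfolding infinity_ennreal_def less_top[symmetric] ennreal_prod_eq_top by simp
  finally show ?thesis .
qed

lemma frobenius_norm_sq:
  fixes A :: "complex ^ 'd::finite ^ 'd"
  shows "(norm A)\<^sup>2 = (\<Sum>i\<in>UNIV. \<Sum>j\<in>UNIV. (norm (A $ i $ j))\<^sup>2)"
  by (simp add: norm_vec_def L2_set_def sum_nonneg)

lemma matrix_measurable:
  fixes F :: "'x \<Rightarrow> complex ^ 'd::finite ^ 'd"
  assumes "\<And>i j. (\<lambda>x. F x $ i $ j) \<in> borel_measurable N"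
  shows "F \<in> borel_measurable N"
proof (subst borel_measurable_euclidean_space, rule ballI)
  fix b :: "complex ^ 'd ^ 'd" assume "b \<in> Basis"
  then obtain i v where b: "b = axis i v" and v: "v \<in> Basis" by (auto simp: Basis_vec_def)
  from v obtain j c where c: "v = axis j c" by (auto simp: Basis_vec_def)
  have "(\<lambda>x. F x $ i $ j \<bullet> c) \<in> borel_measurable N" using assms by (intro borel_measurable_inner) auto
  then show "(\<lambda>x. F x \<bullet> b) \<in> borel_measurable N" by (simp add: b c inner_axis)
qed

lemma matrix_entry_measurable:
  fixes F :: "'x \<Rightarrow> complex ^ 'd::finite ^ 'd"
  assumes "F \<in> borel_measurable N"
  shows "(\<lambda>x. F x $ i $ j) \<in> borel_measurable N"
  using assms by (rule measurable_compose) (intro borel_measurable_continuous_onI continuous_intros)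

context brownian_sheet_space
begin

lemma fourier_current_version_exists: "\<exists>\<Xi>. fourier_current_version M W \<Xi>"
proof -
  have "\<forall>i j. \<exists>X. X \<in> borel_measurable (borel \<Otimes>\<^sub>M M) \<and> (\<forall>y. chaos_sum M W (fourier_chaos (current_chaos i j) y) (\<lambda>\<omega>. X (y, \<omega>)))"
    using fourier_current_measurable_version by metis
  then obtain X where X: "\<And>i j. X i j \<in> borel_measurable (borel \<Otimes>\<^sub>M M)"
    "\<And>i j y. chaos_sum M W (fourier_chaos (current_chaos i j) y) (\<lambda>\<omega>. X i j (y, \<omega>))" by metis
  have "fourier_current_version M W (\<lambda>y \<omega>. \<chi> i j. X i j (y, \<omega>))"
    unfolding fourier_current_version_def
  proof (intro conjI allI)
    show "(\<lambda>(y, \<omega>). \<chi> i j. X i j (y, \<omega>)) \<in> borel_measurable (borel \<Otimes>\<^sub>M M)"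
      using X(1) by (intro matrix_measurable) (simp add: case_prod_unfold)
  qed (simp add: X(2))
  then show ?thesis by blast
qed

text \<open>The kernels at \<open>- y\<close> are the conjugates of those at \<open>y\<close>, so for each
  \<open>y\<close> the identity holds almost surely by uniqueness of chaos sums; Fubini's theorem exchanges
  the order.\<close>

lemma fourier_current_version_reflect:
  assumes V: "fourier_current_version M W \<Xi>"
  shows "AE \<omega> in M. AE y in lborel. \<forall>i j. \<Xi> (- y) \<omega> $ i $ j = cnj (\<Xi> y \<omega> $ i $ j)"
proof -
  have meas: "(\<lambda>x. \<Xi> (fst x) (snd x)) \<in> borel_measurable (borel \<Otimes>\<^sub>M M)"
    and chaos: "\<And>y i j. chaos_sum M W (fourier_chaos (current_chaos i j) y) (\<lambda>\<omega>. \<Xi> y \<omega> $ i $ j)"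
    using V by (auto simp: fourier_current_version_def case_prod_unfold)
  have meas': "(\<lambda>x. \<Xi> (- fst x) (snd x)) \<in> borel_measurable (borel \<Otimes>\<^sub>M M)"
  proof -
    have "(\<lambda>x. (- fst x, snd x)) \<in> measurable (borel \<Otimes>\<^sub>M M) ((borel :: (real ^ 'd) measure) \<Otimes>\<^sub>M M)" by measurable
    from measurable_compose[OF this meas] show ?thesis by simp
  qed
  interpret P: pair_sigma_finite "lborel :: (real ^ 'd) measure" M ..
  have "AE y in lborel. AE \<omega> in M. \<forall>i j. \<Xi> (- y) \<omega> $ i $ j = cnj (\<Xi> y \<omega> $ i $ j)"
  proof (rule AE_I2)
    fix y :: "real ^ 'd"
    have "AE \<omega> in M. \<Xi> (- y) \<omega> $ i $ j = cnj (\<Xi> y \<omega> $ i $ j)" for i j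
    proof (rule chaos_sum_unique[OF chaos])
      have "fourier_chaos (current_chaos i j) (- y) = (\<lambda>n z. cnj (fourier_chaos (current_chaos i j) y n z))"
        by (intro ext) (simp only: fourier_chaos_def fourier_reflect)
      then show "chaos_sum M W (fourier_chaos (current_chaos i j) (- y)) (\<lambda>\<omega>. cnj (\<Xi> y \<omega> $ i $ j))"
        using chaos_sum_cnj[OF chaos] by simp
    qed
    then show "AE \<omega> in M. \<forall>i j. \<Xi> (- y) \<omega> $ i $ j = cnj (\<Xi> y \<omega> $ i $ j)"
      by (simp add: AE_all_countable)
  qed
  moreover have "{x \<in> space (lborel \<Otimes>\<^sub>M M). \<forall>i j. \<Xi> (- fst x) (snd x) $ i $ j = cnj (\<Xi> (fst x) (snd x) $ i $ j)} \<in> sets (lborel \<Otimes>\<^sub>M M)"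
  proof -
    have sets_eq: "sets (lborel \<Otimes>\<^sub>M M :: ((real ^ 'd) \<times> 'w) measure) = sets (borel \<Otimes>\<^sub>M M)" by (intro sets_pair_measure_cong) auto
    have "{x \<in> space (borel \<Otimes>\<^sub>M M). \<forall>i j. \<Xi> (- fst x) (snd x) $ i $ j = cnj (\<Xi> (fst x) (snd x) $ i $ j)} \<in> sets (borel \<Otimes>\<^sub>M M)"
    proof -
      note [measurable] = matrix_entry_measurable[OF meas] matrix_entry_measurable[OF meas']
      show ?thesis by measurable
    qed
    then show ?thesis using sets_eq sets_eq_imp_space_eq[OF sets_eq] by simp
  qed
  ultimately show ?thesis by (subst (asm) P.AE_commute) auto
qed

text \<open>The energy of each entry is bounded uniformly in \<open>y\<close>, and the weight is integrable.\<close>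

lemma fourier_current_version_sobolev:
  assumes V: "fourier_current_version M W \<Xi>" and r: "r > real CARD('d) / 2"
  shows "AE \<omega> in M. (\<integral>\<^sup>+ y. ennreal ((1 + (norm y)\<^sup>2) powr (- r) * (norm (\<Xi> y \<omega>))\<^sup>2) \<partial>lborel) < \<infinity>"
proof -
  have meas: "(\<lambda>x. \<Xi> (fst x) (snd x)) \<in> borel_measurable (borel \<Otimes>\<^sub>M M)"
    and chaos: "\<And>y i j. chaos_sum M W (fourier_chaos (current_chaos i j) y) (\<lambda>\<omega>. \<Xi> y \<omega> $ i $ j)"
    using V by (auto simp: fourier_current_version_def case_prod_unfold)
  let ?w = "\<lambda>y :: real ^ 'd. (1 + (norm y)\<^sup>2) powr (- r)"
  let ?h = "\<lambda>y \<omega>. ennreal (?w y * (norm (\<Xi> y \<omega>))\<^sup>2)"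
  interpret P: pair_sigma_finite "lborel :: (real ^ 'd) measure" M ..
  have meas_h: "case_prod ?h \<in> borel_measurable (lborel \<Otimes>\<^sub>M M)"
  proof -
    have "case_prod ?h \<in> borel_measurable (borel \<Otimes>\<^sub>M M)"
      unfolding case_prod_unfold using meas by measurable
    moreover have "sets (lborel \<Otimes>\<^sub>M M :: ((real ^ 'd) \<times> 'w) measure) = sets (borel \<Otimes>\<^sub>M M)" by (intro sets_pair_measure_cong) auto
    ultimately show ?thesis by (subst measurable_cong_sets[OF _ refl])
  qed
  have energy: "(\<integral>\<^sup>+ \<omega>. ennreal ((norm (\<Xi> y \<omega>))\<^sup>2) \<partial>M) \<le> of_nat (CARD('d) * CARD('d))" for y
  proof -
    have m: "(\<lambda>\<omega>. \<Xi> y \<omega> $ i $ j) \<in> borel_measurable M" for i j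
      using chaos[of i j y] by (simp add: chaos_sum_def)
    have "(\<integral>\<^sup>+ \<omega>. ennreal ((norm (\<Xi> y \<omega>))\<^sup>2) \<partial>M) = (\<integral>\<^sup>+ \<omega>. (\<Sum>i\<in>UNIV. \<Sum>j\<in>UNIV. ennreal ((norm (\<Xi> y \<omega> $ i $ j))\<^sup>2)) \<partial>M)"
    proof (intro nn_integral_cong)
      fix \<omega>
      have "(\<Sum>i\<in>UNIV. \<Sum>j\<in>UNIV. ennreal ((norm (\<Xi> y \<omega> $ i $ j))\<^sup>2)) = (\<Sum>i\<in>UNIV. ennreal (\<Sum>j\<in>UNIV. (norm (\<Xi> y \<omega> $ i $ j))\<^sup>2))"
        by (intro sum.cong refl sum_ennreal) simp
      also have "\<dots> = ennreal ((norm (\<Xi> y \<omega>))\<^sup>2)"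
        unfolding frobenius_norm_sq by (rule sum_ennreal) (simp add: sum_nonneg)
      finally show "ennreal ((norm (\<Xi> y \<omega>))\<^sup>2) = (\<Sum>i\<in>UNIV. \<Sum>j\<in>UNIV. ennreal ((norm (\<Xi> y \<omega> $ i $ j))\<^sup>2))" ..
    qed
    also have "\<dots> = (\<Sum>i\<in>UNIV. \<integral>\<^sup>+ \<omega>. (\<Sum>j\<in>UNIV. ennreal ((norm (\<Xi> y \<omega> $ i $ j))\<^sup>2)) \<partial>M)"
      using m by (intro nn_integral_sum) measurable
    also have "\<dots> = (\<Sum>i\<in>UNIV. \<Sum>j\<in>UNIV. L2_sq M (\<lambda>\<omega>. \<Xi> y \<omega> $ i $ j))"
      unfolding L2_sq_def using m by (intro sum.cong refl nn_integral_sum) measurable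
    also have "\<dots> \<le> (\<Sum>i\<in>(UNIV :: 'd set). \<Sum>j\<in>(UNIV :: 'd set). 1)"
      by (intro sum_mono fourier_current_energy[OF chaos])
    also have "\<dots> = of_nat (CARD('d) * CARD('d))" by simp
    finally show ?thesis .
  qed
  have "(\<integral>\<^sup>+ \<omega>. (\<integral>\<^sup>+ y. ?h y \<omega> \<partial>lborel) \<partial>M) = (\<integral>\<^sup>+ y. (\<integral>\<^sup>+ \<omega>. ?h y \<omega> \<partial>M) \<partial>lborel)"
    by (rule P.Fubini'[OF meas_h])
  also have "\<dots> \<le> (\<integral>\<^sup>+ y. of_nat (CARD('d) * CARD('d)) * ennreal (?w y) \<partial>lborel)"
  proof (intro nn_integral_mono)
    fix y :: "real ^ 'd"
    have my: "(\<lambda>\<omega>. \<Xi> y \<omega>) \<in> borel_measurable M"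
      using measurable_compose[OF measurable_Pair1'[of y borel M] meas] by simp
    have "(\<integral>\<^sup>+ \<omega>. ?h y \<omega> \<partial>M) = ennreal (?w y) * (\<integral>\<^sup>+ \<omega>. ennreal ((norm (\<Xi> y \<omega>))\<^sup>2) \<partial>M)"
      using my by (simp add: ennreal_mult nn_integral_cmult)
    also have "\<dots> \<le> ennreal (?w y) * of_nat (CARD('d) * CARD('d))"
      by (intro mult_left_mono energy) simp
    finally show "(\<integral>\<^sup>+ \<omega>. ?h y \<omega> \<partial>M) \<le> of_nat (CARD('d) * CARD('d)) * ennreal (?w y)" by (simp only: mult.commute)
  qed
  also have "\<dots> = of_nat (CARD('d) * CARD('d)) * (\<integral>\<^sup>+ y. ennreal (?w y) \<partial>lborel)"
    by (intro nn_integral_cmult) measurable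
  also have "\<dots> < \<infinity>"
    using bessel_weight_finite[OF r] by (simp add: ennreal_mult_less_top of_nat_less_top del: of_nat_mult)
  finally have fin: "(\<integral>\<^sup>+ \<omega>. (\<integral>\<^sup>+ y. ?h y \<omega> \<partial>lborel) \<partial>M) \<noteq> \<infinity>" by simp
  have "(\<lambda>\<omega>. \<integral>\<^sup>+ y. ?h y \<omega> \<partial>lborel) \<in> borel_measurable M"
    using lborel.borel_measurable_nn_integral[of "\<lambda>\<omega> y. ?h y \<omega>" M] measurable_pair_swap[OF meas_h]
    by (simp add: case_prod_unfold)
  from nn_integral_PInf_AE[OF this fin] show ?thesis by eventually_elim (simp add: less_top)
qed

text \<open>The exceptional set is chosen simultaneously for a sequence of exponents that decreases to
  \<open>d / 2\<close>; the weight is decreasing in the exponent.\<close>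

lemma fourier_current_version_neg_sobolev:
  assumes V: "fourier_current_version M W \<Xi>"
  shows "AE \<omega> in M. \<forall>r::real. r > real CARD('d) / 2 \<longrightarrow> (\<lambda>y. \<Xi> y \<omega>) \<in> neg_sobolev_fourier r"
proof -
  define \<rho> where "\<rho> m = real CARD('d) / 2 + 1 / real (Suc m)" for m
  have "AE \<omega> in M. \<forall>m. (\<integral>\<^sup>+ y. ennreal ((1 + (norm y)\<^sup>2) powr (- \<rho> m) * (norm (\<Xi> y \<omega>))\<^sup>2) \<partial>lborel) < \<infinity>"
    unfolding AE_all_countable by (intro allI fourier_current_version_sobolev[OF V]) (simp add: \<rho>_def)
  then show ?thesis
    using fourier_current_version_reflect[OF V] AE_space
  proof eventually_elim
    case (elim \<omega>)
    have "(\<lambda>x. \<Xi> (fst x) (snd x)) \<in> borel_measurable (borel \<Otimes>\<^sub>M M)"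
      using V by (simp add: fourier_current_version_def case_prod_unfold)
    from measurable_compose[OF measurable_Pair2'[OF elim(3)] this]
    have meas: "(\<lambda>y. \<Xi> y \<omega>) \<in> borel_measurable borel" by simp
    show ?case
    proof (intro allI impI)
      fix r :: real assume r: "r > real CARD('d) / 2"
      then obtain m where m: "1 / real (Suc m) < r - real CARD('d) / 2"
        using reals_Archimedean[of "r - real CARD('d) / 2"] by (auto simp: inverse_eq_divide)
      have "(\<integral>\<^sup>+ y. ennreal ((1 + (norm y)\<^sup>2) powr (- r) * (norm (\<Xi> y \<omega>))\<^sup>2) \<partial>lborel)
          \<le> (\<integral>\<^sup>+ y. ennreal ((1 + (norm y)\<^sup>2) powr (- \<rho> m) * (norm (\<Xi> y \<omega>))\<^sup>2) \<partial>lborel)"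
        using m by (intro nn_integral_mono ennreal_leI mult_right_mono powr_mono) (auto simp: \<rho>_def)
      also have "\<dots> < \<infinity>" using elim(1) by blast
      finally show "(\<lambda>y. \<Xi> y \<omega>) \<in> neg_sobolev_fourier r"
        unfolding neg_sobolev_fourier_def using meas elim(2) by blast
    qed
  qed
qed

end

theorem theorem5:
  fixes M :: "'w measure" and W :: "'d::finite \<Rightarrow> real \<times> real \<Rightarrow> 'w \<Rightarrow> real"
  assumes "CARD('d) \<ge> 2" and "brownian_sheet M W"
  shows "(\<exists>\<Xi>. fourier_current_version M W \<Xi>) \<and>
         (\<forall>\<Xi>. fourier_current_version M W \<Xi> \<longrightarrow>
           (AE \<omega> in M. \<forall>r::real. r > real CARD('d) / 2 \<longrightarrow> (\<lambda>y. \<Xi> y \<omega>) \<in> neg_sobolev_fourier r))"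
proof -
  interpret prob_space M using assms(2) by (simp add: brownian_sheet_def)
  interpret brownian_sheet_space M W by standard (rule assms(2))
  show ?thesis
    using fourier_current_version_exists fourier_current_version_neg_sobolev by blast
qed

end
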